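(* Let $r,q\ge 1$ be integers, $n=qr+1$, and let $\underline m=(m_1,\dots,m_{r-1})$ be integers with $1\le m_i\le q$ for all $i$. Let $X=X^{v_{\underline m}}_{w_{r,n}}\subseteq G_{r,n}$ be the Richardson variety associated with $v_{\underline m}=(1,m_1+1,q+m_2+1,\dots,(r-2)q+m_{r-1}+1)$ and $w_{r,n}=(q+1,2q+1,\dots,rq+1)$, let $\mathcal L=\mathcal L(n\omega_r)$, and put $R_k=H^0(X,\mathcal L^{\otimes k})^T$ for $k\ge 0$ and $R=\bigoplus_{k\ge0}R_k$. Then $R$ is generated by $R_1$ as a $\mathbb C$-algebra.
   Context: Setting. $G=SL(n,\mathbb C)$, $T$ is the diagonal maximal torus, $B$ (resp. $B^-$) the upper (resp. lower) triangular subgroup, $P^{\alpha_r}$ the maximal parabolic subgroup containing $B$ corresponding to the simple root $\alpha_r$, and $G/P^{\alpha_r}=G_{r,n}$ is the Grassmannian of $r$-dimensional subspaces of $\mathbb C^n$. The line bundle $\mathcal L(\omega_r)$ is the pullback of $\mathcal O(1)$ under the Plücker embedding $G_{r,n}\hookrightarrow\mathbb P(\wedge^r\mathbb C^n)$, $T$-linearized by restricting the $G$-linearization, and $\mathcal L(n\omega_r)=\mathcal L(\omega_r)^{\otimes n}$; restrictions to subvarieties are denoted the same way. The set $I(r,n)$ of increasing sequences $1\le a_1<\dots<a_r\le n$ with the componentwise order is identified with the set of minimal coset representatives $W^{P^{\alpha_r}}$ with the Bruhat order ("one line notation"). For $v\le w$ in $I(r,n)$, $X(w)=\overline{BwP^{\alpha_r}/P^{\alpha_r}}$,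 $X^v=\overline{B^-vP^{\alpha_r}/P^{\alpha_r}}$, and the Richardson variety is $X^v_w=X(w)\cap X^v$ with its reduced structure. *)

theory Defs
  imports
    "Jordan_Normal_Form.DL_Rank"
    "HOL-Algebra.Generated_Rings"
begin

section \<open>The Grassmannian and its Richardson varieties\<close>

text \<open>
  Members of \<open>index_seqs r n\<close> are 1-based, whereas vectors and matrices are indexed from 0; entry \<open>i\<close> of a
  sequence therefore refers to the basis vector \<open>unit_vec n (i - 1)\<close>.
\<close>

definition index_seqs :: "nat \<Rightarrow> nat \<Rightarrow> nat list set" where
  "index_seqs r n = {a. length a = r \<and> sorted_wrt (<) a \<and> set a \<subseteq> {1..n}}"

definition SL :: "nat \<Rightarrow> complex mat set" where
  "SL n = {g \<in> carrier_mat n n. det g = 1}"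

definition torus :: "nat \<Rightarrow> complex mat set" where
  "torus n = {g \<in> SL n. diagonal_mat g}"

definition borel :: "nat \<Rightarrow> complex mat set" where
  "borel n = {g \<in> SL n. upper_triangular g}"

definition opposite_borel :: "nat \<Rightarrow> complex mat set" where
  "opposite_borel n = {g \<in> SL n. upper_triangular (transpose_mat g)}"

abbreviation std_space :: "nat \<Rightarrow> (complex, complex vec) module" where
  "std_space n \<equiv> module_vec TYPE(complex) n"

definition grassmannian :: "nat \<Rightarrow> nat \<Rightarrow> complex vec set set" where
  "grassmannian r n = {V. VectorSpace.subspace class_ring V (std_space n) \<and>
     vectorspace.dim class_ring (std_space n\<lparr>carrier := V\<rparr>) = r}"

definition coord_subspace :: "nat \<Rightarrow> nat list \<Rightarrow> complex vec set" where
  "coord_subspace n a =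
     LinearCombinations.module.span class_ring (std_space n) ((\<lambda>i. unit_vec n (i - 1)) ` set a)"

text \<open>
  An element of \<open>\<Lambda>\<^sup>r \<complex>\<^sup>n\<close> is given by its coordinates with respect to the basis
  \<open>e\<^sub>a = e\<^sub>a\<^sub>1 \<and> \<dots> \<and> e\<^sub>a\<^sub>r\<close>, \<open>a \<in> index_seqs r n\<close>; coordinates outside \<open>index_seqs r n\<close> are 0.
\<close>

type_synonym wedge = "nat list \<Rightarrow> complex"

definition minor :: "complex mat \<Rightarrow> nat list \<Rightarrow> nat list \<Rightarrow> complex" where
  "minor A a b = det (mat (length a) (length b) (\<lambda>(i, j). A $$ (a ! i - 1, b ! j - 1)))"

definition wedge_cols :: "nat \<Rightarrow> nat \<Rightarrow> complex mat \<Rightarrow> wedge" where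
  "wedge_cols r n M = (\<lambda>a. if a \<in> index_seqs r n then minor M a [1..<Suc r] else 0)"

text \<open>
  The Pluecker embedding sends \<open>V\<close> to the line spanned by \<open>v\<^sub>1 \<and> \<dots> \<and> v\<^sub>r\<close> for a basis \<open>v\<close> of \<open>V\<close>.
  Letting the basis vary gives that line without its origin, since the wedge products of two bases
  differ by an arbitrary nonzero factor (for \<open>r \<ge> 1\<close>).
\<close>

definition pluecker :: "nat \<Rightarrow> nat \<Rightarrow> complex vec set \<Rightarrow> wedge set" where
  "pluecker r n V = {wedge_cols r n M | M. M \<in> carrier_mat n r \<and> vec_space.col_space n M = V}"

definition cone :: "nat \<Rightarrow> nat \<Rightarrow> complex vec set set \<Rightarrow> wedge set" where
  "cone r n X = (\<Union>V\<in>X. pluecker r n V)"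

text \<open>The polynomial functions in the coordinates \<open>x j\<close>, \<open>j \<in> J\<close>, that are homogeneous of degree \<open>d\<close>.\<close>

definition forms :: "'i set \<Rightarrow> nat \<Rightarrow> (('i \<Rightarrow> complex) \<Rightarrow> complex) set" where
  "forms J d = {(\<lambda>x. \<Sum>e\<in>E. c e * (\<Prod>j\<in>J. x j ^ e j)) | E c.
     finite E \<and> (\<forall>e\<in>E. (\<Sum>j\<in>J. e j) = d)}"

definition zariski_closure :: "nat \<Rightarrow> nat \<Rightarrow> complex vec set set \<Rightarrow> complex vec set set" where
  "zariski_closure r n S = {V \<in> grassmannian r n. \<forall>d. \<forall>f\<in>forms (index_seqs r n) d.
     (\<forall>x\<in>cone r n S. f x = 0) \<longrightarrow> (\<forall>x\<in>pluecker r n V. f x = 0)}"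

text \<open>
  Under \<open>G/P = grassmannian r n\<close> the coset \<open>wP\<close> is the coordinate subspace of \<open>w \<in> index_seqs r n\<close>.
\<close>

definition orbit :: "complex mat set \<Rightarrow> complex vec set \<Rightarrow> complex vec set set" where
  "orbit H V = {(\<lambda>v. g *\<^sub>v v) ` V | g. g \<in> H}"

definition schubert :: "nat \<Rightarrow> nat \<Rightarrow> nat list \<Rightarrow> complex vec set set" where
  "schubert r n w = zariski_closure r n (orbit (borel n) (coord_subspace n w))"

definition opposite_schubert :: "nat \<Rightarrow> nat \<Rightarrow> nat list \<Rightarrow> complex vec set set" where
  "opposite_schubert r n v = zariski_closure r n (orbit (opposite_borel n) (coord_subspace n v))"

definition richardson :: "nat \<Rightarrow> nat \<Rightarrow> nat list \<Rightarrow> nat list \<Rightarrow> complex vec set set" where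
  "richardson r n v w = schubert r n w \<inter> opposite_schubert r n v"

section \<open>Sections of line bundles\<close>

definition zariski_open :: "'i set \<Rightarrow> ('i \<Rightarrow> complex) set \<Rightarrow> ('i \<Rightarrow> complex) set \<Rightarrow> bool" where
  "zariski_open J C U \<longleftrightarrow> (\<exists>F \<subseteq> (\<Union>d. forms J d). U = {x\<in>C. \<exists>f\<in>F. f x \<noteq> 0})"

text \<open>
  Let \<open>X\<close> be a (reduced) subvariety of the projective space with homogeneous coordinates indexed by
  \<open>J\<close>, and \<open>C\<close> its affine cone without the origin.  A section of \<open>\<O>(d)\<close> over \<open>X\<close> is a function on
  \<open>C\<close> which locally is a quotient of forms whose degrees differ by \<open>d\<close> (so it is homogeneous of
  degree \<open>d\<close>).  The value 0 off \<open>C\<close> makes the representing function unique.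
\<close>

definition global_sections ::
    "'i set \<Rightarrow> ('i \<Rightarrow> complex) set \<Rightarrow> nat \<Rightarrow> (('i \<Rightarrow> complex) \<Rightarrow> complex) set" where
  "global_sections J C d = {s. (\<forall>x. x \<notin> C \<longrightarrow> s x = 0) \<and>
     (\<forall>x\<in>C. \<exists>U. zariski_open J C U \<and> x \<in> U \<and>
       (\<exists>e. \<exists>f\<in>forms J (d + e). \<exists>g\<in>forms J e. \<forall>y\<in>U. g y \<noteq> 0 \<and> s y = f y / g y))}"

text \<open>
  The action of a matrix on \<open>\<Lambda>\<^sup>r \<complex>\<^sup>n\<close> (by its \<open>r\<close>-th compound).  It induces the linearization of
  \<open>\<L>(\<omega>\<^sub>r)\<close>, for which \<open>(g \<cdot> s) x = s (g\<^sup>-\<^sup>1 \<cdot> x)\<close>.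
\<close>

definition wedge_act :: "nat \<Rightarrow> nat \<Rightarrow> complex mat \<Rightarrow> wedge \<Rightarrow> wedge" where
  "wedge_act r n g x = (\<lambda>a. if a \<in> index_seqs r n then \<Sum>b\<in>index_seqs r n. minor g a b * x b else 0)"

text \<open>\<open>inv_sections r n X d\<close> is \<open>H\<^sup>0(X, \<L>(\<omega>\<^sub>r)\<^sup>\<otimes>\<^sup>d)\<^sup>T\<close>.\<close>

definition inv_sections :: "nat \<Rightarrow> nat \<Rightarrow> complex vec set set \<Rightarrow> nat \<Rightarrow> (wedge \<Rightarrow> complex) set" where
  "inv_sections r n X d = {s \<in> global_sections (index_seqs r n) (cone r n X) d.
     \<forall>t\<in>torus n. \<forall>x\<in>cone r n X. s (wedge_act r n t x) = s x}"

text \<open>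
  The graded ring \<open>\<Oplus>\<^sub>k H\<^sup>0(X, \<L>(n\<omega>\<^sub>r)\<^sup>\<otimes>\<^sup>k)\<^sup>T\<close> as an external direct sum: an element is the family
  of its homogeneous components.
\<close>

definition inv_ring :: "nat \<Rightarrow> nat \<Rightarrow> complex vec set set \<Rightarrow> (nat \<Rightarrow> wedge \<Rightarrow> complex) ring" where
  "inv_ring r n X =
     \<lparr>carrier = {s. (\<forall>k. s k \<in> inv_sections r n X (n * k)) \<and> finite {k. s k \<noteq> (\<lambda>_. 0)}},
      monoid.mult = (\<lambda>s t k x. \<Sum>i\<le>k. s i x * t (k - i) x),
      one = (\<lambda>k x. if k = 0 \<and> x \<in> cone r n X then 1 else 0),
      zero = (\<lambda>k x. 0),
      add = (\<lambda>s t k x. s k x + t k x)\<rparr>"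

definition scalars :: "nat \<Rightarrow> nat \<Rightarrow> complex vec set set \<Rightarrow> (nat \<Rightarrow> wedge \<Rightarrow> complex) set" where
  "scalars r n X = {(\<lambda>k x. if k = 0 \<and> x \<in> cone r n X then c else 0) | c. True}"

definition graded_piece ::
    "nat \<Rightarrow> nat \<Rightarrow> complex vec set set \<Rightarrow> nat \<Rightarrow> (nat \<Rightarrow> wedge \<Rightarrow> complex) set" where
  "graded_piece r n X k = {s \<in> carrier (inv_ring r n X). \<forall>i. i \<noteq> k \<longrightarrow> s i = (\<lambda>_. 0)}"

text \<open>The \<open>\<complex>\<close>-subalgebra generated by \<open>H\<close> is the subring generated by \<open>H\<close> and the scalars.\<close>

definition generated_algebra ::
    "nat \<Rightarrow> nat \<Rightarrow> complex vec set set \<Rightarrow> (nat \<Rightarrow> wedge \<Rightarrow> complex) set \<Rightarrow>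
     (nat \<Rightarrow> wedge \<Rightarrow> complex) set" where
  "generated_algebra r n X H = generate_ring (inv_ring r n X) (scalars r n X \<union> H)"

section \<open>The two index sequences\<close>

definition v_seq :: "nat \<Rightarrow> nat \<Rightarrow> (nat \<Rightarrow> nat) \<Rightarrow> nat list" where
  "v_seq r q m = 1 # map (\<lambda>i. (i - 1) * q + m i + 1) [1..<r]"

definition w_seq :: "nat \<Rightarrow> nat \<Rightarrow> nat list" where
  "w_seq r q = map (\<lambda>i. i * q + 1) [1..<Suc r]"

end

theory Submission
  imports "HOL-Complex_Analysis.Cauchy_Integral_Formula" Defs
begin

text \<open>
  Count rows and columns from 0 and let row \<open>i\<close> of an \<open>r \<times> n\<close> matrix be supported on the interval from
  \<open>lo i\<close> to \<open>hi i\<close> whose ends are given by the \<open>i\<close>-th entries of \<open>v\<close> and \<open>w\<close>.  The row span of such a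
  band matrix lies in the Richardson variety \<open>X\<close>, and a generic point of \<open>X\<close> arises in this way.  For
  the sequences at hand an interval meets only its two neighbours: every column \<open>j\<close> has an owner,
  the first row whose interval contains it, and besides it lies at most in the interval of the next
  row.  A band matrix thus consists of the entries \<open>\<alpha> j\<close> of the owners and of the entries \<open>\<beta> j\<close> of the next
  rows on the overlaps of the intervals.

  Let \<open>s\<close> be an invariant section of degree \<open>n * k\<close>.  Scaling the columns and the rows of a band matrix
  shows that \<open>s\<close> is \<open>(\<Prod>j. \<alpha> j) ^ (r * k) * \<Phi> (\<beta> / \<alpha>)\<close>, where \<open>\<Phi>\<close> is entire and homogeneous of degree
  \<open>k * (r - 1 - i)\<close> in the variables of the \<open>i\<close>-th overlap.  Such a function is a polynomial, by
  Liouville's theorem in each variable, so \<open>s\<close> is a combination of monomials in \<open>\<alpha>\<close> and \<open>\<beta>\<close>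
  (\<open>section_expansion\<close>).  In other words, the quotient of \<open>X\<close> by the torus is a product of projective
  spaces, and \<open>s\<close> is a section of \<open>\<O>(k * (r - 1), \<dots>, k)\<close> there.  A monomial of level \<open>k + 1\<close> is the
  product of one of level 1 and one of level \<open>k\<close> (\<open>exponents_split\<close>), and one of level 1 is the
  restriction of a product of \<open>n\<close> Pluecker coordinates (\<open>monomial_section_on_band\<close>).  This proves the
  claim on band matrices.

  It remains to control the other points of \<open>X\<close>.  A point that does not come from a band matrix with
  nonzero \<open>\<alpha> (hi i)\<close> for all \<open>i\<close> is unstable: it meets some coordinate subspace in too large a dimension
  (\<open>cone_point_on_band_or_unstable\<close>).  A suitable one-parameter subgroup moves the Pluecker vector of
  such a point to 0 while the line that it spans converges in \<open>X\<close>, so that invariant sections of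
  positive degree vanish there.  In degree 0 the same degeneration carries any point to a coordinate
  subspace, which is a limit of band matrices with nonzero \<open>\<alpha> (hi i)\<close>; hence an invariant
  section of degree 0 is constant.
\<close>

(* Some names and the notation for components denote matrices and vectors over finite index types in
   the analysis theories; below they are those of matrices of explicit dimension. *)
hide_const (open) Determinants.det Finite_Cartesian_Product.mat Finite_Cartesian_Product.vec
  Finite_Cartesian_Product.row up_ring.coeff up_ring.monom module.smult
hide_fact (open) Determinants.det_permute_rows Determinants.det_identical_rows
no_notation Finite_Cartesian_Product.vec.vec_nth (infixl \<open>$\<close> 90)

section \<open>Determinants of selected rows\<close>

text \<open>
  The minor of the \<open>r\<close> vectors \<open>M 0, \<dots>, M (r - 1)\<close> in the coordinates \<open>c 0, \<dots>, c (r - 1)\<close>.  Vectors and choices of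
  coordinates are plain functions because most arguments below change a single vector or coordinate.
\<close>

definition rdet :: "nat \<Rightarrow> (nat \<Rightarrow> nat \<Rightarrow> complex) \<Rightarrow> (nat \<Rightarrow> nat) \<Rightarrow> complex" where
  "rdet r M c = det (mat r r (\<lambda>(p, l). M l (c p)))"

lemma rdet_cong:
  assumes "\<And>l p. l < r \<Longrightarrow> p < r \<Longrightarrow> M l (c p) = M' l (c' p)"
  shows "rdet r M c = rdet r M' c'"
  unfolding rdet_def by (rule arg_cong[where f = det]) (auto intro!: eq_matI simp: assms)

lemma rdet_leibniz:
  "rdet r M c = (\<Sum>\<sigma> | \<sigma> permutes {0..<r}. signof \<sigma> * (\<Prod>p = 0..<r. M (\<sigma> p) (c p)))"
proof -
  have "(\<Prod>p = 0..<r. mat r r (\<lambda>(p, l). M l (c p)) $$ (p, \<sigma> p)) = (\<Prod>p = 0..<r. M (\<sigma> p) (c p))"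
    if "\<sigma> permutes {0..<r}" for \<sigma>
  proof (rule prod.cong[OF refl])
    fix p assume "p \<in> {0..<r}"
    then have "\<sigma> p < r" "p < r" using permutes_in_image[OF that, of p] by auto
    then show "mat r r (\<lambda>(p, l). M l (c p)) $$ (p, \<sigma> p) = M (\<sigma> p) (c p)" by simp
  qed
  then show ?thesis
    unfolding rdet_def by (subst det_def'[of _ r]) (auto intro!: sum.cong)
qed

text \<open>
  By counting, every term of the expansion has a factor in the rectangle.
\<close>

lemma rdet_eq_0_of_zero_rectangle:
  assumes P: "P \<subseteq> {0..<r}" and L: "L \<subseteq> {0..<r}" and card: "r < card P + card L"
    and 0: "\<And>p l. p \<in> P \<Longrightarrow> l \<in> L \<Longrightarrow> M l (c p) = 0"
  shows "rdet r M c = 0"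
proof -
  have "(\<Prod>p = 0..<r. M (\<sigma> p) (c p)) = 0" if s: "\<sigma> permutes {0..<r}" for \<sigma>
  proof -
    have "\<exists>p\<in>P. \<sigma> p \<in> L"
    proof (rule ccontr)
      assume "\<not> ?thesis"
      then have "\<sigma> ` P \<subseteq> {0..<r} - L" using P permutes_in_image[OF s] by blast
      then have "card (\<sigma> ` P) \<le> card ({0..<r} - L)" by (intro card_mono) auto
      moreover have "card (\<sigma> ` P) = card P" using permutes_inj_on[OF s] by (rule card_image)
      moreover have "card ({0..<r} - L) = r - card L"
        using L by (simp add: card_Diff_subset finite_subset)
      moreover have "card L \<le> r" using card_mono[OF _ L] by simp
      moreover have "card P \<le> r" using card_mono[OF _ P] by simp
      ultimately show False using card by linarith
    qed
    then obtain p where "p \<in> P" "\<sigma> p \<in> L" by blast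
    then show ?thesis using 0 P by (intro prod_zero) (auto intro!: bexI[of _ p])
  qed
  then show ?thesis unfolding rdet_leibniz by (intro sum.neutral) auto
qed

lemma rdet_eq_0_of_zero_block:
  assumes "i < r" and "\<And>p l. i \<le> p \<Longrightarrow> p < r \<Longrightarrow> l \<le> i \<Longrightarrow> M l (c p) = 0"
  shows "rdet r M c = 0"
  by (rule rdet_eq_0_of_zero_rectangle[of "{i..<r}" r "{..i}"]) (use assms in auto)

lemma rdet_eq_0_of_zero_block':
  assumes "i < r" and "\<And>p l. p \<le> i \<Longrightarrow> i \<le> l \<Longrightarrow> l < r \<Longrightarrow> M l (c p) = 0"
  shows "rdet r M c = 0"
  by (rule rdet_eq_0_of_zero_rectangle[of "{..i}" r "{i..<r}"]) (use assms in auto)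

lemma rdet_triangular:
  assumes "\<And>p l. l < p \<Longrightarrow> p < r \<Longrightarrow> M l (c p) = 0"
  shows "rdet r M c = (\<Prod>p<r. M p (c p))"
proof -
  have "det (mat r r (\<lambda>(p, l). M l (c p)))
      = prod_list (diag_mat (mat r r (\<lambda>(p, l). M l (c p))))"
    by (rule det_upper_triangular[of _ r]) (auto simp: upper_triangular_def assms)
  also have "\<dots> = (\<Prod>p<r. M p (c p))"
    by (simp add: diag_mat_def prod.list_conv_set_nth atLeast0LessThan)
  finally show ?thesis unfolding rdet_def .
qed

lemma rdet_block:
  assumes "i \<le> r" and "\<And>p l. i \<le> p \<Longrightarrow> p < r \<Longrightarrow> l < i \<Longrightarrow> M l (c p) = 0"
  shows "rdet r M c = rdet i M c * rdet (r - i) (\<lambda>l. M (l + i)) (\<lambda>p. c (p + i))"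
proof -
  let ?A = "mat i i (\<lambda>(p, l). M l (c p))" and ?D = "mat (r-i) (r-i) (\<lambda>(p, l). M (l+i) (c (p+i)))"
  let ?B = "mat i (r-i) (\<lambda>(p, l). M (l+i) (c p))"
  have eq: "mat r r (\<lambda>(p, l). M l (c p)) = four_block_mat ?A ?B (0\<^sub>m (r-i) i) ?D"
    using assms by (intro eq_matI) (auto simp: four_block_mat_def Let_def)
  show ?thesis unfolding rdet_def eq
    by (rule det_four_block_mat_lower_left_zero) auto
qed

lemma rdet_mult:
  "rdet r (\<lambda>l j. \<Sum>h<r. C l h * M h j) c = det (mat r r (\<lambda>(l, h). C l h)) * rdet r M c"
proof -
  let ?C = "mat r r (\<lambda>(l, h). C l h)"
  have "mat r r (\<lambda>(p, l). \<Sum>h<r. C l h * M h (c p)) = mat r r (\<lambda>(p, l). M l (c p)) * transpose_mat ?C"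
    by (intro eq_matI) (auto simp: scalar_prod_def atLeast0LessThan mult.commute intro!: sum.cong)
  then show ?thesis unfolding rdet_def
    by (simp add: det_mult[of _ r] det_transpose[of _ r] mult.commute)
qed

lemma rdet_eq_0_of_repeat:
  assumes "p < r" "p' < r" "p \<noteq> p'" "c p = c p'"
  shows "rdet r M c = 0"
  unfolding rdet_def using assms
  by (intro det_identical_rows[of _ r p p']) (auto intro!: eq_vecI)

text \<open>
  Expanding along the row that carries the coordinate \<open>j\<close> shows that, as a vector in \<open>j\<close>, the minor is a
  combination of the vectors \<open>M h\<close>.  This is how explicit vectors of a subspace are produced from its
  Pluecker coordinates.
\<close>

lemma rdet_contraction:
  assumes "i < r"
  shows "\<exists>C. (\<forall>j. rdet r M (c(i := j)) = (\<Sum>h<r. C h * M h j))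
    \<and> C (r - 1) = (-1) ^ (i + (r - 1)) * det (mat_delete (mat r r (\<lambda>(p, l). M l (c p))) i (r - 1))"
proof -
  define A where "A = (\<lambda>j. mat r r (\<lambda>(p, l). M l ((c(i := j)) p)))"
  let ?A0 = "mat r r (\<lambda>(p, l). M l (c p))"
  have del: "mat_delete (A j) i h = mat_delete ?A0 i h" for j h
    by (intro eq_matI) (auto simp: mat_delete_def A_def)
  have "det (A j) = (\<Sum>h<r. A j $$ (i,h) * cofactor (A j) i h)" for j
    by (rule laplace_expansion_row) (use assms in \<open>auto simp: A_def\<close>)
  also have "(\<Sum>h<r. A j $$ (i,h) * cofactor (A j) i h)
      = (\<Sum>h<r. ((-1) ^ (i + h) * det (mat_delete ?A0 i h)) * M h j)" for j
    unfolding cofactor_def del using assms by (intro sum.cong) (auto simp: A_def)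
  finally have "rdet r M (c(i := j)) = (\<Sum>h<r. ((-1) ^ (i + h) * det (mat_delete ?A0 i h)) * M h j)" for j
    by (simp only: rdet_def A_def)
  then show ?thesis by (intro exI[of _ "\<lambda>h. (-1) ^ (i + h) * det (mat_delete ?A0 i h)"]) auto
qed

lemma rdet_sort:
  assumes "rdet r M c \<noteq> 0"
  shows "\<exists>a. length a = r \<and> sorted_wrt (<) a \<and> set a = c ` {..<r} \<and> rdet r M ((!) a) \<noteq> 0"
proof -
  have inj: "inj_on c {..<r}"
    using rdet_eq_0_of_repeat[of _ r _ c M] assms by (auto simp: inj_on_def)
  define a where "a = sorted_list_of_set (c ` {..<r})"
  have set_a: "set a = c ` {..<r}" by (simp add: a_def)
  have len: "length a = r" using inj by (simp add: a_def card_image)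
  have sorted: "sorted_wrt (<) a" by (simp add: a_def)
  have "mset a = mset (map c [0..<r])"
    using inj by (intro set_eq_iff_mset_eq_distinct[THEN iffD1])
      (auto simp: a_def distinct_map atLeast0LessThan)
  then obtain p where p: "p permutes {..<length a}" "permute_list p a = map c [0..<r]"
    by (metis mset_eq_permutation)
  have ap: "a ! p k = c k" if "k < r" for k
    using p that len by (metis add_0 diff_zero length_upt nth_map nth_upt permute_list_nth)
  have pr: "p permutes {0..<r}" using p(1) len by (simp add: atLeast0LessThan)
  have plt: "p k < r" if "k < r" for k
    using permutes_in_image[OF pr, of k] that by simp
  have "mat r r (\<lambda>(k, l). M l (c k))
     = mat r r (\<lambda>(k, l). mat r r (\<lambda>(p, l). M l (a ! p)) $$ (p k, l))"
    by (intro eq_matI) (auto simp: ap plt)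
  then have "rdet r M c = signof p * rdet r M ((!) a)"
    unfolding rdet_def using det_permute_rows[OF _ pr, of "mat r r (\<lambda>(p, l). M l (a ! p))"] by simp
  then show ?thesis using assms len sorted set_a by (intro exI[of _ a]) auto
qed

text \<open>
  Induction on the number of vectors: a nonzero minor of all but the last vector is the coefficient of the
  last vector in a contraction, which therefore does not vanish.
\<close>

lemma ex_rdet_nonzero:
  assumes "\<And>v. (\<And>j. j < n \<Longrightarrow> (\<Sum>l<r. v l * M l j) = 0) \<Longrightarrow> (\<And>l. l < r \<Longrightarrow> v l = (0::complex))"
  shows "\<exists>c. (\<forall>p<r. c p < n) \<and> rdet r M c \<noteq> 0"
  using assms
proof (induction r)
  case 0
  show ?case by (auto simp: rdet_leibniz)
next
  case (Suc r)
  have "\<exists>c. (\<forall>p<r. c p < n) \<and> rdet r M c \<noteq> 0"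
  proof (rule Suc.IH)
    fix v l assume v: "\<And>j. j < n \<Longrightarrow> (\<Sum>l<r. v l * M l j) = 0" and "l < r"
    have "(v(r := 0)) l = 0"
      by (rule Suc.prems) (use v \<open>l < r\<close> in auto)
    then show "v l = 0" using \<open>l < r\<close> by simp
  qed
  then obtain c where c: "\<forall>p<r. c p < n" "rdet r M c \<noteq> 0" by blast
  obtain C where C: "\<And>j. rdet (Suc r) M (c(r := j)) = (\<Sum>h<Suc r. C h * M h j)"
    "C r = (-1) ^ (r + r) * det (mat_delete (mat (Suc r) (Suc r) (\<lambda>(p, l). M l (c p))) r r)"
    using rdet_contraction[of r "Suc r" M c] by auto
  have "mat_delete (mat (Suc r) (Suc r) (\<lambda>(p, l). M l (c p))) r r = mat r r (\<lambda>(p, l). M l (c p))"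
    by (intro eq_matI) (auto simp: mat_delete_def)
  then have "C r = rdet r M c" using C(2) unfolding rdet_def by (simp flip: mult_2)
  then have "\<exists>j<n. (\<Sum>h<Suc r. C h * M h j) \<noteq> 0"
    using Suc.prems[of C r] c(2) by auto
  then obtain j where "j < n" "rdet (Suc r) M (c(r := j)) \<noteq> 0" unfolding C(1) by auto
  moreover have "\<forall>p<Suc r. (c(r := j)) p < n" using c(1) \<open>j < n\<close> by (auto simp: less_Suc_eq)
  ultimately show ?case by blast
qed

section \<open>Forms and global sections\<close>

lemma finite_index_seqs: "finite (index_seqs r n)"
  by (rule finite_subset[OF _ finite_lists_length_eq[of "{1..n}" r]]) (auto simp: index_seqs_def)

text \<open>
  The exponents \<open>h p\<close> may repeat; equal ones are collected.
\<close>

lemma formsI: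
  fixes h :: "'p \<Rightarrow> 'i \<Rightarrow> nat" and J :: "'i set"
  assumes "finite P" and "\<And>p. p \<in> P \<Longrightarrow> (\<Sum>j\<in>J. h p j) = d"
  shows "(\<lambda>x. \<Sum>p\<in>P. k p * (\<Prod>j\<in>J. x j ^ h p j)) \<in> forms J d"
proof -
  have "(\<Sum>p\<in>P. k p * (\<Prod>j\<in>J. x j ^ h p j))
      = (\<Sum>e\<in>h ` P. (\<Sum>p | p \<in> P \<and> h p = e. k p) * (\<Prod>j\<in>J. x j ^ e j))" for x :: "'i \<Rightarrow> complex"
    by (subst sum.image_gen[OF assms(1), of _ h]) (auto simp: sum_distrib_right intro!: sum.cong)
  then show ?thesis unfolding forms_def using assms
    by (auto intro!: exI[of _ "h ` P"] exI[of _ "\<lambda>e. (\<Sum>p | p \<in> P \<and> h p = e. k p)"])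
qed

lemma formsE:
  assumes "f \<in> forms J d"
  obtains E c where "finite E" "\<forall>e\<in>E. (\<Sum>j\<in>J. e j) = d"
    "f = (\<lambda>x. \<Sum>e\<in>E. c e * (\<Prod>j\<in>J. x j ^ e j))"
  using assms unfolding forms_def by blast

lemma forms_const: "(\<lambda>x. c) \<in> forms J 0"
  using formsI[where P = "{()}" and h = "\<lambda>_ _. 0" and k = "\<lambda>_. c"] by simp

lemma forms_coord: "finite J \<Longrightarrow> a \<in> J \<Longrightarrow> (\<lambda>x. x a) \<in> forms J 1"
proof -
  assume J: "finite J" "a \<in> J"
  have "(\<Prod>j\<in>J. x j ^ (if j = a then 1 else 0)) = x a" for x :: "'a \<Rightarrow> complex"
    using J by (subst prod.remove[of _ a]) (auto intro!: prod.neutral)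
  then show ?thesis using J formsI[where P = "{()}" and J = J and h = "\<lambda>_ j. if j = a then 1 else 0" and d = 1 and k = "\<lambda>_. 1"] by simp
qed

lemma forms_add:
  assumes "f \<in> forms J d" "g \<in> forms J d"
  shows "(\<lambda>x. f x + g x) \<in> forms J d"
proof -
  obtain E c where f: "finite E" "\<forall>e\<in>E. (\<Sum>j\<in>J. e j) = d"
    "f = (\<lambda>x. \<Sum>e\<in>E. c e * (\<Prod>j\<in>J. x j ^ e j))" by (rule formsE[OF assms(1)])
  obtain E' c' where g: "finite E'" "\<forall>e\<in>E'. (\<Sum>j\<in>J. e j) = d"
    "g = (\<lambda>x. \<Sum>e\<in>E'. c' e * (\<Prod>j\<in>J. x j ^ e j))" by (rule formsE[OF assms(2)])
  have "(\<lambda>x. \<Sum>p\<in>E <+> E'. case_sum c c' p * (\<Prod>j\<in>J. x j ^ case_sum id id p j)) \<in> forms J d"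
    by (rule formsI) (use f(1,2) g(1,2) in auto)
  then show ?thesis using f(1) g(1) by (simp add: f(3) g(3) sum.Plus o_def)
qed

lemma forms_mult:
  assumes "f \<in> forms J d" "g \<in> forms J d'"
  shows "(\<lambda>x. f x * g x) \<in> forms J (d + d')"
proof -
  obtain E c where f: "finite E" "\<forall>e\<in>E. (\<Sum>j\<in>J. e j) = d"
    "f = (\<lambda>x. \<Sum>e\<in>E. c e * (\<Prod>j\<in>J. x j ^ e j))" by (rule formsE[OF assms(1)])
  obtain E' c' where g: "finite E'" "\<forall>e\<in>E'. (\<Sum>j\<in>J. e j) = d'"
    "g = (\<lambda>x. \<Sum>e\<in>E'. c' e * (\<Prod>j\<in>J. x j ^ e j))" by (rule formsE[OF assms(2)])
  have "(\<lambda>x. \<Sum>p\<in>E \<times> E'. (c (fst p) * c' (snd p)) * (\<Prod>j\<in>J. x j ^ (fst p j + snd p j))) \<in> forms J (d + d')"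
    by (rule formsI) (use f(1,2) g(1,2) in \<open>auto simp: sum.distrib\<close>)
  also have "(\<lambda>x. \<Sum>p\<in>E \<times> E'. (c (fst p) * c' (snd p)) * (\<Prod>j\<in>J. x j ^ (fst p j + snd p j))) = (\<lambda>x. f x * g x)"
    by (simp only: f(3) g(3) sum_product sum.cartesian_product case_prod_unfold power_add prod.distrib) (simp add: mult_ac)
  finally show ?thesis .
qed

lemma forms_prod:
  assumes "finite I" "\<And>i. i \<in> I \<Longrightarrow> f i \<in> forms J (d i)"
  shows "(\<lambda>x. \<Prod>i\<in>I. f i x) \<in> forms J (\<Sum>i\<in>I. d i)"
  using assms by (induction I rule: finite_induct) (auto intro: forms_const forms_mult)

lemma forms_scale:
  assumes "f \<in> forms J d"
  shows "f (\<lambda>j. c * x j) = c ^ d * f x"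
proof -
  obtain E k where f: "finite E" "\<forall>e\<in>E. (\<Sum>j\<in>J. e j) = d"
    "f = (\<lambda>x. \<Sum>e\<in>E. k e * (\<Prod>j\<in>J. x j ^ e j))" by (rule formsE[OF assms(1)])
  have "(\<Prod>j\<in>J. (c * x j) ^ e j) = c ^ d * (\<Prod>j\<in>J. x j ^ e j)" if "e \<in> E" for e
    using f(2) that by (auto simp: power_mult_distrib prod.distrib power_sum)
  then show ?thesis by (simp add: f(3) sum_distrib_left mult_ac)
qed

lemma forms_rescale:
  assumes "f \<in> forms J d"
  shows "(\<lambda>x. f (\<lambda>j. t j * x j)) \<in> forms J d"
proof -
  obtain E k where f: "finite E" "\<forall>e\<in>E. (\<Sum>j\<in>J. e j) = d"
    "f = (\<lambda>x. \<Sum>e\<in>E. k e * (\<Prod>j\<in>J. x j ^ e j))" by (rule formsE[OF assms(1)])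
  have "(\<lambda>x. \<Sum>e\<in>E. (k e * (\<Prod>j\<in>J. t j ^ e j)) * (\<Prod>j\<in>J. x j ^ e j)) \<in> forms J d"
    by (rule formsI) (use f(1,2) in auto)
  then show ?thesis by (simp add: f(3) power_mult_distrib prod.distrib mult_ac)
qed

lemma forms_cong:
  assumes "f \<in> forms J d" "\<And>j. j \<in> J \<Longrightarrow> x j = y j"
  shows "f x = f y"
proof -
  obtain E k where f: "f = (\<lambda>x. \<Sum>e\<in>E. k e * (\<Prod>j\<in>J. x j ^ e j))" using formsE[OF assms(1)] by blast
  show ?thesis unfolding f using assms(2) by simp
qed

lemma forms_holomorphic:
  assumes "f \<in> forms J d" "\<And>j. j \<in> J \<Longrightarrow> (\<lambda>z. x z j) holomorphic_on S"
  shows "(\<lambda>z. f (x z)) holomorphic_on S"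
proof -
  obtain E k where f: "f = (\<lambda>x. \<Sum>e\<in>E. k e * (\<Prod>j\<in>J. x j ^ e j))" using formsE[OF assms(1)] by blast
  show ?thesis unfolding f by (intro holomorphic_intros assms(2))
qed

lemma zariski_open_whole: "zariski_open J C C"
  unfolding zariski_open_def using forms_const[of 1 J]
  by (intro exI[of _ "{\<lambda>_. 1}"]) auto

lemma zariski_open_Int:
  assumes "zariski_open J C U" "zariski_open J C V"
  shows "zariski_open J C (U \<inter> V)"
proof -
  obtain F where F: "F \<subseteq> (\<Union>d. forms J d)" "U = {x\<in>C. \<exists>f\<in>F. f x \<noteq> 0}"
    using assms(1) unfolding zariski_open_def by blast
  obtain G where G: "G \<subseteq> (\<Union>d. forms J d)" "V = {x\<in>C. \<exists>f\<in>G. f x \<noteq> 0}"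
    using assms(2) unfolding zariski_open_def by blast
  let ?H = "{(\<lambda>x. f x * g x) | f g. f \<in> F \<and> g \<in> G}"
  have "?H \<subseteq> (\<Union>d. forms J d)"
    using F(1) G(1) forms_mult by (fastforce simp: subset_iff)
  moreover have "U \<inter> V = {x\<in>C. \<exists>f\<in>?H. f x \<noteq> 0}"
    unfolding F(2) G(2) by fastforce
  ultimately show ?thesis unfolding zariski_open_def by blast
qed

lemma global_sectionsE:
  assumes "s \<in> global_sections J C d" "x \<in> C"
  obtains U e f g where "zariski_open J C U" "x \<in> U" "f \<in> forms J (d + e)" "g \<in> forms J e"
    "\<forall>y\<in>U. g y \<noteq> 0" "\<forall>y\<in>U. s y = f y / g y"
proof -
  have "\<forall>x\<in>C. \<exists>U. zariski_open J C U \<and> x \<in> U \<and>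
      (\<exists>e. \<exists>f\<in>forms J (d + e). \<exists>g\<in>forms J e. \<forall>y\<in>U. g y \<noteq> 0 \<and> s y = f y / g y)"
    using assms(1) unfolding global_sections_def by simp
  from bspec[OF this assms(2)] obtain U e f g where U: "zariski_open J C U" "x \<in> U"
    and fg: "f \<in> forms J (d + e)" "g \<in> forms J e" "\<forall>y\<in>U. g y \<noteq> 0 \<and> s y = f y / g y"
    by - (elim exE bexE conjE, rule that)
  show ?thesis by (rule that[OF U fg(1,2)]) (use fg(3) in auto)
qed

lemma global_sections_outside: "s \<in> global_sections J C d \<Longrightarrow> x \<notin> C \<Longrightarrow> s x = 0"
  unfolding global_sections_def by blast

lemma global_sectionsI:
  assumes "\<And>x. x \<notin> C \<Longrightarrow> s x = 0"
    and "\<And>x. x \<in> C \<Longrightarrow> \<exists>U e f g. zariski_open J C U \<and> x \<in> U \<and> f \<in> forms J (d + e) \<and> g \<in> forms J e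
      \<and> (\<forall>y\<in>U. g y \<noteq> 0 \<and> s y = f y / g y)"
  shows "s \<in> global_sections J C d"
  unfolding global_sections_def
proof (intro CollectI conjI allI impI ballI)
  fix x assume "x \<in> C"
  from assms(2)[OF this] obtain U e f g where "zariski_open J C U" "x \<in> U"
    "f \<in> forms J (d + e)" "g \<in> forms J e" "\<forall>y\<in>U. g y \<noteq> 0 \<and> s y = f y / g y"
    by - (elim exE conjE, rule that)
  then show "\<exists>U. zariski_open J C U \<and> x \<in> U \<and>
      (\<exists>e. \<exists>f\<in>forms J (d + e). \<exists>g\<in>forms J e. \<forall>y\<in>U. g y \<noteq> 0 \<and> s y = f y / g y)"
    by (intro exI[of _ U] exI[of _ e] conjI bexI[of _ f] bexI[of _ g])
qed (rule assms(1))

lemma form_global_section: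
  assumes "f \<in> forms J d"
  shows "(\<lambda>x. if x \<in> C then f x else 0) \<in> global_sections J C d"
proof (rule global_sectionsI)
  fix x assume "x \<in> C"
  define G :: "('a \<Rightarrow> complex) \<Rightarrow> complex" where "G = (\<lambda>_. 1)"
  have "G \<in> forms J 0" unfolding G_def by (rule forms_const)
  moreover have "\<forall>y\<in>C. G y \<noteq> 0 \<and> (if y \<in> C then f y else 0) = f y / G y" by (simp add: G_def)
  moreover have "f \<in> forms J (d + 0)" using assms by simp
  ultimately show "\<exists>U e f' g. zariski_open J C U \<and> x \<in> U \<and> f' \<in> forms J (d + e) \<and> g \<in> forms J e
      \<and> (\<forall>y\<in>U. g y \<noteq> 0 \<and> (if y \<in> C then f y else 0) = f' y / g y)"
    using zariski_open_whole \<open>x \<in> C\<close> by blast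
qed auto

lemma global_sections_add:
  assumes "s \<in> global_sections J C d" "t \<in> global_sections J C d"
  shows "(\<lambda>x. s x + t x) \<in> global_sections J C d"
proof (rule global_sectionsI)
  fix x assume x: "x \<in> C"
  obtain U e f g where 1: "zariski_open J C U" "x \<in> U" "f \<in> forms J (d + e)" "g \<in> forms J e"
    "\<forall>y\<in>U. g y \<noteq> 0" "\<forall>y\<in>U. s y = f y / g y" by (rule global_sectionsE[OF assms(1) x])
  obtain U' e' f' g' where 2: "zariski_open J C U'" "x \<in> U'" "f' \<in> forms J (d + e')" "g' \<in> forms J e'"
    "\<forall>y\<in>U'. g' y \<noteq> 0" "\<forall>y\<in>U'. t y = f' y / g' y" by (rule global_sectionsE[OF assms(2) x])
  define F where "F = (\<lambda>x. f x * g' x + g x * f' x)"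
  define G where "G = (\<lambda>x. g x * g' x)"
  have F: "F \<in> forms J (d + (e + e'))" unfolding F_def
    using forms_mult[OF 1(3) 2(4)] forms_mult[OF 1(4) 2(3)] by (intro forms_add) (simp_all add: add_ac)
  have G: "G \<in> forms J (e + e')" unfolding G_def by (rule forms_mult[OF 1(4) 2(4)])
  have "\<forall>y\<in>U \<inter> U'. G y \<noteq> 0 \<and> s y + t y = F y / G y"
    using 1(5,6) 2(5,6) by (simp add: F_def G_def add_frac_eq mult.commute)
  then show "\<exists>U e f g. zariski_open J C U \<and> x \<in> U \<and> f \<in> forms J (d + e) \<and> g \<in> forms J e
      \<and> (\<forall>y\<in>U. g y \<noteq> 0 \<and> s y + t y = f y / g y)"
    using zariski_open_Int[OF 1(1) 2(1)] 1(2) 2(2) F G by blast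
qed (use assms in \<open>auto simp: global_sections_outside\<close>)

lemma global_sections_mult:
  assumes "s \<in> global_sections J C d" "t \<in> global_sections J C d'"
  shows "(\<lambda>x. s x * t x) \<in> global_sections J C (d + d')"
proof (rule global_sectionsI)
  fix x assume x: "x \<in> C"
  obtain U e f g where 1: "zariski_open J C U" "x \<in> U" "f \<in> forms J (d + e)" "g \<in> forms J e"
    "\<forall>y\<in>U. g y \<noteq> 0" "\<forall>y\<in>U. s y = f y / g y" by (rule global_sectionsE[OF assms(1) x])
  obtain U' e' f' g' where 2: "zariski_open J C U'" "x \<in> U'" "f' \<in> forms J (d' + e')" "g' \<in> forms J e'"
    "\<forall>y\<in>U'. g' y \<noteq> 0" "\<forall>y\<in>U'. t y = f' y / g' y" by (rule global_sectionsE[OF assms(2) x])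
  define F where "F = (\<lambda>x. f x * f' x)"
  define G where "G = (\<lambda>x. g x * g' x)"
  have F: "F \<in> forms J (d + d' + (e + e'))" unfolding F_def
    using forms_mult[OF 1(3) 2(3)] by (simp add: add_ac)
  have G: "G \<in> forms J (e + e')" unfolding G_def by (rule forms_mult[OF 1(4) 2(4)])
  have "\<forall>y\<in>U \<inter> U'. G y \<noteq> 0 \<and> s y * t y = F y / G y"
    using 1(5,6) 2(5,6) by (simp add: F_def G_def add_frac_eq mult.commute)
  then show "\<exists>U e f g. zariski_open J C U \<and> x \<in> U \<and> f \<in> forms J (d + d' + e) \<and> g \<in> forms J e
      \<and> (\<forall>y\<in>U. g y \<noteq> 0 \<and> s y * t y = f y / g y)"
    using zariski_open_Int[OF 1(1) 2(1)] 1(2) 2(2) F G by blast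
qed (use assms in \<open>auto simp: global_sections_outside\<close>)

lemma global_sections_scale:
  assumes s: "s \<in> global_sections J C d" and x: "x \<in> C" "(\<lambda>j. c * x j) \<in> C" and c: "c \<noteq> 0"
  shows "s (\<lambda>j. c * x j) = c ^ d * s x"
proof -
  obtain U e f g where 1: "zariski_open J C U" "x \<in> U" "f \<in> forms J (d + e)" "g \<in> forms J e"
    "\<forall>y\<in>U. g y \<noteq> 0" "\<forall>y\<in>U. s y = f y / g y" by (rule global_sectionsE[OF s x(1)])
  have "(\<lambda>j. c * x j) \<in> U"
    using 1(1,2) x(2) c unfolding zariski_open_def by (fastforce simp: forms_scale)
  then show ?thesis
    using 1(2,5,6) c by (simp add: forms_scale[OF 1(3)] forms_scale[OF 1(4)] power_add)
qed

text \<open>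
  Along a holomorphic curve in the cone a section is locally a quotient of holomorphic functions.  So
  values of sections may be computed as limits.
\<close>

lemma global_sections_holomorphic:
  assumes s: "s \<in> global_sections J C d" and S: "open S" and xC: "\<And>z. z \<in> S \<Longrightarrow> x z \<in> C"
    and hol: "\<And>j. j \<in> J \<Longrightarrow> (\<lambda>z. x z j) holomorphic_on S"
  shows "(\<lambda>z. s (x z)) holomorphic_on S"
  unfolding holomorphic_on_def
proof
  fix z0 assume z0: "z0 \<in> S"
  obtain U e f g where 1: "zariski_open J C U" "x z0 \<in> U" "f \<in> forms J (d + e)" "g \<in> forms J e"
    "\<forall>y\<in>U. g y \<noteq> 0" "\<forall>y\<in>U. s y = f y / g y"
    by (rule global_sectionsE[OF s xC[OF z0]])
  obtain F where F: "F \<subseteq> (\<Union>d. forms J d)" "U = {x\<in>C. \<exists>f\<in>F. f x \<noteq> 0}"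
    using 1(1) unfolding zariski_open_def by blast
  obtain h k where h: "h \<in> F" "h \<in> forms J k" "h (x z0) \<noteq> 0" using 1(2) F by blast
  define S' where "S' = {z\<in>S. h (x z) \<noteq> 0}"
  have "(\<lambda>z. h (x z)) holomorphic_on S" by (rule forms_holomorphic[OF h(2) hol])
  then have "open (S \<inter> (\<lambda>z. h (x z)) -` (- {0}))"
    by (intro continuous_open_preimage holomorphic_on_imp_continuous_on S) auto
  moreover have "S \<inter> (\<lambda>z. h (x z)) -` (- {0}) = S'" by (auto simp: S'_def)
  ultimately have S': "open S'" by simp
  have U: "x z \<in> U" if "z \<in> S'" for z using that h(1) xC by (auto simp: S'_def F(2))
  have hol': "\<And>j. j \<in> J \<Longrightarrow> (\<lambda>z. x z j) holomorphic_on S'"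
    using hol by (rule holomorphic_on_subset) (auto simp: S'_def)
  have "(\<lambda>z. f (x z) / g (x z)) holomorphic_on S'"
    by (intro holomorphic_on_divide forms_holomorphic[OF 1(3)] forms_holomorphic[OF 1(4)] hol')
      (use 1(5) U in auto)
  then have "(\<lambda>z. s (x z)) holomorphic_on S'"
    by (rule holomorphic_transform) (use 1(6) U in auto)
  moreover have "z0 \<in> S'" using z0 h(3) by (simp add: S'_def)
  ultimately show "(\<lambda>z. s (x z)) field_differentiable (at z0 within S)"
    using S' holomorphic_on_imp_differentiable_at field_differentiable_at_within by blast
qed

section \<open>Multihomogeneous entire functions\<close>


definition is_poly_comb :: "'i set \<Rightarrow> ('i \<Rightarrow> nat) set \<Rightarrow> (('i \<Rightarrow> complex) \<Rightarrow> complex) \<Rightarrow> bool" where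
  "is_poly_comb J Q \<Phi> \<longleftrightarrow> (\<exists>E c. finite E \<and> E \<subseteq> Q \<and> \<Phi> = (\<lambda>b. \<Sum>x\<in>E. c x * (\<Prod>j\<in>J. b j ^ x j)))"

lemma is_poly_combI:
  fixes h :: "'p \<Rightarrow> 'i \<Rightarrow> nat"
  assumes "finite P" and "\<And>p. p \<in> P \<Longrightarrow> h p \<in> Q"
  shows "is_poly_comb J Q (\<lambda>b. \<Sum>p\<in>P. k p * (\<Prod>j\<in>J. b j ^ h p j))"
proof -
  have "(\<Sum>p\<in>P. k p * (\<Prod>j\<in>J. b j ^ h p j))
      = (\<Sum>e\<in>h ` P. (\<Sum>p | p \<in> P \<and> h p = e. k p) * (\<Prod>j\<in>J. b j ^ e j))" for b :: "'i \<Rightarrow> complex"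
    by (subst sum.image_gen[OF assms(1), of _ h]) (auto simp: sum_distrib_right intro!: sum.cong)
  then show ?thesis unfolding is_poly_comb_def using assms
    by (auto intro!: exI[of _ "h ` P"] exI[of _ "\<lambda>e. (\<Sum>p | p \<in> P \<and> h p = e. k p)"])
qed

lemma poly_altdef_le:
  fixes p :: "complex poly"
  assumes "degree p \<le> D"
  shows "poly p z = (\<Sum>i\<le>D. coeff p i * z ^ i)"
  unfolding poly_altdef using assms by (intro sum.mono_neutral_left) (auto simp: coeff_eq_0)

lemma lagrange_basis:
  "\<exists>L :: nat \<Rightarrow> complex poly. (\<forall>l\<le>D. degree (L l) \<le> D)
    \<and> (\<forall>p. degree p \<le> D \<longrightarrow> p = (\<Sum>l\<le>D. smult (poly p (of_nat l)) (L l)))"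
proof -
  define L :: "nat \<Rightarrow> complex poly" where
    "L l = (\<Prod>h\<in>{..D} - {l}. smult (1 / (of_nat l - of_nat h)) [:- of_nat h, 1:])" for l
  have "degree (L l) \<le> (\<Sum>h\<in>{..D} - {l}. degree (smult (1 / (of_nat l - of_nat h)) [:- of_nat h, 1 :: complex:]))" for l
    unfolding L_def by (rule order_trans[OF degree_prod_sum_le]) auto
  also have "\<dots> l \<le> (\<Sum>h\<in>{..D} - {l}. 1)" for l
    by (intro sum_mono) auto
  finally have deg: "degree (L l) \<le> card ({..D} - {l})" for l by simp
  have deg': "degree (L l) \<le> D" if "l \<le> D" for l using deg[of l] that by simp
  have poly_L: "poly (L l) (of_nat m) = (if l = m then 1 else 0)" if "l \<le> D" "m \<le> D" for l m
  proof (cases "l = m")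
    case True
    then show ?thesis by (auto simp: L_def poly_prod diff_divide_distrib[symmetric] intro!: prod.neutral)
  next
    case False
    then show ?thesis using that by (auto simp: L_def poly_prod intro!: prod_zero bexI[of _ m])
  qed
  have "p = (\<Sum>l\<le>D. smult (poly p (of_nat l)) (L l))" if p: "degree p \<le> D" for p
  proof -
  define q where "q = (\<Sum>l\<le>D. smult (poly p (of_nat l)) (L l))"
  have "degree q \<le> D" unfolding q_def
    by (intro degree_sum_le) (auto intro!: order_trans[OF degree_smult_le] deg')
  then have pq: "degree (p - q) \<le> D" using p degree_diff_le by blast
  have "poly (p - q) (of_nat m) = 0" if "m \<le> D" for m
    using that by (simp add: q_def poly_sum poly_L if_distrib[of "\<lambda>u. _ * u"] sum.delta' cong: if_cong)
  then have sub: "of_nat ` {..D} \<subseteq> {z. poly (p - q) z = 0}" by auto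
  have "p - q = 0"
  proof (rule ccontr)
    assume ne: "p - q \<noteq> 0"
    have "card (of_nat ` {..D} :: complex set) \<le> card {z. poly (p - q) z = 0}"
      by (rule card_mono[OF poly_roots_finite[OF ne] sub])
    also have "\<dots> \<le> degree (p - q)" by (rule card_poly_roots_bound[OF ne])
    finally show False using pq by (simp add: card_image inj_on_def)
  qed
  then show ?thesis by (simp add: q_def)
  qed
  with deg' show ?thesis by blast
qed

text \<open>
  Interpolation in one variable writes \<open>\<Phi>\<close> as a combination of its restrictions to the hyperplanes
  \<open>b k = l\<close>, \<open>l \<le> D\<close>, with coefficients that are polynomials in \<open>b k\<close>; the restrictions have fewer
  variables.
\<close>

lemma separately_polynomial_is_poly_comb:
  assumes "finite J"
    and "\<And>b b'. (\<And>j. j \<in> J \<Longrightarrow> b j = b' j) \<Longrightarrow> \<Phi> b = \<Phi> b'"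
    and "\<And>j b. j \<in> J \<Longrightarrow> \<exists>p. degree p \<le> D \<and> (\<forall>z. \<Phi> (b(j := z)) = poly p z)"
  shows "is_poly_comb J {x. \<forall>j. j \<notin> J \<longrightarrow> x j = 0} \<Phi>"
  using assms
proof (induction J arbitrary: \<Phi> rule: finite_induct)
  case empty
  have eq: "\<Phi> = (\<lambda>b. \<Sum>p\<in>{()}. \<Phi> (\<lambda>_. 0) * (\<Prod>j\<in>{}. b j ^ (\<lambda>_. 0) j))"
    using empty(1)[of _ "\<lambda>_. 0"] by (auto simp: fun_eq_iff)
  show ?case by (subst eq, rule is_poly_combI) auto
next
  case (insert k J)
  let ?Q = "{x. \<forall>j. j \<notin> J \<longrightarrow> x j = (0::nat)}"
  obtain L :: "nat \<Rightarrow> complex poly" where L: "\<And>l. l \<le> D \<Longrightarrow> degree (L l) \<le> D"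
    "\<And>p. degree p \<le> D \<Longrightarrow> p = (\<Sum>l\<le>D. smult (poly p (of_nat l)) (L l))" using lagrange_basis[of D] by auto
  have "is_poly_comb J ?Q (\<lambda>b. \<Phi> (b(k := of_nat l)))" for l
  proof (rule insert.IH)
    show "\<Phi> (b(k := of_nat l)) = \<Phi> (b'(k := of_nat l))" if "\<And>j. j \<in> J \<Longrightarrow> b j = b' j" for b b'
      by (rule insert.prems(1)) (use that in auto)
    show "\<exists>p. degree p \<le> D \<and> (\<forall>z. \<Phi> (b(j := z, k := of_nat l)) = poly p z)" if "j \<in> J" for j b
    proof -
      have jk: "j \<noteq> k" "j \<in> insert k J" using that insert.hyps(2) by auto
      show ?thesis using insert.prems(2)[OF jk(2), of "b(k := of_nat l)"]
        by (simp only: fun_upd_twist[OF jk(1)])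
    qed
  qed
  then have "\<forall>l. \<exists>E c. finite E \<and> E \<subseteq> ?Q \<and>
      (\<lambda>b. \<Phi> (b(k := of_nat l))) = (\<lambda>b. \<Sum>x\<in>E. c x * (\<Prod>j\<in>J. b j ^ x j))"
    unfolding is_poly_comb_def by simp
  then have "\<exists>E c. \<forall>l. finite (E l) \<and> E l \<subseteq> ?Q \<and>
      (\<lambda>b. \<Phi> (b(k := of_nat l))) = (\<lambda>b. \<Sum>x\<in>E l. c l x * (\<Prod>j\<in>J. b j ^ x j))"
    by (simp only: choice_iff)
  then obtain E c where Ec: "\<forall>l. finite (E l) \<and> E l \<subseteq> ?Q \<and>
      (\<lambda>b. \<Phi> (b(k := of_nat l))) = (\<lambda>b. \<Sum>x\<in>E l. c l x * (\<Prod>j\<in>J. b j ^ x j))"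
    by - (elim exE, rule that)
  have Ec3: "\<Phi> (b(k := of_nat l)) = (\<Sum>x\<in>E l. c l x * (\<Prod>j\<in>J. b j ^ x j))" for b l
    using fun_cong[OF Ec[THEN spec, THEN conjunct2, THEN conjunct2, of l], of b] .
  have "\<Phi> b = (\<Sum>l\<le>D. \<Phi> (b(k := of_nat l)) * poly (L l) (b k))" for b
  proof -
    obtain p where p: "degree p \<le> D" "\<And>z. \<Phi> (b(k := z)) = poly p z"
      using insert.prems(2)[OF insertI1, of b] by - (elim exE conjE, rule that, assumption, rule spec)
    have "\<Phi> b = poly p (b k)" using p(2)[of "b k"] by simp
    also have "\<dots> = poly (\<Sum>l\<le>D. smult (poly p (of_nat l)) (L l)) (b k)" using L(2)[OF p(1)] by simp
    finally show ?thesis by (simp add: poly_sum p(2))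
  qed
  also have "\<dots> b = (\<Sum>l\<le>D. \<Sum>i\<le>D. \<Sum>x\<in>E l. coeff (L l) i * c l x * (b k ^ i * (\<Prod>j\<in>J. b j ^ x j)))" for b
    unfolding Ec3
  proof (rule sum.cong[OF refl])
    fix l assume "l \<in> {..D}"
    then have "poly (L l) (b k) = (\<Sum>i\<le>D. coeff (L l) i * b k ^ i)"
      using L(1)[of l] by (intro poly_altdef_le) auto
    then show "(\<Sum>x\<in>E l. c l x * (\<Prod>j\<in>J. b j ^ x j)) * poly (L l) (b k)
      = (\<Sum>i\<le>D. \<Sum>x\<in>E l. coeff (L l) i * c l x * (b k ^ i * (\<Prod>j\<in>J. b j ^ x j)))"
      by (simp add: sum_distrib_left sum_distrib_right mult_ac) (rule sum.swap)
  qed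
  also have "\<dots> b = (\<Sum>p\<in>(SIGMA l:{..D}. {..D} \<times> E l). (coeff (L (fst p)) (fst (snd p)) * c (fst p) (snd (snd p)))
      * (\<Prod>j\<in>insert k J. b j ^ ((snd (snd p))(k := fst (snd p))) j))" for b
  proof -
    have "(\<Prod>j\<in>insert k J. b j ^ (x(k := i)) j) = b k ^ i * (\<Prod>j\<in>J. b j ^ x j)" for x i
    proof -
      have "(\<Prod>j\<in>J. b j ^ (x(k := i)) j) = (\<Prod>j\<in>J. b j ^ x j)"
        using insert.hyps by (intro prod.cong) auto
      then show ?thesis using insert.hyps by (subst prod.insert) (simp_all only: fun_upd_same not_False_eq_True)
    qed
    then show ?thesis using Ec by (simp add: sum.Sigma sum.cartesian_product case_prod_unfold)
  qed
  finally have eq: "\<Phi> = (\<lambda>b. \<Sum>p\<in>(SIGMA l:{..D}. {..D} \<times> E l). (coeff (L (fst p)) (fst (snd p)) * c (fst p) (snd (snd p)))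
      * (\<Prod>j\<in>insert k J. b j ^ ((snd (snd p))(k := fst (snd p))) j))" by (rule ext)
  show ?case by (subst eq, rule is_poly_combI) (use Ec in \<open>auto simp: subset_iff\<close>)
qed

text \<open>
  Comparing the coefficients of \<open>\<mu> ^ D\<close> leaves only the monomials of degree \<open>D\<close> in the variables from \<open>B\<close>.
\<close>

lemma is_poly_comb_homogeneous:
  assumes "is_poly_comb J Q \<Phi>" "finite J" "B \<subseteq> J"
    and hom: "\<And>\<mu> b. \<mu> \<noteq> 0 \<Longrightarrow> \<Phi> (\<lambda>j. if j \<in> B then \<mu> * b j else b j) = \<mu> ^ D * \<Phi> b"
  shows "is_poly_comb J {x\<in>Q. (\<Sum>j\<in>B. x j) = D} \<Phi>"
proof -
  obtain E c where E: "finite E" "E \<subseteq> Q" "\<Phi> = (\<lambda>b. \<Sum>x\<in>E. c x * (\<Prod>j\<in>J. b j ^ x j))"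
    using assms(1) unfolding is_poly_comb_def by blast
  have prod: "(\<Prod>j\<in>J. (if j \<in> B then \<mu> * b j else b j) ^ x j) = \<mu> ^ (\<Sum>j\<in>B. x j) * (\<Prod>j\<in>J. b j ^ x j)"
    for \<mu> and b :: "'a \<Rightarrow> complex" and x
  proof -
    have "(\<Prod>j\<in>J. (if j \<in> B then \<mu> * b j else b j) ^ x j) = (\<Prod>j\<in>J. (if j \<in> B then \<mu> ^ x j else 1) * b j ^ x j)"
      by (rule prod.cong) (auto simp: power_mult_distrib)
    also have "\<dots> = (\<Prod>j\<in>J. if j \<in> B then \<mu> ^ x j else 1) * (\<Prod>j\<in>J. b j ^ x j)" by (rule prod.distrib)
    also have "(\<Prod>j\<in>J. if j \<in> B then \<mu> ^ x j else 1) = (\<Prod>j\<in>B. \<mu> ^ x j)"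
      using assms(2,3) by (simp add: prod.If_cases Int_absorb1)
    finally show ?thesis by (simp add: power_sum)
  qed
  have "\<Phi> b = (\<Sum>x | x \<in> E \<and> (\<Sum>j\<in>B. x j) = D. c x * (\<Prod>j\<in>J. b j ^ x j))" for b
  proof -
    define p where "p = (\<Sum>x\<in>E. monom (c x * (\<Prod>j\<in>J. b j ^ x j)) (\<Sum>j\<in>B. x j))"
    have "poly p \<mu> = poly (monom (\<Phi> b) D) \<mu>" if "\<mu> \<noteq> 0" for \<mu>
      using hom[OF that, of b] by (simp add: p_def E(3) poly_sum poly_monom prod mult_ac)
    then have "poly (p * [:0, 1:]) \<mu> = poly (monom (\<Phi> b) D * [:0, 1:]) \<mu>" for \<mu> by (cases "\<mu> = 0") auto
    then have "p * [:0, 1:] = monom (\<Phi> b) D * [:0, 1:]" by (simp add: poly_eq_poly_eq_iff[symmetric] fun_eq_iff)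
    then have "p = monom (\<Phi> b) D" by simp
    then have "coeff p D = \<Phi> b" by simp
    then show ?thesis using E(1) by (simp add: p_def coeff_sum sum.inter_filter)
  qed
  then have eq: "\<Phi> = (\<lambda>b. \<Sum>x | x \<in> E \<and> (\<Sum>j\<in>B. x j) = D. c x * (\<Prod>j\<in>J. b j ^ x j))" by (rule ext)
  show ?thesis by (subst eq, rule is_poly_combI) (use E in auto)
qed

text \<open>
  The hypothesis says that \<open>g z / z ^ D\<close> stays bounded as \<open>z\<close> tends to infinity, so Liouville's theorem
  applies.
\<close>

lemma entire_of_polynomial_growth:
  assumes g: "g holomorphic_on UNIV" and h: "h holomorphic_on UNIV"
    and gh: "\<And>z. z \<noteq> 0 \<Longrightarrow> g z = z ^ D * h (1 / z)"
  shows "\<exists>p. degree p \<le> D \<and> (\<forall>z. g z = poly p z)"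
proof -
  have "compact (h ` cball 0 1)"
    by (intro compact_continuous_image holomorphic_on_imp_continuous_on holomorphic_on_subset[OF h]) auto
  then obtain B where B: "\<And>w. w \<in> cball 0 1 \<Longrightarrow> norm (h w) \<le> B"
    by (meson bounded_iff compact_imp_bounded imageI)
  have "norm (g z) \<le> B * norm z ^ D" if "1 \<le> norm z" for z
  proof -
    have "norm (h (1 / z)) \<le> B" using that by (intro B) (simp add: norm_divide divide_simps)
    moreover have "g z = z ^ D * h (1 / z)" using that by (intro gh) auto
    ultimately show ?thesis
      using mult_left_mono[of "norm (h (1 / z))" B "norm z ^ D"] by (simp add: norm_mult norm_power mult.commute)
  qed
  then have "g z = (\<Sum>k\<le>D. (deriv ^^ k) g 0 / fact k * z ^ k)" for z
    by (rule Liouville_polynomial[OF g])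
  then show ?thesis
    by (intro exI[of _ "\<Sum>k\<le>D. monom ((deriv ^^ k) g 0 / fact k) k"])
      (auto simp: poly_sum poly_monom intro!: degree_sum_le order_trans[OF degree_monom_le])
qed

text \<open>
  The variables come in blocks, \<open>block j\<close> being that of \<open>j\<close>, and \<open>\<Phi>\<close> is homogeneous in each block.  In a
  single variable \<open>b k\<close>, homogeneity turns the behaviour of \<open>\<Phi>\<close> near infinity into that of another entire
  function near 0, so \<open>\<Phi>\<close> is a polynomial in \<open>b k\<close> of degree at most that of the block.
\<close>

lemma multihomogeneous_entire_is_poly_comb:
  assumes J: "finite J" and I: "finite I" "block ` J \<subseteq> I"
    and dep: "\<And>b b'. (\<And>j. j \<in> J \<Longrightarrow> b j = b' j) \<Longrightarrow> \<Phi> b = \<Phi> b'"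
    and hol: "\<And>b b'. (\<lambda>z. \<Phi> (\<lambda>j. b j + z * b' j)) holomorphic_on UNIV"
    and hom: "\<And>i \<mu> b. i \<in> I \<Longrightarrow> \<mu> \<noteq> 0 \<Longrightarrow> \<Phi> (\<lambda>j. if block j = i then \<mu> * b j else b j) = \<mu> ^ D i * \<Phi> b"
  shows "is_poly_comb J {x. (\<forall>j. j \<notin> J \<longrightarrow> x j = 0) \<and> (\<forall>i\<in>I. (\<Sum>j | j \<in> J \<and> block j = i. x j) = D i)} \<Phi>"
proof -
  let ?Q = "\<lambda>I. {x. (\<forall>j. j \<notin> J \<longrightarrow> x j = 0) \<and> (\<forall>i\<in>I. (\<Sum>j | j \<in> J \<and> block j = i. x j) = D i)}"
  have poly: "\<exists>p. degree p \<le> D (block k) \<and> (\<forall>z. \<Phi> (b(k := z)) = poly p z)" if k: "k \<in> J" for k b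
  proof (rule entire_of_polynomial_growth)
    define h where "h w = \<Phi> (\<lambda>j. if j = k then 1 else if block j = block k then w * b j else b j)" for w
    have "(\<lambda>z. \<Phi> (\<lambda>j. (b(k := 0)) j + z * (if j = k then 1 else 0))) holomorphic_on UNIV" by (rule hol)
    also have "(\<lambda>z j. (b(k := 0)) j + z * (if j = k then 1 else 0)) = (\<lambda>z. b(k := z))" by (auto simp: fun_eq_iff)
    finally show "(\<lambda>z. \<Phi> (b(k := z))) holomorphic_on UNIV" .
    have "(\<lambda>w. \<Phi> (\<lambda>j. (if j = k then 1 else if block j = block k then 0 else b j)
        + w * (if j \<noteq> k \<and> block j = block k then b j else 0))) holomorphic_on UNIV" by (rule hol)
    also have "(\<lambda>w j. (if j = k then 1 else if block j = block k then 0 else b j)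
        + w * (if j \<noteq> k \<and> block j = block k then b j else 0))
        = (\<lambda>w j. if j = k then 1 else if block j = block k then w * b j else b j)" by (auto simp: fun_eq_iff)
    finally show "h holomorphic_on UNIV" by (simp add: h_def[abs_def])
    fix z :: complex assume z: "z \<noteq> 0"
    let ?b = "\<lambda>j. if j = k then 1 else if block j = block k then 1 / z * b j else b j"
    have "b(k := z) = (\<lambda>j. if block j = block k then z * ?b j else ?b j)" using z by auto
    then have "\<Phi> (b(k := z)) = \<Phi> (\<lambda>j. if block j = block k then z * ?b j else ?b j)" by simp
    also have "\<dots> = z ^ D (block k) * \<Phi> ?b"
      by (rule hom) (use I(2) k z in auto)
    finally show "\<Phi> (b(k := z)) = z ^ D (block k) * h (1 / z)" by (simp add: h_def)
  qed
  have "is_poly_comb J {x. \<forall>j. j \<notin> J \<longrightarrow> x j = 0} \<Phi>"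
  proof (rule separately_polynomial_is_poly_comb[OF J dep])
    show "\<exists>p. degree p \<le> (\<Sum>i\<in>I. D i) \<and> (\<forall>z. \<Phi> (b(j := z)) = poly p z)" if "j \<in> J" for j b
      using poly[OF that, of b] member_le_sum[of "block j" I D] I that by (meson image_subset_iff le_trans le0)
  qed
  moreover have "is_poly_comb J (?Q I') \<Phi>" if "I' \<subseteq> I" "is_poly_comb J (?Q {}) \<Phi>" for I'
    using finite_subset[OF that(1) I(1)] that
  proof (induction I' rule: finite_induct)
    case (insert i I')
    have "is_poly_comb J {x\<in>?Q I'. (\<Sum>j\<in>{j\<in>J. block j = i}. x j) = D i} \<Phi>"
    proof (rule is_poly_comb_homogeneous)
      fix \<mu> :: complex and b :: "'a \<Rightarrow> complex" assume "\<mu> \<noteq> 0"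
      have "\<Phi> (\<lambda>j. if j \<in> {j \<in> J. block j = i} then \<mu> * b j else b j) = \<Phi> (\<lambda>j. if block j = i then \<mu> * b j else b j)"
        by (rule dep) auto
      then show "\<Phi> (\<lambda>j. if j \<in> {j \<in> J. block j = i} then \<mu> * b j else b j) = \<mu> ^ D i * \<Phi> b"
        using hom[of i \<mu> b] insert.prems(1) \<open>\<mu> \<noteq> 0\<close> by auto
    qed (use insert J in auto)
    then show ?case by (rule back_subst[of "\<lambda>Q. is_poly_comb J Q \<Phi>"]) auto
  qed simp
  ultimately show ?thesis by simp
qed

section \<open>Pluecker vectors of row spans\<close>

lemma rdet_holomorphic:
  assumes "\<And>l j. (\<lambda>z. M z l j) holomorphic_on S"
  shows "(\<lambda>z. rdet r (M z) c) holomorphic_on S"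
  unfolding rdet_leibniz by (intro holomorphic_intros assms)

lemma index_seqsD:
  assumes "a \<in> index_seqs r n"
  shows "length a = r" "\<And>p. p < r \<Longrightarrow> a ! p \<ge> 1" "\<And>p. p < r \<Longrightarrow> a ! p \<le> n"
    "\<And>p q. p < q \<Longrightarrow> q < r \<Longrightarrow> a ! p < a ! q"
proof -
  show len: "length a = r" using assms by (simp add: index_seqs_def)
  show "a ! p \<ge> 1" "a ! p \<le> n" if "p < r" for p
  proof -
    have "a ! p \<in> set a" using that len by simp
    then show "a ! p \<ge> 1" "a ! p \<le> n" using assms by (auto simp: index_seqs_def)
  qed
  show "a ! p < a ! q" if "p < q" "q < r" for p q
    using assms that by (simp add: index_seqs_def sorted_wrt_nth_less)
qed

lemma index_seqs_mono: "a \<in> index_seqs r n \<Longrightarrow> p \<le> q \<Longrightarrow> q < r \<Longrightarrow> a ! p \<le> a ! q"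
  using index_seqsD(4)[of a r n p q] by (cases "p = q") auto

text \<open>
  The vectors \<open>M i\<close> become the columns of the matrix, as in \<open>pluecker\<close>.
\<close>

definition rows_mat :: "nat \<Rightarrow> nat \<Rightarrow> (nat \<Rightarrow> nat \<Rightarrow> complex) \<Rightarrow> complex mat" where
  "rows_mat r n M = mat n r (\<lambda>(j, i). M i j)"

abbreviation row_span :: "nat \<Rightarrow> nat \<Rightarrow> (nat \<Rightarrow> nat \<Rightarrow> complex) \<Rightarrow> complex vec set" where
  "row_span r n M \<equiv> vec_space.col_space n (rows_mat r n M)"

text \<open>
  The Pluecker vector of the span of \<open>M 0, \<dots>, M (r - 1)\<close>.
\<close>

definition plk :: "nat \<Rightarrow> nat \<Rightarrow> (nat \<Rightarrow> nat \<Rightarrow> complex) \<Rightarrow> wedge" where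
  "plk r n M = wedge_cols r n (rows_mat r n M)"

lemma rows_mat_carrier [simp]: "rows_mat r n M \<in> carrier_mat n r"
  by (simp add: rows_mat_def)

lemma rows_mat_cong: "(\<And>i j. i < r \<Longrightarrow> j < n \<Longrightarrow> M i j = M' i j) \<Longrightarrow> rows_mat r n M = rows_mat r n M'"
  by (auto simp: rows_mat_def intro!: eq_matI)

lemma rows_mat_entries: "A \<in> carrier_mat n r \<Longrightarrow> rows_mat r n (\<lambda>i j. A $$ (j, i)) = A"
  by (auto simp: rows_mat_def intro!: eq_matI)

lemma plk_apply:
  assumes "a \<in> index_seqs r n"
  shows "plk r n M a = rdet r M (\<lambda>p. a ! p - 1)"
proof -
  note a = index_seqsD[OF assms]
  have lt: "a ! p - 1 < n" if "p < r" for p using a(2,3)[OF that] by linarith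
  have "mat r r (\<lambda>(i, j). rows_mat r n M $$ (a ! i - 1, [1..<Suc r] ! j - 1)) = mat r r (\<lambda>(p, l). M l (a ! p - 1))"
    by (intro eq_matI) (auto simp: rows_mat_def lt[simplified] simp del: upt_Suc)
  then show ?thesis
    using assms a(1) by (simp add: plk_def wedge_cols_def minor_def rdet_def del: upt_Suc)
qed

lemma plk_outside: "a \<notin> index_seqs r n \<Longrightarrow> plk r n M a = 0"
  by (simp add: plk_def wedge_cols_def)

lemma plk_cong: "(\<And>i j. i < r \<Longrightarrow> j < n \<Longrightarrow> M i j = M' i j) \<Longrightarrow> plk r n M = plk r n M'"
  unfolding plk_def by (rule arg_cong[where f = "wedge_cols r n"], rule rows_mat_cong)

lemma plk_mult:
  "plk r n (\<lambda>l j. \<Sum>h<r. C l h * M h j) = (\<lambda>a. det (mat r r (\<lambda>(l, h). C l h)) * plk r n M a)"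
proof
  fix a show "plk r n (\<lambda>l j. \<Sum>h<r. C l h * M h j) a = det (mat r r (\<lambda>(l, h). C l h)) * plk r n M a"
    by (cases "a \<in> index_seqs r n") (simp_all add: plk_apply rdet_mult plk_outside)
qed

lemma plk_row_scale:
  "plk r n (\<lambda>i j. c i * M i j) = (\<lambda>a. (\<Prod>i<r. c i) * plk r n M a)"
proof -
  have "plk r n (\<lambda>i j. c i * M i j) = plk r n (\<lambda>l j. \<Sum>h<r. (if h = l then c l else 0) * M h j)"
    by (rule plk_cong) (auto simp: if_distrib[of "\<lambda>u. u * _"] sum.delta cong: if_cong)
  moreover have "det (mat r r (\<lambda>(l, h). if h = l then c l else 0)) = (\<Prod>i<r. c i)"
    by (subst det_upper_triangular[of _ r])
      (auto simp: upper_triangular_def diag_mat_def prod.list_conv_set_nth atLeast0LessThan)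
  ultimately show ?thesis by (simp add: plk_mult)
qed

lemma plk_holomorphic:
  assumes "\<And>l j. (\<lambda>z. M z l j) holomorphic_on S"
  shows "(\<lambda>z. plk r n (M z) a) holomorphic_on S"
  by (cases "a \<in> index_seqs r n") (simp_all add: plk_apply plk_outside rdet_holomorphic assms)

lemma ex_plk_nonzero_of_rdet:
  assumes "rdet r M c \<noteq> 0" "\<And>p. p < r \<Longrightarrow> c p < n"
  shows "\<exists>a\<in>index_seqs r n. set a = Suc ` c ` {..<r} \<and> plk r n M a \<noteq> 0"
proof -
  obtain a where a: "length a = r" "sorted_wrt (<) a" "set a = c ` {..<r}" "rdet r M ((!) a) \<noteq> 0"
    using rdet_sort[OF assms(1)] by blast
  have mem: "map Suc a \<in> index_seqs r n"
    using a(1-3) assms(2) by (auto simp: index_seqs_def sorted_wrt_map Suc_le_eq)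
  have "plk r n M (map Suc a) = rdet r M ((!) a)"
    unfolding plk_apply[OF mem] by (rule rdet_cong) (simp add: a(1))
  then show ?thesis using mem a(3,4) by (intro bexI[of _ "map Suc a"]) auto
qed

lemma row_span_eq: "row_span r n M = {rows_mat r n M *\<^sub>v v | v. v \<in> carrier_vec r}"
proof -
  interpret vec_space "TYPE(complex)" n .
  show ?thesis by (subst col_space_eq[OF rows_mat_carrier])
    (use carrier_matD[OF rows_mat_carrier, of r n M] in \<open>auto intro!: mult_mat_vec_carrier[OF rows_mat_carrier]\<close>)
qed

lemma rows_mat_mult_vec: "j < n \<Longrightarrow> v \<in> carrier_vec r \<Longrightarrow> (rows_mat r n M *\<^sub>v v) $ j = (\<Sum>l<r. v $ l * M l j)"
  by (auto simp: rows_mat_def scalar_prod_def atLeast0LessThan mult.commute intro!: sum.cong)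

lemma ex_coefficients_of_row_span_eq:
  assumes "row_span r n N = row_span r n M"
  shows "\<exists>C. \<forall>i<r. \<forall>j<n. N i j = (\<Sum>h<r. C i h * M h j)"
proof -
  have "\<forall>i\<in>{..<r}. \<exists>v. v \<in> carrier_vec r \<and> rows_mat r n N *\<^sub>v unit_vec r i = rows_mat r n M *\<^sub>v v"
  proof
    fix i assume "i \<in> {..<r}"
    have "rows_mat r n N *\<^sub>v unit_vec r i \<in> row_span r n N" unfolding row_span_eq by auto
    then have "rows_mat r n N *\<^sub>v unit_vec r i \<in> row_span r n M" by (simp only: assms)
    then show "\<exists>v. v \<in> carrier_vec r \<and> rows_mat r n N *\<^sub>v unit_vec r i = rows_mat r n M *\<^sub>v v"
      unfolding row_span_eq by auto
  qed
  from bchoice[OF this] obtain v where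
    v': "\<forall>i\<in>{..<r}. v i \<in> carrier_vec r \<and> rows_mat r n N *\<^sub>v unit_vec r i = rows_mat r n M *\<^sub>v v i"
    by - (elim exE, rule that)
  have v: "v i \<in> carrier_vec r" "rows_mat r n N *\<^sub>v unit_vec r i = rows_mat r n M *\<^sub>v v i" if "i < r" for i
    using bspec[OF v', of i] that by simp_all
  have "N i j = (\<Sum>h<r. v i $ h * M h j)" if "i < r" "j < n" for i j
  proof -
    have "(rows_mat r n N *\<^sub>v unit_vec r i) $ j = N i j"
      using that by (simp add: rows_mat_mult_vec if_distrib[of "\<lambda>u. u * _"] cong: if_cong)
    then show ?thesis using v[OF that(1)] that(2) by (simp add: rows_mat_mult_vec)
  qed
  then show ?thesis by (intro exI[of _ "\<lambda>i h. v i $ h"]) auto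
qed

text \<open>
  The vectors are independent if and only if some maximal minor does not vanish.
\<close>

lemma row_span_grassmannian_iff:
  "row_span r n M \<in> grassmannian r n \<longleftrightarrow> (\<exists>a\<in>index_seqs r n. plk r n M a \<noteq> 0)"
proof -
  interpret vec_space "TYPE(complex)" n .
  have dim: "vectorspace.dim class_ring (std_space n\<lparr>carrier := row_span r n M\<rparr>) = rank (rows_mat r n M)"
    unfolding rank_def col_space_def by simp
  have sub: "VectorSpace.subspace class_ring (row_span r n M) (std_space n)"
    unfolding col_space_def
    by (rule span_is_subspace) (use rows_mat_carrier[of r n M] cols_dim[of "rows_mat r n M"] in \<open>auto simp: rows_mat_def\<close>)
  have "rank (rows_mat r n M) = r \<longleftrightarrow> (\<exists>a\<in>index_seqs r n. plk r n M a \<noteq> 0)"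
  proof
    assume rank: "rank (rows_mat r n M) = r"
    have dist: "distinct (cols (rows_mat r n M))"
    proof (rule ccontr)
      assume nd: "\<not> distinct (cols (rows_mat r n M))"
      obtain S where S: "maximal S (\<lambda>T. T \<subseteq> set (cols (rows_mat r n M)) \<and> lin_indpt T)"
        using maximal_exists[of "\<lambda>T. T \<subseteq> set (cols (rows_mat r n M)) \<and> lin_indpt T" "card (set (cols (rows_mat r n M)))" "{}"]
        by (meson List.finite_set card_mono empty_iff empty_subsetI finite_lin_indpt2 rev_finite_subset)
      have "rank (rows_mat r n M) = card S" by (rule rank_card_indpt[OF rows_mat_carrier S])
      also have "card S \<le> card (set (cols (rows_mat r n M)))"
        using S by (simp add: card_mono maximal_def)
      also have "\<dots> < length (cols (rows_mat r n M))"
        using nd card_distinct card_length le_neq_implies_less by blast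
      finally show False using rank by (simp add: rows_mat_def)
    qed
    have indpt: "lin_indpt (set (cols (rows_mat r n M)))"
      by (rule full_rank_lin_indpt[OF rows_mat_carrier rank dist])
    have "v l = 0" if v: "\<And>j. j < n \<Longrightarrow> (\<Sum>l<r. v l * M l j) = 0" and "l < r" for v l
    proof -
      have "rows_mat r n M *\<^sub>v vec r v = 0\<^sub>v n"
        by (rule eq_vecI) (auto simp: rows_mat_mult_vec v, simp add: rows_mat_def)
      then have "vec r v = 0\<^sub>v r"
        using lin_depI[OF rows_mat_carrier, of "vec r v"] dist indpt by auto
      then show ?thesis using \<open>l < r\<close> by (metis index_vec index_zero_vec(1))
    qed
    then obtain c where "\<forall>p<r. c p < n" "rdet r M c \<noteq> 0" using ex_rdet_nonzero[where n = n and r = r and M = M] by blast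
    then show "\<exists>a\<in>index_seqs r n. plk r n M a \<noteq> 0" using ex_plk_nonzero_of_rdet by blast
  next
    assume "\<exists>a\<in>index_seqs r n. plk r n M a \<noteq> 0"
    then obtain a where a: "a \<in> index_seqs r n" "rdet r M (\<lambda>p. a ! p - 1) \<noteq> 0" by (auto simp: plk_apply)
    let ?D = "mat r r (\<lambda>(p, l). M l (a ! p - 1))"
    have lt: "a ! p - 1 < n" if "p < r" for p using index_seqsD(2,3)[OF a(1) that] by linarith
    have ker: "v = 0\<^sub>v r" if v: "v \<in> carrier_vec r" "rows_mat r n M *\<^sub>v v = 0\<^sub>v n" for v
    proof (rule ccontr)
      assume "v \<noteq> 0\<^sub>v r"
      moreover have "?D *\<^sub>v v = 0\<^sub>v r"
      proof (rule eq_vecI)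
        fix p assume "p < dim_vec (0\<^sub>v r :: complex vec)"
        then have p: "p < r" by simp
        have "(?D *\<^sub>v v) $ p = (rows_mat r n M *\<^sub>v v) $ (a ! p - 1)"
          using p v(1) lt[OF p] by (simp add: rows_mat_mult_vec) (simp add: scalar_prod_def atLeast0LessThan mult.commute)
        then show "(?D *\<^sub>v v) $ p = 0\<^sub>v r $ p" using p lt[OF p] by (simp add: v(2))
      qed simp
      ultimately have "det ?D = 0" using det_0_iff_vec_prod_zero_field[of ?D r] v(1) by auto
      then show False using a(2) by (simp add: rdet_def)
    qed
    have dist: "distinct (cols (rows_mat r n M))"
    proof (rule ccontr)
      assume "\<not> distinct (cols (rows_mat r n M))"
      then obtain i k where ik: "i < r" "k < r" "i \<noteq> k" "col (rows_mat r n M) i = col (rows_mat r n M) k"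
        unfolding distinct_conv_nth by (auto simp: rows_mat_def)
      have "M i j = M k j" if "j < n" for j
        using arg_cong[OF ik(4), of "\<lambda>u. u $ j"] ik(1,2) that by (simp add: rows_mat_def)
      then have "rows_mat r n M *\<^sub>v (unit_vec r i - unit_vec r k) = 0\<^sub>v n"
        using ik by (intro eq_vecI)
          (simp_all add: rows_mat_mult_vec left_diff_distrib sum_subtractf if_distrib[of "\<lambda>u. u * _"] cong: if_cong, simp add: rows_mat_def)
      then have "unit_vec r i - unit_vec r k = (0\<^sub>v r :: complex vec)" by (intro ker) auto
      then have "(unit_vec r i - unit_vec r k) $ i = (0 :: complex)" using ik by simp
      then show False using ik by simp
    qed
    have "lin_indpt (set (cols (rows_mat r n M)))"
    proof (rule ccontr)
      assume "\<not> lin_indpt (set (cols (rows_mat r n M)))"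
      then have "lin_dep (set (cols (rows_mat r n M)))" by simp
      from lin_depE[OF rows_mat_carrier this dist] obtain v where
        "v \<in> carrier_vec r" "v \<noteq> 0\<^sub>v r" "rows_mat r n M *\<^sub>v v = 0\<^sub>v n" .
      then show False using ker by simp
    qed
    then show "rank (rows_mat r n M) = r" by (rule lin_indpt_full_rank[OF rows_mat_carrier dist])
  qed
  then show ?thesis unfolding grassmannian_def using sub by (simp add: dim)
qed

lemma plk_mem_pluecker: "plk r n M \<in> pluecker r n (row_span r n M)"
  unfolding pluecker_def plk_def by (intro CollectI exI[of _ "rows_mat r n M"]) simp

lemma mem_coneE:
  assumes "x \<in> cone r n X"
  obtains M where "x = plk r n M" "row_span r n M \<in> X"
proof -
  obtain V A where "V \<in> X" "x = wedge_cols r n A" "A \<in> carrier_mat n r" "vec_space.col_space n A = V"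
    using assms unfolding cone_def pluecker_def by auto
  then show ?thesis using that[of "\<lambda>i j. A $$ (j, i)"] by (simp add: plk_def rows_mat_entries)
qed

lemma plk_mem_cone: "row_span r n M \<in> X \<Longrightarrow> plk r n M \<in> cone r n X"
  unfolding cone_def using plk_mem_pluecker by blast

text \<open>
  Two bases of a subspace have proportional Pluecker vectors, so a form may be tested on a single
  basis.
\<close>

lemma row_span_in_zariski_closure_iff:
  "row_span r n M \<in> zariski_closure r n S \<longleftrightarrow> (\<exists>a\<in>index_seqs r n. plk r n M a \<noteq> 0) \<and>
    (\<forall>d. \<forall>f\<in>forms (index_seqs r n) d. (\<forall>x\<in>cone r n S. f x = 0) \<longrightarrow> f (plk r n M) = 0)"
    (is "?L \<longleftrightarrow> ?R")
proof -
  have eq: "(\<forall>x\<in>pluecker r n (row_span r n M). f x = 0) \<longleftrightarrow> f (plk r n M) = 0"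
    if f: "f \<in> forms (index_seqs r n) d" for f d
  proof
    assume "\<forall>x\<in>pluecker r n (row_span r n M). f x = 0"
    then show "f (plk r n M) = 0" using plk_mem_pluecker by blast
  next
    assume 0: "f (plk r n M) = 0"
    show "\<forall>x\<in>pluecker r n (row_span r n M). f x = 0"
    proof
      fix x assume "x \<in> pluecker r n (row_span r n M)"
      then obtain A where A: "x = wedge_cols r n A" "A \<in> carrier_mat n r"
        "vec_space.col_space n A = row_span r n M" unfolding pluecker_def by auto
      define N where "N = (\<lambda>i j. A $$ (j, i))"
      have N: "x = plk r n N" "row_span r n N = row_span r n M"
        using A by (simp_all add: N_def plk_def rows_mat_entries)
      obtain C where "\<forall>i<r. \<forall>j<n. N i j = (\<Sum>h<r. C i h * M h j)"
        using ex_coefficients_of_row_span_eq[OF N(2)] by blast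
      then have "x = plk r n (\<lambda>i j. \<Sum>h<r. C i h * M h j)" unfolding N(1) by (intro plk_cong) auto
      then show "f x = 0" by (simp add: plk_mult forms_scale[OF f] 0)
    qed
  qed
  show ?thesis unfolding zariski_closure_def mem_Collect_eq row_span_grassmannian_iff
    by (intro conj_cong refl all_cong1 ball_cong imp_cong) (rule eq)
qed

section \<open>Closures of orbits and Richardson varieties\<close>


text \<open>
  The images under \<open>g\<close> of the basis vectors that span the coordinate subspace of \<open>w\<close>.
\<close>

definition flag_rows :: "nat list \<Rightarrow> complex mat \<Rightarrow> nat \<Rightarrow> nat \<Rightarrow> complex" where
  "flag_rows w g = (\<lambda>h j. g $$ (j, w ! h - 1))"

lemma orbit_coord_subspace:
  assumes w: "w \<in> index_seqs r n" and H: "H \<subseteq> carrier_mat n n"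
  shows "orbit H (coord_subspace n w) = {row_span r n (flag_rows w g) | g. g \<in> H}"
proof -
  interpret vec_space "TYPE(complex)" n .
  note wD = index_seqsD[OF w]
  have lt: "w ! p - 1 < n" if "p < r" for p using wD(2,3)[OF that] by linarith
  let ?E = "rows_mat r n (\<lambda>h j. if j = w ! h - 1 then 1 else 0)"
  have col: "col ?E h = unit_vec n (w ! h - 1)" if "h < r" for h
    using that lt[OF that] by (intro eq_vecI) (auto simp: rows_mat_def)
  have "set (cols ?E) = (\<lambda>i. unit_vec n (i - 1)) ` set w"
  proof -
    have "set (cols ?E) = (\<lambda>h. col ?E h) ` {..<r}"
      by (auto simp: cols_def rows_mat_def atLeast0LessThan)
    also have "\<dots> = (\<lambda>h. unit_vec n (w ! h - 1)) ` {..<r}" using col by (intro image_cong) auto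
    also have "\<dots> = (\<lambda>i. unit_vec n (i - 1)) ` ((!) w ` {..<r})" by (simp add: image_image)
    also have "(!) w ` {..<r} = set w" using wD(1) by (auto simp: set_conv_nth)
    finally show ?thesis .
  qed
  then have cs: "coord_subspace n w = row_span r n (\<lambda>h j. if j = w ! h - 1 then 1 else 0)"
    by (simp add: coord_subspace_def col_space_def)
  have "(\<lambda>v. g *\<^sub>v v) ` coord_subspace n w = row_span r n (flag_rows w g)" if g: "g \<in> H" for g
  proof -
    have gc: "g \<in> carrier_mat n n" using g H by blast
    have gE: "g * ?E = rows_mat r n (flag_rows w g)"
      using gc lt by (intro eq_matI)
        (auto simp: rows_mat_def flag_rows_def scalar_prod_def if_distrib[of "\<lambda>u. _ * u"] cong: if_cong)
    have "g *\<^sub>v (?E *\<^sub>v v) = rows_mat r n (flag_rows w g) *\<^sub>v v" if "v \<in> carrier_vec r" for v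
      unfolding gE[symmetric] using assoc_mult_mat_vec[OF gc rows_mat_carrier that] by simp
    then have "(\<lambda>v. g *\<^sub>v v) ` {?E *\<^sub>v v | v. v \<in> carrier_vec r} = {rows_mat r n (flag_rows w g) *\<^sub>v v | v. v \<in> carrier_vec r}"
      unfolding setcompr_eq_image image_image by (intro image_cong) auto
    then show ?thesis unfolding cs row_span_eq .
  qed
  then show ?thesis unfolding orbit_def by auto
qed

text \<open>
  As before, it is enough to look at one basis of each subspace in the orbit.
\<close>

lemma forms_vanish_on_orbit_iff:
  assumes w: "w \<in> index_seqs r n" and H: "H \<subseteq> carrier_mat n n" and f: "f \<in> forms (index_seqs r n) d"
  shows "(\<forall>x\<in>cone r n (orbit H (coord_subspace n w)). f x = 0) \<longleftrightarrow> (\<forall>g\<in>H. f (plk r n (flag_rows w g)) = 0)"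
proof
  assume 0: "\<forall>x\<in>cone r n (orbit H (coord_subspace n w)). f x = 0"
  show "\<forall>g\<in>H. f (plk r n (flag_rows w g)) = 0"
  proof
    fix g assume "g \<in> H"
    then have "row_span r n (flag_rows w g) \<in> orbit H (coord_subspace n w)"
      unfolding orbit_coord_subspace[OF w H] by auto
    then show "f (plk r n (flag_rows w g)) = 0" by (rule 0[rule_format, OF plk_mem_cone])
  qed
next
  assume 0: "\<forall>g\<in>H. f (plk r n (flag_rows w g)) = 0"
  show "\<forall>x\<in>cone r n (orbit H (coord_subspace n w)). f x = 0"
  proof
    fix x assume "x \<in> cone r n (orbit H (coord_subspace n w))"
    then obtain N where N: "x = plk r n N" "row_span r n N \<in> orbit H (coord_subspace n w)"
      by (rule mem_coneE)
    then obtain g where g: "g \<in> H" "row_span r n N = row_span r n (flag_rows w g)"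
      unfolding orbit_coord_subspace[OF w H] by auto
    obtain C where "\<forall>i<r. \<forall>j<n. N i j = (\<Sum>h<r. C i h * flag_rows w g h j)"
      using ex_coefficients_of_row_span_eq[OF g(2)] by blast
    then have "x = plk r n (\<lambda>i j. \<Sum>h<r. C i h * flag_rows w g h j)" unfolding N(1) by (intro plk_cong) auto
    then show "f x = 0" using 0 g(1) by (simp add: plk_mult forms_scale[OF f])
  qed
qed

text \<open>
  The closure of the \<open>H\<close>-orbit of the coordinate subspace of \<open>w\<close>, as a condition on a Pluecker vector.
\<close>

definition in_orbit_closure :: "nat \<Rightarrow> nat \<Rightarrow> complex mat set \<Rightarrow> nat list \<Rightarrow> wedge \<Rightarrow> bool" where
  "in_orbit_closure r n H w x \<longleftrightarrow> (\<forall>d. \<forall>f\<in>forms (index_seqs r n) d.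
     (\<forall>g\<in>H. f (plk r n (flag_rows w g)) = 0) \<longrightarrow> f x = 0)"

lemma in_orbit_closureD:
  assumes "in_orbit_closure r n H w x" "f \<in> forms (index_seqs r n) d"
    and "\<And>g. g \<in> H \<Longrightarrow> f (plk r n (flag_rows w g)) = 0"
  shows "f x = 0"
  using assms(1)[unfolded in_orbit_closure_def, rule_format, OF assms(2)] assms(3) by blast

lemma borel_carrier: "borel n \<subseteq> carrier_mat n n" "opposite_borel n \<subseteq> carrier_mat n n"
  by (auto simp: borel_def opposite_borel_def SL_def)

lemma row_span_in_richardson_iff:
  assumes v: "v \<in> index_seqs r n" and w: "w \<in> index_seqs r n"
  shows "row_span r n M \<in> richardson r n v w \<longleftrightarrow> (\<exists>a\<in>index_seqs r n. plk r n M a \<noteq> 0)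
    \<and> in_orbit_closure r n (borel n) w (plk r n M) \<and> in_orbit_closure r n (opposite_borel n) v (plk r n M)"
proof -
  have "row_span r n M \<in> zariski_closure r n (orbit H (coord_subspace n u)) \<longleftrightarrow>
    (\<exists>a\<in>index_seqs r n. plk r n M a \<noteq> 0) \<and> in_orbit_closure r n H u (plk r n M)"
    if "u \<in> index_seqs r n" "H \<subseteq> carrier_mat n n" for H u
    unfolding row_span_in_zariski_closure_iff in_orbit_closure_def
    by (intro conj_cong refl all_cong1 ball_cong imp_cong) (rule forms_vanish_on_orbit_iff[OF that])
  from this[OF w borel_carrier(1)] this[OF v borel_carrier(2)] show ?thesis
    unfolding richardson_def schubert_def opposite_schubert_def by blast
qed

text \<open>
  The set where \<open>h\<close> does not vanish is open, and a nonempty open subset of the plane is infinite.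
\<close>

lemma finite_zero_extends:
  fixes h :: "complex \<Rightarrow> complex"
  assumes h: "h holomorphic_on S" and S: "open S" and B: "finite B"
    and 0: "\<And>z. z \<in> S \<Longrightarrow> z \<notin> B \<Longrightarrow> h z = 0" and z: "z \<in> S"
  shows "h z = 0"
proof (rule ccontr)
  assume "h z \<noteq> 0"
  have "open (S \<inter> h -` (- {0}))"
    using continuous_open_preimage[OF holomorphic_on_imp_continuous_on[OF h] S, of "- {0}"] by (simp add: open_Compl)
  moreover have "S \<inter> h -` (- {0}) \<subseteq> B" using 0 by auto
  then have "finite (S \<inter> h -` (- {0}))" using B by (rule finite_subset)
  ultimately show False using finite_imp_not_open \<open>h z \<noteq> 0\<close> z by blast
qed

lemma in_orbit_closure_limit:
  assumes hol: "\<And>l j. (\<lambda>z. A z l j) holomorphic_on UNIV" and B: "finite B"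
    and cl: "\<And>z. z \<notin> B \<Longrightarrow> in_orbit_closure r n H w (plk r n (A z))"
  shows "in_orbit_closure r n H w (plk r n (A z))"
  unfolding in_orbit_closure_def
proof (intro allI ballI impI)
  fix d f assume f: "f \<in> forms (index_seqs r n) d" and 0: "\<forall>g\<in>H. f (plk r n (flag_rows w g)) = 0"
  have "(\<lambda>z. f (plk r n (A z))) holomorphic_on UNIV"
    by (intro forms_holomorphic[OF f] plk_holomorphic hol)
  then show "f (plk r n (A z)) = 0"
    by (rule finite_zero_extends[OF _ open_UNIV B]) (use cl f 0 in \<open>auto simp: in_orbit_closure_def\<close>)
qed

lemma in_orbit_closure_of_flag_rows:
  assumes "g \<in> H" and "\<And>i j. i < r \<Longrightarrow> j < n \<Longrightarrow> M i j = c i * flag_rows w g i j"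
  shows "in_orbit_closure r n H w (plk r n M)"
proof -
  have M: "plk r n M = plk r n (\<lambda>i j. c i * flag_rows w g i j)" by (rule plk_cong) (rule assms(2))
  show ?thesis unfolding in_orbit_closure_def M plk_row_scale
    using assms(1) by (auto simp: forms_scale)
qed

lemma index_seqs_nth_inj:
  assumes "w \<in> index_seqs r n" "h < r" "k < r" "w ! h - 1 = w ! k - 1"
  shows "h = k"
  using index_seqsD(2)[OF assms(1,2)] index_seqsD(2)[OF assms(1,3)] index_seqsD(4)[OF assms(1), of h k]
    index_seqsD(4)[OF assms(1), of k h] assms(2-4) by (cases h k rule: linorder_cases) auto

text \<open>
  The rows, which are triangular with pivots at \<open>w\<close>, are placed in the columns of \<open>g\<close> with indices from \<open>w\<close>;
  the other columns of \<open>g\<close> are unit vectors.  Dividing row 0 by the product of the pivots makes the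
  determinant 1.
\<close>

lemma ex_group_element:
  assumes w: "w \<in> index_seqs r n" and r: "r \<ge> 1"
    and nz: "\<And>i. i < r \<Longrightarrow> M i (w ! i - 1) \<noteq> 0"
    and tri: "(\<forall>i<r. \<forall>j<n. w ! i - 1 < j \<longrightarrow> M i j = 0) \<or> (\<forall>i<r. \<forall>j<n. j < w ! i - 1 \<longrightarrow> M i j = 0)"
  shows "\<exists>g c. g \<in> SL n \<and> (\<forall>i<r. \<forall>j<n. M i j = c i * flag_rows w g i j)
    \<and> ((\<forall>i<r. \<forall>j<n. w ! i - 1 < j \<longrightarrow> M i j = 0) \<longrightarrow> g \<in> borel n)
    \<and> ((\<forall>i<r. \<forall>j<n. j < w ! i - 1 \<longrightarrow> M i j = 0) \<longrightarrow> g \<in> opposite_borel n)"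
proof -
  note wD = index_seqsD[OF w]
  have lt: "w ! p - 1 < n" if "p < r" for p using wD(2,3)[OF that] by linarith
  define D where "D = (\<Prod>i<r. M i (w ! i - 1))"
  have D: "D \<noteq> 0" using nz by (simp add: D_def)
  define c where "c i = (if i = 0 then D else 1)" for i :: nat
  have c: "c i \<noteq> 0" for i using D by (simp add: c_def)
  define idx where "idx k = (THE h. h < r \<and> k = w ! h - 1)" for k
  have idx: "idx (w ! h - 1) = h" if "h < r" for h
    unfolding idx_def using that index_seqs_nth_inj[OF w] by (intro the_equality) auto
  note idx' = idx[unfolded One_nat_def]
  define g where "g = mat n n (\<lambda>(j, k). if \<exists>h<r. k = w ! h - 1 then M (idx k) j / c (idx k)
    else if j = k then 1 else 0)"
  have gc: "g \<in> carrier_mat n n" by (simp add: g_def)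
  have rows: "M i j = c i * flag_rows w g i j" if "i < r" "j < n" for i j
  proof -
    have "\<exists>h<r. w ! i - 1 = w ! h - 1" using that by blast
    then show ?thesis using that lt[OF that(1)] c[of i] by (simp add: flag_rows_def g_def idx')
  qed
  have diag: "(\<Prod>k<n. g $$ (k, k)) = 1"
  proof -
    let ?W = "(\<lambda>h. w ! h - 1) ` {..<r}"
    have inj: "inj_on (\<lambda>h. w ! h - 1) {..<r}" using index_seqs_nth_inj[OF w] by (auto intro!: inj_onI)
    have "(\<Prod>k<n. g $$ (k, k)) = (\<Prod>k\<in>?W. g $$ (k, k))"
      using lt by (intro prod.mono_neutral_right) (auto simp: g_def)
    also have "\<dots> = (\<Prod>h<r. M h (w ! h - 1) / c h)"
    proof (subst prod.reindex[OF inj], rule prod.cong)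
      fix h assume h: "h \<in> {..<r}"
      then have "\<exists>h'<r. w ! h - 1 = w ! h' - 1" by blast
      then show "((\<lambda>k. g $$ (k, k)) \<circ> (\<lambda>h. w ! h - 1)) h = M h (w ! h - 1) / c h"
        using h lt[of h] by (simp add: g_def idx')
    qed simp
    also have "\<dots> = D / (\<Prod>h<r. c h)" by (simp add: prod_dividef D_def)
    also have "(\<Prod>h<r. c h) = D" using r by (simp add: c_def prod.delta)
    finally show ?thesis using D by simp
  qed
  have up: "upper_triangular g" if "\<forall>i<r. \<forall>j<n. w ! i - 1 < j \<longrightarrow> M i j = 0"
    unfolding upper_triangular_def
  proof (intro allI impI)
    fix i j assume "i < dim_row g" "j < i"
    then show "g $$ (i, j) = 0" using that gc by (auto simp: g_def idx')
  qed
  have low: "upper_triangular (transpose_mat g)" if "\<forall>i<r. \<forall>j<n. j < w ! i - 1 \<longrightarrow> M i j = 0"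
    unfolding upper_triangular_def
  proof (intro allI impI)
    fix i j assume "i < dim_row (transpose_mat g)" "j < i"
    then show "transpose_mat g $$ (i, j) = 0" using that gc by (auto simp: g_def idx')
  qed
  have det: "det g = 1"
    using tri
  proof
    assume "\<forall>i<r. \<forall>j<n. w ! i - 1 < j \<longrightarrow> M i j = 0"
    then have "det g = prod_list (diag_mat g)" by (intro det_upper_triangular[OF up gc])
    then show ?thesis using diag gc by (simp add: diag_mat_def prod.list_conv_set_nth atLeast0LessThan)
  next
    assume "\<forall>i<r. \<forall>j<n. j < w ! i - 1 \<longrightarrow> M i j = 0"
    then have "det (transpose_mat g) = prod_list (diag_mat (transpose_mat g))"
      by (intro det_upper_triangular[OF low]) (use gc in auto)
    then show ?thesis using diag gc
      by (simp add: det_transpose[OF gc] diag_mat_def prod.list_conv_set_nth atLeast0LessThan)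
  qed
  have SL: "g \<in> SL n" using gc det by (simp add: SL_def)
  then have "(\<forall>i<r. \<forall>j<n. w ! i - 1 < j \<longrightarrow> M i j = 0) \<longrightarrow> g \<in> borel n"
    "(\<forall>i<r. \<forall>j<n. j < w ! i - 1 \<longrightarrow> M i j = 0) \<longrightarrow> g \<in> opposite_borel n"
    using up low by (auto simp: borel_def opposite_borel_def)
  with SL rows show ?thesis by blast
qed

text \<open>
  If the entries of \<open>A\<close> at \<open>v\<close> and \<open>w\<close> are nonzero, then the rows are triangular with respect to both
  sequences and their span lies in both orbits.  In general it is a limit of such spans.
\<close>

lemma row_span_in_richardson:
  assumes v: "v \<in> index_seqs r n" and w: "w \<in> index_seqs r n" and r: "r \<ge> 1"
    and vw: "\<And>i. i < r \<Longrightarrow> v ! i < w ! i"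
    and supp: "\<And>i j. i < r \<Longrightarrow> j < n \<Longrightarrow> j + 1 < v ! i \<or> w ! i < j + 1 \<Longrightarrow> A i j = 0"
    and nz: "plk r n A a \<noteq> 0"
  shows "row_span r n A \<in> richardson r n v w"
proof -
  have a: "a \<in> index_seqs r n" using nz plk_outside by blast
  \<comment> \<open>adding \<open>z\<close> at the ends of the intervals makes the rows triangular on both sides\<close>
  define B where "B z = (\<lambda>i j. A i j + z * (if j + 1 = v ! i \<or> j + 1 = w ! i then 1 else 0))" for z
  have hol: "(\<lambda>z. B z l j) holomorphic_on UNIV" for l j
    unfolding B_def by (intro holomorphic_intros)
  \<comment> \<open>the values of \<open>z\<close> for which an entry at \<open>v\<close> or \<open>w\<close> vanishes\<close>
  define bad where "bad = (\<lambda>i. - A i (v ! i - 1)) ` {..<r} \<union> (\<lambda>i. - A i (w ! i - 1)) ` {..<r}"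
  have fin: "finite bad" by (simp add: bad_def)
  note vD = index_seqsD[OF v] and wD = index_seqsD[OF w]
  have nzv: "B z i (v ! i - 1) \<noteq> 0" and nzw: "B z i (w ! i - 1) \<noteq> 0" if "z \<notin> bad" "i < r" for z i
  proof -
    have "z \<noteq> - A i (v ! i - 1)" "z \<noteq> - A i (w ! i - 1)" using that by (auto simp: bad_def)
    then show "B z i (v ! i - 1) \<noteq> 0" "B z i (w ! i - 1) \<noteq> 0"
      using vD(2)[OF that(2)] wD(2)[OF that(2)] by (auto simp: B_def add_eq_0_iff)
  qed
  have supB: "B z i j = 0" if "i < r" "j < n" "j + 1 < v ! i \<or> w ! i < j + 1" for z i j
    using supp[OF that] that(3) vw[OF that(1)] by (auto simp: B_def)
  have wB: "\<forall>i<r. \<forall>j<n. w ! i - 1 < j \<longrightarrow> B z i j = 0" for z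
  proof (intro allI impI)
    fix i j assume ij: "i < r" "j < n" "w ! i - 1 < j"
    then have "w ! i < j + 1" by linarith
    then show "B z i j = 0" using supB[OF ij(1,2)] by blast
  qed
  have vB: "\<forall>i<r. \<forall>j<n. j < v ! i - 1 \<longrightarrow> B z i j = 0" for z
  proof (intro allI impI)
    fix i j assume ij: "i < r" "j < n" "j < v ! i - 1"
    then have "j + 1 < v ! i" by linarith
    then show "B z i j = 0" using supB[OF ij(1,2)] by blast
  qed
  have "in_orbit_closure r n (borel n) w (plk r n (B 0))"
  proof (rule in_orbit_closure_limit[OF hol fin])
    fix z assume z: "z \<notin> bad"
    obtain g c where "g \<in> borel n" "\<forall>i<r. \<forall>j<n. B z i j = c i * flag_rows w g i j"
      using ex_group_element[OF w r, of "B z"] nzw[OF z] wB by blast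
    then show "in_orbit_closure r n (borel n) w (plk r n (B z))" by (intro in_orbit_closure_of_flag_rows) auto
  qed
  moreover have "in_orbit_closure r n (opposite_borel n) v (plk r n (B 0))"
  proof (rule in_orbit_closure_limit[OF hol fin])
    fix z assume z: "z \<notin> bad"
    obtain g c where "g \<in> opposite_borel n" "\<forall>i<r. \<forall>j<n. B z i j = c i * flag_rows v g i j"
      using ex_group_element[OF v r, of "B z"] nzv[OF z] vB by blast
    then show "in_orbit_closure r n (opposite_borel n) v (plk r n (B z))" by (intro in_orbit_closure_of_flag_rows) auto
  qed
  moreover have "B 0 = A" by (simp add: B_def)
  ultimately show ?thesis unfolding row_span_in_richardson_iff[OF v w] using a nz by metis
qed

text \<open>
  The Pluecker coordinates outside the Bruhat interval are forms of degree 1 that vanish on one of the two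
  orbits, because of a zero block in the minor.
\<close>

lemma richardson_pluecker_support:
  assumes v: "v \<in> index_seqs r n" and w: "w \<in> index_seqs r n"
    and M: "row_span r n M \<in> richardson r n v w" and a: "plk r n M a \<noteq> 0" and i: "i < r"
  shows "v ! i \<le> a ! i" "a ! i \<le> w ! i"
proof -
  have aI: "a \<in> index_seqs r n" using a plk_outside by blast
  note aD = index_seqsD[OF aI] and vD = index_seqsD[OF v] and wD = index_seqsD[OF w]
  have lt: "a ! p - 1 < n" if "p < r" for p using aD(2,3)[OF that] by linarith
  have coord: "(\<lambda>x. x a) \<in> forms (index_seqs r n) 1" by (rule forms_coord[OF finite_index_seqs aI])
  note cl = M[unfolded row_span_in_richardson_iff[OF v w]]
  show "a ! i \<le> w ! i"
  proof (rule ccontr)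
    assume gt: "\<not> a ! i \<le> w ! i"
    have van: "plk r n (flag_rows w g) a = 0" if "g \<in> borel n" for g
      unfolding plk_apply[OF aI]
    proof (rule rdet_eq_0_of_zero_block[OF i])
      fix p l assume pl: "i \<le> p" "p < r" "l \<le> i"
      have "w ! l \<le> w ! i" "a ! i \<le> a ! p"
        using index_seqs_mono[OF w pl(3) i] index_seqs_mono[OF aI pl(1,2)] by auto
      then have "w ! l - 1 < a ! p - 1" using gt wD(2)[of l] pl i by linarith
      then show "flag_rows w g l (a ! p - 1) = 0"
        using that lt[OF pl(2)] by (auto simp: flag_rows_def borel_def SL_def upper_triangular_def)
    qed
    have "plk r n M a = 0" by (rule in_orbit_closureD[OF conjunct1[OF conjunct2[OF cl]] coord]) (rule van)
    then show False using a by simp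
  qed
  show "v ! i \<le> a ! i"
  proof (rule ccontr)
    assume gt: "\<not> v ! i \<le> a ! i"
    have van: "plk r n (flag_rows v g) a = 0" if "g \<in> opposite_borel n" for g
      unfolding plk_apply[OF aI]
    proof (rule rdet_eq_0_of_zero_block'[OF i])
      fix p l assume pl: "p \<le> i" "i \<le> l" "l < r"
      have "v ! i \<le> v ! l" "a ! p \<le> a ! i"
        using index_seqs_mono[OF v pl(2,3)] index_seqs_mono[OF aI pl(1) i] by auto
      then have "a ! p - 1 < v ! l - 1" using gt aD(2)[of p] pl i by linarith
      moreover have "v ! l - 1 < n" using vD(2,3)[OF pl(3)] by linarith
      moreover have "g \<in> carrier_mat n n" "upper_triangular (transpose_mat g)"
        using that by (auto simp: opposite_borel_def SL_def)
      then have "transpose_mat g $$ (v ! l - 1, a ! p - 1) = 0"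
        using calculation unfolding upper_triangular_def by simp
      ultimately show "flag_rows v g l (a ! p - 1) = 0"
        using \<open>g \<in> carrier_mat n n\<close> by (simp add: flag_rows_def)
    qed
    have "plk r n M a = 0" by (rule in_orbit_closureD[OF conjunct2[OF conjunct2[OF cl]] coord]) (rule van)
    then show False using a by simp
  qed
qed

text \<open>
  For \<open>b \<noteq> a\<close> some member of \<open>b\<close> is not in \<open>a\<close>, and all vectors vanish in this coordinate.
\<close>

lemma plk_coord_rows:
  assumes a: "a \<in> index_seqs r n"
  shows "plk r n (\<lambda>i j. if j = a ! i - 1 then c i else 0) = (\<lambda>b. if b = a then (\<Prod>i<r. c i) else 0)"
proof
  fix b
  let ?M = "\<lambda>i j. if j = a ! i - 1 then c i else (0::complex)"
  show "plk r n ?M b = (if b = a then (\<Prod>i<r. c i) else 0)"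
  proof (cases "b \<in> index_seqs r n")
    case b: True
    show ?thesis
    proof (cases "b = a")
      case True
      have "rdet r ?M (\<lambda>p. a ! p - 1) = (\<Prod>p<r. ?M p (a ! p - 1))"
      proof (rule rdet_triangular)
        fix p l assume "l < p" "p < r"
        then show "?M l (a ! p - 1) = 0" using index_seqs_nth_inj[OF a, of p l] by auto
      qed
      then show ?thesis using True by (simp add: plk_apply[OF a])
    next
      case False
      have "rdet r ?M (\<lambda>p. b ! p - 1) = 0"
      proof (rule ccontr)
        assume "rdet r ?M (\<lambda>p. b ! p - 1) \<noteq> 0"
        then obtain \<sigma> where s: "\<sigma> permutes {0..<r}" "(\<Prod>p = 0..<r. ?M (\<sigma> p) (b ! p - 1)) \<noteq> 0"
          unfolding rdet_leibniz by (auto elim!: sum.not_neutral_contains_not_neutral)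
        have "set b \<subseteq> set a"
        proof
          fix u assume "u \<in> set b"
          then obtain p where p: "p < r" "u = b ! p" using index_seqsD(1)[OF b] by (auto simp: set_conv_nth)
          have sp: "\<sigma> p < r" using permutes_in_image[OF s(1), of p] p(1) by simp
          have "?M (\<sigma> p) (b ! p - 1) \<noteq> 0" using s(2) p(1) by (simp del: if_split_asm)
          then have "b ! p - 1 = a ! \<sigma> p - 1" by (auto split: if_splits)
          then have "b ! p = a ! \<sigma> p"
            using index_seqsD(2)[OF b p(1)] index_seqsD(2)[OF a sp] by linarith
          then show "u \<in> set a" using p(2) sp index_seqsD(1)[OF a] by simp
        qed
        moreover have sd: "sorted a" "distinct a" "sorted b" "distinct b"
          using a b by (auto simp: index_seqs_def strict_sorted_iff)
        moreover have "card (set a) = card (set b)"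
          using sd a b by (simp add: distinct_card index_seqs_def)
        ultimately have "set b = set a" using card_subset_eq by (metis List.finite_set)
        then show False using sd sorted_distinct_set_unique False by blast
      qed
      then show ?thesis using False by (simp add: plk_apply[OF b])
    qed
  next
    case False
    then show ?thesis using a by (auto simp: plk_outside)
  qed
qed

text \<open>
  The character by which a diagonal matrix acts on the basis vector \<open>e\<^sub>a\<close> of the exterior power.
\<close>

definition torus_char :: "nat \<Rightarrow> (nat \<Rightarrow> complex) \<Rightarrow> nat list \<Rightarrow> complex" where
  "torus_char r t a = (\<Prod>p<r. t (a ! p - 1))"

lemma wedge_act_diag:
  assumes t: "t \<in> carrier_mat n n" "diagonal_mat t" and a: "a \<in> index_seqs r n"
  shows "wedge_act r n t x a = torus_char r (\<lambda>j. t $$ (j, j)) a * x a"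
proof -
  have lt: "b ! p - 1 < n" if "p < r" "b \<in> index_seqs r n" for p b
    using index_seqsD(2,3)[OF that(2,1)] by linarith
  have minor: "minor t a b = (if a = b then torus_char r (\<lambda>j. t $$ (j, j)) b else 0)" if b: "b \<in> index_seqs r n" for b
  proof -
    have "minor t a b = rdet r (\<lambda>l j. t $$ (j, b ! l - 1)) (\<lambda>p. a ! p - 1)"
      using index_seqsD(1)[OF a] index_seqsD(1)[OF b] by (simp add: minor_def rdet_def)
    also have "\<dots> = rdet r (\<lambda>l j. if j = b ! l - 1 then t $$ (b ! l - 1, b ! l - 1) else 0) (\<lambda>p. a ! p - 1)"
    proof (rule rdet_cong)
      fix l p assume "l < r" "p < r"
      then have "b ! l - 1 < n" "a ! p - 1 < n" using lt a b by blast+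
      then show "t $$ (a ! p - 1, b ! l - 1)
          = (if a ! p - 1 = b ! l - 1 then t $$ (b ! l - 1, b ! l - 1) else 0)"
        using t by (simp add: diagonal_mat_def)
    qed
    also have "\<dots> = plk r n (\<lambda>l j. if j = b ! l - 1 then t $$ (b ! l - 1, b ! l - 1) else 0) a"
      by (simp only: plk_apply[OF a])
    finally show ?thesis
      unfolding plk_coord_rows[OF b, of "\<lambda>l. t $$ (b ! l - 1, b ! l - 1)"] torus_char_def .
  qed
  have "wedge_act r n t x a = (\<Sum>b\<in>index_seqs r n. (if a = b then torus_char r (\<lambda>j. t $$ (j, j)) b else 0) * x b)"
    using a by (simp add: wedge_act_def minor)
  also have "\<dots> = (\<Sum>b\<in>index_seqs r n. if b = a then torus_char r (\<lambda>j. t $$ (j, j)) a * x a else 0)"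
    by (rule sum.cong) auto
  also have "\<dots> = torus_char r (\<lambda>j. t $$ (j, j)) a * x a"
    using a finite_index_seqs by (simp add: sum.delta)
  finally show ?thesis .
qed

lemma plk_column_scale:
  assumes a: "a \<in> index_seqs r n"
  shows "plk r n (\<lambda>l j. t j * M l j) a = torus_char r t a * plk r n M a"
proof -
  have eq: "(\<Prod>p = 0..<r. t (a ! p - 1) * M (\<sigma> p) (a ! p - 1)) = torus_char r t a * (\<Prod>p = 0..<r. M (\<sigma> p) (a ! p - 1))"
    for \<sigma> by (simp add: prod.distrib torus_char_def atLeast0LessThan)
  then show ?thesis unfolding plk_apply[OF a] rdet_leibniz eq by (simp add: sum_distrib_left mult_ac)
qed

lemma wedge_act_plk:
  assumes "t \<in> torus n"
  shows "wedge_act r n t (plk r n M) = plk r n (\<lambda>l j. t $$ (j, j) * M l j)"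
proof
  fix a
  have t: "t \<in> carrier_mat n n" "diagonal_mat t" using assms by (auto simp: torus_def SL_def)
  show "wedge_act r n t (plk r n M) a = plk r n (\<lambda>l j. t $$ (j, j) * M l j) a"
  proof (cases "a \<in> index_seqs r n")
    case True
    then show ?thesis by (simp add: wedge_act_diag[OF t] plk_column_scale)
  next
    case False
    then show ?thesis by (simp add: wedge_act_def plk_outside)
  qed
qed

definition diag_of :: "nat \<Rightarrow> (nat \<Rightarrow> complex) \<Rightarrow> complex mat" where
  "diag_of n t = mat n n (\<lambda>(i, j). if i = j then t i else 0)"

lemma det_diag_of: "det (diag_of n t) = (\<Prod>j<n. t j)"
  unfolding diag_of_def by (subst det_upper_triangular[of _ n])
    (auto simp: upper_triangular_def diag_mat_def prod.list_conv_set_nth atLeast0LessThan)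

lemma diag_of_torus: "(\<Prod>j<n. t j) = 1 \<Longrightarrow> diag_of n t \<in> torus n"
  using det_diag_of[of n t] by (simp add: torus_def SL_def diagonal_mat_def diag_of_def)

text \<open>
  The orbit is stable under the torus, and composing a form with the action gives a form again.
\<close>

lemma in_orbit_closure_torus:
  assumes t: "(\<Prod>j<n. t j) = 1" and w: "w \<in> index_seqs r n"
    and H: "\<And>g. g \<in> H \<Longrightarrow> g \<in> carrier_mat n n \<and> diag_of n t * g \<in> H"
    and M: "in_orbit_closure r n H w (plk r n M)"
  shows "in_orbit_closure r n H w (plk r n (\<lambda>l j. t j * M l j))"
  unfolding in_orbit_closure_def
proof (intro allI ballI impI)
  fix d f assume f: "f \<in> forms (index_seqs r n) d" and 0: "\<forall>g\<in>H. f (plk r n (flag_rows w g)) = 0"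
  define f' where "f' x = f (\<lambda>a. torus_char r t a * x a)" for x
  have f': "f' \<in> forms (index_seqs r n) d" unfolding f'_def[abs_def] by (rule forms_rescale[OF f])
  have eq: "f' (plk r n N) = f (plk r n (\<lambda>l j. t j * N l j))" for N
    unfolding f'_def by (rule forms_cong[OF f]) (simp add: plk_column_scale)
  have "f' (plk r n (flag_rows w g)) = 0" if g: "g \<in> H" for g
  proof -
    have gc: "g \<in> carrier_mat n n" using H[OF g] by simp
    have lt: "w ! p - 1 < n" if "p < r" for p using index_seqsD(2,3)[OF w that] by linarith
    have "plk r n (\<lambda>l j. t j * flag_rows w g l j) = plk r n (flag_rows w (diag_of n t * g))"
      using gc lt by (intro plk_cong)
        (auto simp: flag_rows_def diag_of_def scalar_prod_def if_distrib[of "\<lambda>u. u * _"] cong: if_cong)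
    then show ?thesis using 0 H[OF g] by (simp add: eq)
  qed
  then have "f' (plk r n M) = 0" by (rule in_orbit_closureD[OF M f'])
  then show "f (plk r n (\<lambda>l j. t j * M l j)) = 0" by (simp add: eq)
qed

lemma diag_of_mult_borel:
  assumes t: "(\<Prod>j<n. t j) = 1"
  shows "g \<in> borel n \<Longrightarrow> diag_of n t * g \<in> borel n"
    and "g \<in> opposite_borel n \<Longrightarrow> diag_of n t * g \<in> opposite_borel n"
proof -
  have entry: "(diag_of n t * g) $$ (i, j) = t i * g $$ (i, j)" if "g \<in> carrier_mat n n" "i < n" "j < n" for g i j
    using that by (auto simp: diag_of_def scalar_prod_def if_distrib[of "\<lambda>u. u * _"] cong: if_cong)
  have dc: "diag_of n t \<in> carrier_mat n n" by (simp add: diag_of_def)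
  have SL: "diag_of n t * g \<in> SL n" if "g \<in> SL n" for g
    using that dc det_mult[OF dc, of g] det_diag_of[of n t] t by (auto simp: SL_def)
  show "g \<in> borel n \<Longrightarrow> diag_of n t * g \<in> borel n"
    using SL[of g] entry[of g] dc by (auto simp: borel_def upper_triangular_def SL_def)
  show "g \<in> opposite_borel n \<Longrightarrow> diag_of n t * g \<in> opposite_borel n"
    using SL[of g] entry[of g] dc by (auto simp: opposite_borel_def upper_triangular_def SL_def)
qed

lemma richardson_torus_stable:
  assumes v: "v \<in> index_seqs r n" and w: "w \<in> index_seqs r n" and t: "(\<Prod>j<n. t j) = 1"
    and M: "row_span r n M \<in> richardson r n v w"
  shows "row_span r n (\<lambda>l j. t j * M l j) \<in> richardson r n v w"
proof -
  note cl = M[unfolded row_span_in_richardson_iff[OF v w]]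
  obtain a where a: "a \<in> index_seqs r n" "plk r n M a \<noteq> 0" using cl by blast
  have "torus_char r t a \<noteq> 0"
  proof -
    have "t j \<noteq> 0" if "j < n" for j using t that by (metis finite_lessThan lessThan_iff prod_zero_iff zero_neq_one)
    moreover have "a ! p - 1 < n" if "p < r" for p using index_seqsD(2,3)[OF a(1) that] by linarith
    ultimately show ?thesis by (simp add: torus_char_def)
  qed
  then have "plk r n (\<lambda>l j. t j * M l j) a \<noteq> 0" using a by (simp add: plk_column_scale)
  moreover have "in_orbit_closure r n (borel n) w (plk r n (\<lambda>l j. t j * M l j))"
    using cl borel_carrier diag_of_mult_borel(1)[OF t] by (intro in_orbit_closure_torus[OF t w]) auto
  moreover have "in_orbit_closure r n (opposite_borel n) v (plk r n (\<lambda>l j. t j * M l j))"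
    using cl borel_carrier diag_of_mult_borel(2)[OF t] by (intro in_orbit_closure_torus[OF t v]) auto
  ultimately show ?thesis unfolding row_span_in_richardson_iff[OF v w] using a(1) by blast
qed

section \<open>Band matrices\<close>

locale richardson_setup =
  fixes r q n :: nat and m :: "nat \<Rightarrow> nat"
  assumes r1: "r \<ge> 1" and q1: "q \<ge> 1" and n_eq: "n = q * r + 1"
    and m_bounds: "\<forall>i\<in>{1..r - 1}. 1 \<le> m i \<and> m i \<le> q"
begin

text \<open>
  The interval from \<open>lo i\<close> to \<open>hi i\<close> consists of the columns, counted from 0, in which row \<open>i\<close> of a band matrix
  may be nonzero.  The first row to contain a column \<open>j\<close> is \<open>owner j\<close>, and \<open>overlap\<close> is the set of the columns that
  the row \<open>owner j + 1\<close> contains as well.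
\<close>

definition lo :: "nat \<Rightarrow> nat" where "lo i = (if i = 0 then 0 else (i - 1) * q + m i)"
definition hi :: "nat \<Rightarrow> nat" where "hi i = (i + 1) * q"
text \<open>
  The quotient rounds \<open>0 - 1 = 0\<close> to 0 as well, which is right: column 0 belongs to row 0, whose interval has
  \<open>q + 1\<close> columns, while every other row owns \<open>q\<close> columns.
\<close>

definition owner :: "nat \<Rightarrow> nat" where "owner j = (j - 1) div q"
definition overlap :: "nat set" where "overlap = {j. j < n \<and> owner j + 1 < r \<and> lo (owner j + 1) \<le> j}"

abbreviation "v \<equiv> v_seq r q m"
abbreviation "w \<equiv> w_seq r q"
abbreviation "X \<equiv> richardson r n v w"
abbreviation "\<C> \<equiv> cone r n X"

lemma m_pos: "1 \<le> i \<Longrightarrow> i < r \<Longrightarrow> 1 \<le> m i" and m_le: "1 \<le> i \<Longrightarrow> i < r \<Longrightarrow> m i \<le> q"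
  using m_bounds by auto

lemma length_v: "length v = r" and length_w: "length w = r"
  using r1 by (simp_all add: v_seq_def w_seq_def)

lemma v_nth: "i < r \<Longrightarrow> v ! i = lo i + 1"
  by (cases i) (auto simp: v_seq_def lo_def)

lemma w_nth: "i < r \<Longrightarrow> w ! i = hi i + 1"
  by (simp add: w_seq_def hi_def del: upt_Suc)

lemma lo_bounds: "1 \<le> i \<Longrightarrow> i < r \<Longrightarrow> (i - 1) * q < lo i" "i < r \<Longrightarrow> lo i \<le> i * q"
proof -
  show "1 \<le> i \<Longrightarrow> i < r \<Longrightarrow> (i - 1) * q < lo i" using m_pos[of i] by (simp add: lo_def)
  show "i < r \<Longrightarrow> lo i \<le> i * q"
    using m_le[of i] by (cases i) (auto simp: lo_def)
qed

lemma lo_less_hi: "i < r \<Longrightarrow> lo i < hi i"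
  using lo_bounds(2)[of i] q1 by (simp add: hi_def)

lemma hi_less_n: "i < r \<Longrightarrow> hi i < n"
  using mult_le_mono1[of "i + 1" r q] by (simp add: hi_def n_eq mult.commute)

lemma v_mem: "v \<in> index_seqs r n"
proof -
  have "sorted_wrt (<) v"
    unfolding sorted_wrt_iff_nth_less length_v
  proof (intro allI impI)
    fix i j assume ij: "i < j" "j < r"
    have "lo i \<le> i * q" using lo_bounds(2)[of i] ij by simp
    also have "\<dots> \<le> (j - 1) * q" using ij by (intro mult_le_mono1) auto
    also have "\<dots> < lo j" using lo_bounds(1)[of j] ij by simp
    finally show "v ! i < v ! j" using ij by (simp add: v_nth)
  qed
  moreover have "set v \<subseteq> {1..n}"
    using lo_less_hi hi_less_n by (fastforce simp: set_conv_nth length_v v_nth)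
  ultimately show ?thesis by (simp add: index_seqs_def length_v)
qed

lemma w_mem: "w \<in> index_seqs r n"
proof -
  have "sorted_wrt (<) w"
    unfolding sorted_wrt_iff_nth_less length_w using q1 by (auto simp: w_nth hi_def)
  moreover have "set w \<subseteq> {1..n}"
    using hi_less_n by (fastforce simp: set_conv_nth length_w w_nth)
  ultimately show ?thesis by (simp add: index_seqs_def length_w)
qed

lemma owner_eq: "owner j = i \<longleftrightarrow> j \<le> (i + 1) * q \<and> (i = 0 \<or> i * q < j)"
proof -
  have "owner j = i \<longleftrightarrow> i * q \<le> j - 1 \<and> j - 1 < (i + 1) * q"
  proof
    assume "owner j = i"
    then show "i * q \<le> j - 1 \<and> j - 1 < (i + 1) * q"
      using div_times_less_eq_dividend[of "j - 1" q] dividend_less_div_times[of q "j - 1"] q1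
      by (auto simp: owner_def)
  next
    assume "i * q \<le> j - 1 \<and> j - 1 < (i + 1) * q"
    then show "owner j = i" unfolding owner_def by (intro div_nat_eqI) (auto simp: mult.commute)
  qed
  also have "\<dots> \<longleftrightarrow> j \<le> (i + 1) * q \<and> (i = 0 \<or> i * q < j)"
  proof (cases "j = 0")
    case True
    then show ?thesis using q1 by auto
  next
    case False
    then have "j - 1 < (i + 1) * q \<longleftrightarrow> j \<le> (i + 1) * q" by linarith
    moreover have "i * q \<le> j - 1 \<longleftrightarrow> (i = 0 \<or> i * q < j)"
      using False by (cases "i = 0") auto
    ultimately show ?thesis by blast
  qed
  finally show ?thesis .
qed

lemma owner_upper: "j \<le> (owner j + 1) * q" and owner_lower: "owner j \<noteq> 0 \<Longrightarrow> owner j * q < j"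
  using owner_eq[of j "owner j"] by auto

lemma owner_less: "j < n \<Longrightarrow> owner j < r"
proof -
  assume j: "j < n"
  have "owner j * q < r * q"
  proof (cases "owner j = 0")
    case True
    then show ?thesis using r1 q1 by simp
  next
    case False
    moreover have "j \<le> r * q" using j by (simp add: n_eq mult.commute)
    ultimately show ?thesis using owner_lower[of j] by linarith
  qed
  then show "owner j < r" by simp
qed

lemma owner_hi: "owner (hi i) = i"
  using owner_eq[of "hi i" i] q1 by (simp add: hi_def)

lemma overlap_iff: "j \<in> overlap \<longleftrightarrow> j < n \<and> owner j + 1 < r \<and> lo (owner j + 1) \<le> j"
  by (simp add: overlap_def)

lemma finite_overlap: "finite overlap"
  by (rule finite_subset[of _ "{..<n}"]) (auto simp: overlap_def)

definition band_mat :: "(nat \<Rightarrow> complex) \<Rightarrow> (nat \<Rightarrow> complex) \<Rightarrow> nat \<Rightarrow> nat \<Rightarrow> complex" where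
  "band_mat \<alpha> \<beta> i j = (if owner j = i then \<alpha> j else if owner j + 1 = i \<and> j \<in> overlap then \<beta> j else 0)"

abbreviation band :: "(nat \<Rightarrow> complex) \<Rightarrow> (nat \<Rightarrow> complex) \<Rightarrow> wedge" where
  "band \<alpha> \<beta> \<equiv> plk r n (band_mat \<alpha> \<beta>)"

lemma band_mat_support:
  assumes "i < r" "j + 1 < v ! i \<or> w ! i < j + 1"
  shows "band_mat \<alpha> \<beta> i j = 0"
proof -
  have j: "j < lo i \<or> hi i < j" using assms v_nth w_nth by auto
  have "owner j \<noteq> i"
  proof
    assume o: "owner j = i"
    then have "j \<le> hi i" using owner_upper[of j] by (simp add: hi_def)
    moreover have "lo i \<le> j"
    proof (cases "i = 0")
      case False
      then show ?thesis using owner_lower[of j] o lo_bounds(2)[OF assms(1)] by simp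
    qed (simp add: lo_def)
    ultimately show False using j by simp
  qed
  moreover have "\<not> (owner j + 1 = i \<and> j \<in> overlap)"
  proof
    assume o: "owner j + 1 = i \<and> j \<in> overlap"
    then have "lo i \<le> j" by (auto simp: overlap_iff)
    moreover have "j \<le> hi i" using owner_upper[of j] o by (auto simp: hi_def)
    ultimately show False using j by simp
  qed
  ultimately show ?thesis by (auto simp: band_mat_def)
qed

lemma plk_band_mat_holomorphic:
  assumes "\<And>j. (\<lambda>z. \<alpha> z j) holomorphic_on S" "\<And>j. (\<lambda>z. \<beta> z j) holomorphic_on S"
  shows "(\<lambda>z. band (\<alpha> z) (\<beta> z) a) holomorphic_on S"
proof (rule plk_holomorphic)
  show "(\<lambda>z. band_mat (\<alpha> z) (\<beta> z) l j) holomorphic_on S" for l j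
    unfolding band_mat_def by (cases "owner j = l"; cases "owner j + 1 = l \<and> j \<in> overlap") (auto intro!: holomorphic_intros assms)
qed

text \<open>
  The intervals of rows whose indices differ by more than 1 are disjoint.
\<close>

lemma supported_eq_band_mat:
  assumes supp: "\<And>i j. i < r \<Longrightarrow> j < n \<Longrightarrow> j < lo i \<or> hi i < j \<Longrightarrow> A i j = 0" and ij: "i < r" "j < n"
  shows "A i j = band_mat (\<lambda>j. A (owner j) j) (\<lambda>j. A (owner j + 1) j) i j"
proof -
  have "A i j = 0" if "owner j \<noteq> i" "\<not> (owner j + 1 = i \<and> j \<in> overlap)"
  proof (rule supp[OF ij])
    note ne = that(1) and nO = that(2)
    consider "i < owner j" | "owner j + 1 = i" | "owner j + 1 < i" using ne by linarith
    then show "j < lo i \<or> hi i < j"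
    proof cases
      case 1
      then have "hi i \<le> owner j * q" unfolding hi_def by (intro mult_le_mono1) simp
      then show ?thesis using owner_lower[of j] 1 by simp
    next
      case 2
      then show ?thesis using nO ij by (auto simp: overlap_iff)
    next
      case 3
      then have "(owner j + 1) * q \<le> (i - 1) * q" by (intro mult_le_mono1) simp
      then show ?thesis using owner_upper[of j] lo_bounds(1)[of i] 3 ij by linarith
    qed
  qed
  then show ?thesis by (auto simp: band_mat_def)
qed

lemma supported_mem_cone:
  assumes "\<And>i j. i < r \<Longrightarrow> j < n \<Longrightarrow> j < lo i \<or> hi i < j \<Longrightarrow> A i j = 0" "plk r n A a \<noteq> 0"
  shows "plk r n A \<in> \<C>"
proof (rule plk_mem_cone, rule row_span_in_richardson[OF v_mem w_mem r1 _ _ assms(2)])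
  show "v ! i < w ! i" if "i < r" for i using that lo_less_hi by (simp add: v_nth w_nth)
  show "A i j = 0" if "i < r" "j < n" "j + 1 < v ! i \<or> w ! i < j + 1" for i j
    using assms(1)[OF that(1,2)] that by (auto simp: v_nth w_nth)
qed

lemma band_mat_mem_cone: "band \<alpha> \<beta> a \<noteq> 0 \<Longrightarrow> band \<alpha> \<beta> \<in> \<C>"
  by (rule supported_mem_cone) (auto intro!: band_mat_support simp: v_nth w_nth)

lemma plk_at_w:
  assumes "\<And>i j. i < r \<Longrightarrow> j < n \<Longrightarrow> hi i < j \<Longrightarrow> A i j = 0"
  shows "plk r n A w = (\<Prod>i<r. A i (hi i))"
proof -
  have "rdet r A (\<lambda>p. w ! p - 1) = (\<Prod>p<r. A p (w ! p - 1))"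
  proof (rule rdet_triangular)
    fix p l assume lp: "l < p" "p < r"
    have "hi l < hi p" using lp q1 by (simp add: hi_def)
    then show "A l (w ! p - 1) = 0" using assms[of l "hi p"] lp hi_less_n[of p] by (simp add: w_nth)
  qed
  then show ?thesis by (simp add: plk_apply[OF w_mem] w_nth)
qed

lemma plk_band_mat_w: "band \<alpha> \<beta> w = (\<Prod>i<r. \<alpha> (hi i))"
proof -
  have "band \<alpha> \<beta> w = (\<Prod>i<r. band_mat \<alpha> \<beta> i (hi i))"
    by (rule plk_at_w) (auto intro!: band_mat_support simp: w_nth)
  then show ?thesis by (simp add: band_mat_def owner_hi)
qed

text \<open>
  If the last entries \<open>\<alpha> (hi i)\<close> of the rows are nonzero, then so is the Pluecker coordinate at \<open>w\<close>.
\<close>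

lemma band_mem_cone: "(\<And>i. i < r \<Longrightarrow> \<alpha> (hi i) \<noteq> 0) \<Longrightarrow> band \<alpha> \<beta> \<in> \<C>"
  by (rule band_mat_mem_cone[of _ _ w]) (simp add: plk_band_mat_w)

lemma cone_support:
  assumes "x \<in> \<C>" "x a \<noteq> 0"
  shows "a \<in> index_seqs r n" "\<And>i. i < r \<Longrightarrow> lo i + 1 \<le> a ! i" "\<And>i. i < r \<Longrightarrow> a ! i \<le> hi i + 1"
proof -
  obtain M where M: "x = plk r n M" "row_span r n M \<in> X" using mem_coneE[OF assms(1)] .
  show "a \<in> index_seqs r n" using assms(2) M(1) plk_outside by blast
  show "lo i + 1 \<le> a ! i" "a ! i \<le> hi i + 1" if "i < r" for i
    using richardson_pluecker_support[OF v_mem w_mem M(2) _ that, of a] assms(2) M(1) that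
    by (auto simp: v_nth w_nth)
qed

lemma cone_nonzero:
  assumes "x \<in> \<C>" shows "\<exists>a\<in>index_seqs r n. x a \<noteq> 0"
proof -
  obtain M where M: "x = plk r n M" "row_span r n M \<in> X" using mem_coneE[OF assms(1)] .
  then show ?thesis using row_span_in_richardson_iff[OF v_mem w_mem] by blast
qed

lemma cone_scale:
  assumes "x \<in> \<C>" "c \<noteq> 0" shows "(\<lambda>a. c * x a) \<in> \<C>"
proof -
  obtain M where M: "x = plk r n M" "row_span r n M \<in> X" using mem_coneE[OF assms(1)] .
  have "(\<Prod>i<r. if i = 0 then c else 1) = c" using r1 by (simp add: prod.delta)
  then have eq: "plk r n (\<lambda>i j. (if i = 0 then c else 1) * M i j) = (\<lambda>a. c * x a)"
    by (simp add: plk_row_scale M(1))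
  note cl = M(2)[unfolded row_span_in_richardson_iff[OF v_mem w_mem]]
  have "in_orbit_closure r n H u (\<lambda>a. c * x a)" if "in_orbit_closure r n H u x" for H u
    using that unfolding in_orbit_closure_def by (simp add: forms_scale)
  then have "row_span r n (\<lambda>i j. (if i = 0 then c else 1) * M i j) \<in> X"
    unfolding row_span_in_richardson_iff[OF v_mem w_mem] eq using cl assms(2) M(1) by auto
  then show ?thesis using plk_mem_cone eq by metis
qed

lemma cone_torus:
  assumes "x \<in> \<C>" and t: "(\<Prod>j<n. t j) = 1"
  shows "(\<lambda>a. torus_char r t a * x a) \<in> \<C>" "wedge_act r n (diag_of n t) x = (\<lambda>a. torus_char r t a * x a)"
proof -
  obtain M where M: "x = plk r n M" "row_span r n M \<in> X" using mem_coneE[OF assms(1)] .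
  have "plk r n (\<lambda>l j. t j * M l j) a = torus_char r t a * x a" for a
    by (cases "a \<in> index_seqs r n") (simp_all add: plk_column_scale M(1) plk_outside)
  then have eq: "plk r n (\<lambda>l j. t j * M l j) = (\<lambda>a. torus_char r t a * x a)" by (rule ext)
  show "(\<lambda>a. torus_char r t a * x a) \<in> \<C>"
    using plk_mem_cone[OF richardson_torus_stable[OF v_mem w_mem t M(2)]] by (simp add: eq)
  have "plk r n (\<lambda>l j. diag_of n t $$ (j, j) * M l j) = plk r n (\<lambda>l j. t j * M l j)"
    by (rule plk_cong) (simp add: diag_of_def)
  then show "wedge_act r n (diag_of n t) x = (\<lambda>a. torus_char r t a * x a)"
    by (simp add: M(1) wedge_act_plk[OF diag_of_torus[OF t]] eq[unfolded M(1)])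
qed

lemma inv_sectionsD:
  assumes "s \<in> inv_sections r n X d"
  shows "s \<in> global_sections (index_seqs r n) \<C> d"
    and "x \<in> \<C> \<Longrightarrow> (\<Prod>j<n. t j) = 1 \<Longrightarrow> s (\<lambda>a. torus_char r t a * x a) = s x"
    and "x \<in> \<C> \<Longrightarrow> c \<noteq> 0 \<Longrightarrow> s (\<lambda>a. c * x a) = c ^ d * s x"
proof -
  show s: "s \<in> global_sections (index_seqs r n) \<C> d" using assms by (simp add: inv_sections_def)
  show "x \<in> \<C> \<Longrightarrow> (\<Prod>j<n. t j) = 1 \<Longrightarrow> s (\<lambda>a. torus_char r t a * x a) = s x"
  proof -
    assume x: "x \<in> \<C>" and t: "(\<Prod>j<n. t j) = 1"
    have "s (wedge_act r n (diag_of n t) x) = s x"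
      using assms x diag_of_torus[OF t] by (simp add: inv_sections_def)
    then show "s (\<lambda>a. torus_char r t a * x a) = s x" by (simp only: cone_torus(2)[OF x t])
  qed
  show "x \<in> \<C> \<Longrightarrow> c \<noteq> 0 \<Longrightarrow> s (\<lambda>a. c * x a) = c ^ d * s x"
    using global_sections_scale[OF s] cone_scale by blast
qed

text \<open>
  A diagonal matrix is a scalar matrix times an element of the torus.  The scalar \<open>c\<close> acts on the exterior power
  by \<open>c ^ r\<close>, hence on the section by \<open>c ^ (r * n * k) = (c ^ n) ^ (r * k)\<close>.
\<close>

lemma inv_sections_diagonal:
  assumes s: "s \<in> inv_sections r n X (n * k)" and x: "x \<in> \<C>" and t: "\<And>j. j < n \<Longrightarrow> t j \<noteq> 0"
  shows "(\<lambda>a. torus_char r t a * x a) \<in> \<C>"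
    and "s (\<lambda>a. torus_char r t a * x a) = (\<Prod>j<n. t j) ^ (r * k) * s x"
proof -
  define T where "T = (\<Prod>j<n. t j)"
  have T: "T \<noteq> 0" using t by (simp add: T_def)
  have n0: "n \<noteq> 0" by (simp add: n_eq)
  obtain c where c: "c \<noteq> 0" "T = c ^ n" using exists_complex_root_nonzero[OF T n0] by metis
  define t' where "t' j = t j / c" for j
  have t': "(\<Prod>j<n. t' j) = 1" using c T by (simp add: t'_def prod_dividef T_def[symmetric])
  have "torus_char r t a = c ^ r * torus_char r t' a" for a
    using c(1) by (simp add: torus_char_def t'_def prod_dividef)
  then have eq: "(\<lambda>a. torus_char r t a * x a) = (\<lambda>a. c ^ r * (torus_char r t' a * x a))" by (simp add: mult_ac)
  have mem: "(\<lambda>a. torus_char r t' a * x a) \<in> \<C>" by (rule cone_torus(1)[OF x t'])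
  have cr: "c ^ r \<noteq> 0" using c(1) by simp
  show "(\<lambda>a. torus_char r t a * x a) \<in> \<C>" unfolding eq by (rule cone_scale[OF mem cr])
  have "s (\<lambda>a. torus_char r t a * x a) = (c ^ r) ^ (n * k) * s x"
    unfolding eq inv_sectionsD(3)[OF s mem cr] inv_sectionsD(2)[OF s x t'] ..
  also have "(c ^ r) ^ (n * k) = T ^ (r * k)"
    by (simp add: c(2) power_mult[symmetric] mult_ac)
  finally show "s (\<lambda>a. torus_char r t a * x a) = (\<Prod>j<n. t j) ^ (r * k) * s x" by (simp add: T_def)
qed

end

section \<open>Degeneration under one-parameter subgroups\<close>

context richardson_setup
begin


text \<open>
  Distinct index sequences have distinct binary weights, so that the weights \<open>2 ^ j\<close> define a one-parameter
  subgroup that separates the Pluecker coordinates.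
\<close>

definition binary_weight :: "nat list \<Rightarrow> nat" where "binary_weight a = (\<Sum>p<r. 2 ^ (a ! p - 1))"

lemma binary_weight_eq: "a \<in> index_seqs r n \<Longrightarrow> binary_weight a = set_encode ((\<lambda>i. i - 1) ` set a)"
proof -
  assume a: "a \<in> index_seqs r n"
  have inj: "inj_on (\<lambda>p. a ! p - 1) {..<r}" using index_seqs_nth_inj[OF a] by (auto intro!: inj_onI)
  have "set a = (!) a ` {..<r}" using index_seqsD(1)[OF a] by (auto simp: set_conv_nth)
  then have "(\<lambda>i. i - 1) ` set a = (\<lambda>p. a ! p - 1) ` {..<r}" by (simp add: image_image)
  then show ?thesis unfolding binary_weight_def set_encode_def by (simp only: sum.reindex[OF inj] o_def)
qed

lemma binary_weight_less: "a \<in> index_seqs r n \<Longrightarrow> binary_weight a < 2 ^ n"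
proof -
  assume a: "a \<in> index_seqs r n"
  have "(\<lambda>i. i - 1) ` set a \<subseteq> {..<n}" using a by (fastforce simp: index_seqs_def)
  then have "set_encode ((\<lambda>i. i - 1) ` set a) \<le> (\<Sum>j<n. 2 ^ j)"
    unfolding set_encode_def by (intro sum_mono2) auto
  also have "\<dots> = 2 ^ n - (1::nat)" by (induction n) auto
  finally show ?thesis using binary_weight_eq[OF a] by (simp add: Suc_le_eq[symmetric] le_diff_conv2)
qed

lemma binary_weight_inj:
  assumes "a \<in> index_seqs r n" "b \<in> index_seqs r n" "binary_weight a = binary_weight b"
  shows "a = b"
proof -
  have "(\<lambda>i. i - 1) ` set a = (\<lambda>i. i - 1) ` set b"
    using assms by (simp add: binary_weight_eq set_encode_eq)
  moreover have inj: "inj_on (\<lambda>i. i - 1) {1..n}" by (auto intro!: inj_onI)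
  ultimately have "set a = set b"
    using assms(1,2) inj_on_image_eq_iff[OF inj, of "set a" "set b"] by (simp add: index_seqs_def)
  then show ?thesis using assms(1,2) sorted_distinct_set_unique
    by (auto simp: index_seqs_def strict_sorted_iff)
qed

text \<open>
  A coordinate subspace whose index lies between \<open>v\<close> and \<open>w\<close> is spanned by a band matrix.
\<close>

lemma coord_point_mem_cone:
  assumes a: "a \<in> index_seqs r n" and "\<And>i. i < r \<Longrightarrow> lo i + 1 \<le> a ! i" "\<And>i. i < r \<Longrightarrow> a ! i \<le> hi i + 1" and c: "c \<noteq> 0"
  shows "(\<lambda>b. if b = a then c else 0) \<in> \<C>"
    and "\<exists>\<alpha> \<beta>. band \<alpha> \<beta> = (\<lambda>b. if b = a then c else 0)"
proof -
  define A where "A i j = (if j = a ! i - 1 then if i = 0 then c else 1 else 0)" for i j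
  have pc: "(\<Prod>i<r. if i = 0 then c else 1) = c" using r1 by (simp add: prod.delta)
  have A: "plk r n A = (\<lambda>b. if b = a then c else 0)"
    unfolding A_def[abs_def] plk_coord_rows[OF a, of "\<lambda>i. if i = 0 then c else 1"] pc ..
  have supp: "A i j = 0" if "i < r" "j < lo i \<or> hi i < j" for i j
    using assms(2,3)[OF that(1)] that(2) by (auto simp: A_def)
  show "(\<lambda>b. if b = a then c else 0) \<in> \<C>"
    using supported_mem_cone[of A a] supp c by (simp add: A)
  have "plk r n A = band (\<lambda>j. A (owner j) j) (\<lambda>j. A (owner j + 1) j)"
    by (rule plk_cong, rule supported_eq_band_mat) (use supp in auto)
  then show "\<exists>\<alpha> \<beta>. band \<alpha> \<beta> = (\<lambda>b. if b = a then c else 0)" using A by metis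
qed

definition meet_count :: "nat set \<Rightarrow> nat list \<Rightarrow> nat" where "meet_count S a = card {p. p < r \<and> a ! p - 1 \<in> S}"

text \<open>
  Let the diagonal matrix with entries \<open>z ^ (n * (K * [j \<in> S] + 2 ^ j) - \<sigma>)\<close> act on \<open>x\<close>, where \<open>K\<close> is large
  and \<open>\<sigma>\<close> makes the determinant 1.  The weight of the coordinate \<open>b\<close> is up to a constant
  \<open>n * (K * meet_count S b + binary_weight b)\<close>.  These weights are distinct, so after division by the smallest power
  of \<open>z\<close> that occurs, the curve tends as \<open>z \<rightarrow> 0\<close> to a coordinate vector, which belongs to the cone.
\<close>

lemma torus_degeneration:
  assumes s: "s \<in> inv_sections r n X d" and x: "x \<in> \<C>" and S: "S \<subseteq> {..<n}"
  shows "\<exists>a y. x a \<noteq> 0 \<and> a \<in> index_seqs r n \<and> y 0 = (\<lambda>b. if b = a then x a else 0)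
    \<and> (\<lambda>z. s (y z)) holomorphic_on UNIV
    \<and> (\<forall>z. z \<noteq> 0 \<longrightarrow> s (y z) * z ^ (n * ((r + 1) * 2 ^ n * meet_count S a + binary_weight a) * d)
        = z ^ (r * ((r + 1) * 2 ^ n * card S + (2 ^ n - 1)) * d) * s x)"
proof -
  define K where "K = (r + 1) * 2 ^ n"
  define key where "key b = K * meet_count S b + binary_weight b" for b
  define sg where "sg = K * card S + (2 ^ n - 1)"
  have fin: "finite {b. x b \<noteq> 0}"
    by (rule finite_subset[OF _ finite_index_seqs[of r n]]) (use cone_support(1)[OF x] in auto)
  define B where "B = {b. x b \<noteq> 0}"
  have "B \<noteq> {}" using cone_nonzero[OF x] by (auto simp: B_def)
  then have "Min (key ` B) \<in> key ` B" using fin by (intro Min_in) (auto simp: B_def)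
  then obtain a where aB: "a \<in> B" "key a = Min (key ` B)" by auto
  have a: "x a \<noteq> 0" "\<And>b. x b \<noteq> 0 \<Longrightarrow> key a \<le> key b"
    using aB fin by (simp_all add: B_def)
  have aI: "a \<in> index_seqs r n" by (rule cone_support(1)[OF x a(1)])
  have uniq: "b = a" if "x b \<noteq> 0" "key b = key a" for b
  proof (rule binary_weight_inj[OF _ aI])
    show bI: "b \<in> index_seqs r n" by (rule cone_support(1)[OF x that(1)])
    have "binary_weight b < K" "binary_weight a < K" using binary_weight_less[OF bI] binary_weight_less[OF aI] by (simp_all add: K_def trans_less_add1)
    then have "key b mod K = binary_weight b" "key a mod K = binary_weight a" by (simp_all add: key_def)
    then show "binary_weight b = binary_weight a" using that(2) by simp
  qed
  define y where "y z = (\<lambda>b. x b * z ^ (n * (key b - key a)))" for z :: complex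
  have y0: "y 0 = (\<lambda>b. if b = a then x a else 0)"
  proof
    fix b show "y 0 b = (if b = a then x a else 0)"
    proof (cases "x b = 0 \<or> b = a")
      case True
      then show ?thesis using a(1) by (auto simp: y_def)
    next
      case False
      then have "key b \<noteq> key a" "key a \<le> key b" using uniq a(2) by auto
      then have "n * (key b - key a) \<noteq> 0" by (simp add: n_eq)
      then show ?thesis using False by (simp add: y_def del: mult_eq_0_iff)
    qed
  qed
  have rel: "(\<lambda>b. torus_char r t b * x b) = (\<lambda>b. (z ^ (n * key a) / z ^ (r * sg)) * y z b)" and tn: "(\<Prod>j<n. t j) = 1"
    if z: "z \<noteq> 0" and t: "t = (\<lambda>j. z ^ (n * (K * (if j \<in> S then 1 else 0) + 2 ^ j)) / z ^ sg)" for z t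
  proof -
    have "(\<Sum>j<n. K * (if j \<in> S then 1 else 0) + 2 ^ j) = sg"
    proof -
      have "(\<Sum>j<n. (if j \<in> S then 1 else 0)) = card S"
        using S by (simp add: sum.If_cases Int_absorb1)
      moreover have "(\<Sum>j<n. 2 ^ j) = 2 ^ n - (1::nat)" by (induction n) auto
      ultimately show ?thesis by (simp add: sum.distrib sum_distrib_left[symmetric] sg_def)
    qed
    then have "(\<Sum>j<n. n * (K * (if j \<in> S then 1 else 0) + 2 ^ j)) = n * sg"
      by (simp only: sum_distrib_left[symmetric])
    then have "(\<Prod>j<n. z ^ (n * (K * (if j \<in> S then 1 else 0) + 2 ^ j))) = z ^ (n * sg)"
      by (simp only: power_sum[symmetric])
    then show "(\<Prod>j<n. t j) = 1"
      using z by (simp add: t prod_dividef power_mult[symmetric] mult.commute[of sg n])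
    show "(\<lambda>b. torus_char r t b * x b) = (\<lambda>b. (z ^ (n * key a) / z ^ (r * sg)) * y z b)"
    proof
      fix b show "torus_char r t b * x b = (z ^ (n * key a) / z ^ (r * sg)) * y z b"
      proof (cases "x b = 0")
        case False
        have "(\<Sum>p<r. (if b ! p - 1 \<in> S then 1 else 0)) = meet_count S b"
          by (simp add: meet_count_def sum.If_cases Collect_conj_eq lessThan_def)
        then have "(\<Sum>p<r. K * (if b ! p - 1 \<in> S then 1 else 0) + 2 ^ (b ! p - 1)) = key b"
          by (simp add: key_def binary_weight_def sum.distrib sum_distrib_left[symmetric])
        then have "(\<Sum>p<r. n * (K * (if b ! p - 1 \<in> S then 1 else 0) + 2 ^ (b ! p - 1))) = n * key b"
          by (simp only: sum_distrib_left[symmetric])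
        then have "(\<Prod>p<r. z ^ (n * (K * (if b ! p - 1 \<in> S then 1 else 0) + 2 ^ (b ! p - 1)))) = z ^ (n * key b)"
          by (simp only: power_sum[symmetric])
        then have tc: "torus_char r t b = z ^ (n * key b) / z ^ (r * sg)"
          by (simp add: torus_char_def t prod_dividef power_mult[symmetric] mult.commute[of sg r])
        have "n * key b = n * key a + n * (key b - key a)" using a(2)[OF False] by (simp add: distrib_left[symmetric])
        then have "z ^ (n * key b) = z ^ (n * key a) * z ^ (n * (key b - key a))" by (simp only: power_add)
        then show ?thesis by (simp add: tc y_def)
      qed (simp add: y_def)
    qed
  qed
  have yC: "y z \<in> \<C>" if z: "z \<noteq> 0" for z
  proof -
    define t where "t = (\<lambda>j. z ^ (n * (K * (if j \<in> S then 1 else 0) + 2 ^ j)) / z ^ sg)"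
    have "(\<lambda>b. torus_char r t b * x b) \<in> \<C>" by (rule cone_torus(1)[OF x tn[OF z t_def]])
    then have "(\<lambda>b. (z ^ (n * key a) / z ^ (r * sg)) * y z b) \<in> \<C>" by (simp only: rel[OF z t_def])
    from cone_scale[OF this, of "z ^ (r * sg) / z ^ (n * key a)"] show ?thesis using z by simp
  qed
  have seq: "s (y z) * z ^ (n * key a * d) = z ^ (r * sg * d) * s x" if z: "z \<noteq> 0" for z
  proof -
    define t where "t = (\<lambda>j. z ^ (n * (K * (if j \<in> S then 1 else 0) + 2 ^ j)) / z ^ sg)"
    have "s x = s (\<lambda>b. torus_char r t b * x b)"
      by (rule inv_sectionsD(2)[OF s x tn[OF z t_def], symmetric])
    also have "\<dots> = s (\<lambda>b. (z ^ (n * key a) / z ^ (r * sg)) * y z b)" by (simp only: rel[OF z t_def])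
    also have "\<dots> = (z ^ (n * key a) / z ^ (r * sg)) ^ d * s (y z)"
      by (rule inv_sectionsD(3)[OF s yC[OF z]]) (use z in simp)
    finally show ?thesis using z by (simp add: power_divide power_mult[symmetric] field_simps)
  qed
  have "y 0 \<in> \<C>"
    unfolding y0 by (rule coord_point_mem_cone(1)[OF aI _ _ a(1)]) (rule cone_support[OF x a(1)], assumption)+
  then have "y z \<in> \<C>" for z using yC by (cases "z = 0") auto
  then have "(\<lambda>z. s (y z)) holomorphic_on UNIV"
    by (intro global_sections_holomorphic[OF inv_sectionsD(1)[OF s] open_UNIV])
      (auto simp: y_def intro!: holomorphic_intros)
  then show ?thesis using a(1) aI y0 seq
    by (intro exI[of _ a] exI[of _ y]) (simp add: key_def K_def sg_def)
qed

text \<open>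
  The large factor \<open>(r + 1) * 2 ^ n\<close> in the weights makes the hypothesis on \<open>S\<close> outweigh the binary weights: all
  weights of \<open>x\<close> are positive.
\<close>

lemma inv_section_vanishes_if_unstable:
  assumes s: "s \<in> inv_sections r n X d" and x: "x \<in> \<C>" and S: "S \<subseteq> {..<n}" and d: "d > 0"
    and unstable: "\<And>a. x a \<noteq> 0 \<Longrightarrow> r * card S < n * meet_count S a"
  shows "s x = 0"
proof -
  obtain a y where ay: "x a \<noteq> 0" "a \<in> index_seqs r n" "(\<lambda>z. s (y z)) holomorphic_on UNIV"
    and eq: "\<forall>z. z \<noteq> 0 \<longrightarrow> s (y z) * z ^ (n * ((r + 1) * 2 ^ n * meet_count S a + binary_weight a) * d)
        = z ^ (r * ((r + 1) * 2 ^ n * card S + (2 ^ n - 1)) * d) * s x"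
    using torus_degeneration[OF s x S] by (elim exE conjE) (rule that)
  let ?K = "(r + 1) * 2 ^ n"
  have "r * (?K * card S + (2 ^ n - 1)) < ?K * (r * card S + 1)"
  proof -
    have "r * (2 ^ n - 1) < ?K" by (rule le_less_trans[of _ "r * 2 ^ n"]) auto
    moreover have "r * (?K * card S + (2 ^ n - 1)) = ?K * (r * card S) + r * (2 ^ n - 1)"
      by (simp only: distrib_left[of r] mult.left_commute[of r])
    moreover have "?K * (r * card S + 1) = ?K * (r * card S) + ?K"
      by (simp only: distrib_left mult_1_right)
    ultimately show ?thesis by linarith
  qed
  also have "?K * (r * card S + 1) \<le> ?K * (n * meet_count S a)"
    by (rule mult_le_mono2) (use unstable[OF ay(1)] in simp)
  also have "\<dots> \<le> n * (?K * meet_count S a + binary_weight a)" by (simp add: distrib_left mult_ac)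
  finally obtain e where e: "n * (?K * meet_count S a + binary_weight a) = r * (?K * card S + (2 ^ n - 1)) + e" "e > 0"
    using less_imp_add_positive by metis
  have "s (y z) * z ^ (e * d) - s x = 0" if z: "z \<noteq> 0" for z
  proof -
    have "z ^ (n * (?K * meet_count S a + binary_weight a) * d) = z ^ (r * (?K * card S + (2 ^ n - 1)) * d) * z ^ (e * d)"
      unfolding e(1) by (simp add: distrib_right power_add)
    then show ?thesis using eq[rule_format, OF z] z by simp
  qed
  then have "s (y 0) * 0 ^ (e * d) - s x = 0"
    by (intro finite_zero_extends[of "\<lambda>z. s (y z) * z ^ (e * d) - s x" UNIV "{0}" 0])
      (auto intro!: holomorphic_intros ay(3))
  moreover have "0 < e * d" using e(2) d by simp
  ultimately show ?thesis by (simp only: zero_power mult_zero_right) simp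
qed

text \<open>
  Degenerating with \<open>S = {}\<close> shows that \<open>s x\<close> is the value at a coordinate subspace.  The latter is the limit
  for \<open>z \<rightarrow> 0\<close> of band matrices whose entries at \<open>hi i\<close> are increased by \<open>z\<close>.
\<close>

lemma inv_section_degree_0:
  assumes s: "s \<in> inv_sections r n X 0" and x: "x \<in> \<C>"
    and nice: "\<And>\<alpha> \<beta>. (\<And>i. i < r \<Longrightarrow> \<alpha> (hi i) \<noteq> 0) \<Longrightarrow> s (band \<alpha> \<beta>) = c"
  shows "s x = c"
proof -
  obtain a y where ay: "x a \<noteq> 0" "a \<in> index_seqs r n" "y 0 = (\<lambda>b. if b = a then x a else 0)"
      "(\<lambda>z. s (y z)) holomorphic_on UNIV"
    and eq: "\<forall>z. z \<noteq> 0 \<longrightarrow> s (y z) * z ^ (n * ((r + 1) * 2 ^ n * meet_count {} a + binary_weight a) * 0)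
        = z ^ (r * ((r + 1) * 2 ^ n * card ({} :: nat set) + (2 ^ n - 1)) * 0) * s x"
    using torus_degeneration[OF s x empty_subsetI] by (elim exE conjE) (rule that)
  have "s (y 0) - s x = 0"
    by (rule finite_zero_extends[of "\<lambda>z. s (y z) - s x" UNIV "{0}" 0])
      (use eq in \<open>auto intro!: holomorphic_intros ay(4)\<close>)
  moreover have "s (y 0) = c"
  proof -
    obtain \<alpha> \<beta> where ab: "band \<alpha> \<beta> = (\<lambda>b. if b = a then x a else 0)"
      using coord_point_mem_cone(2)[OF ay(2) _ _ ay(1)] cone_support(2,3)[OF x ay(1)] by blast
    define A where "A z = band_mat (\<lambda>j. \<alpha> j + z * (if j \<in> hi ` {..<r} then 1 else 0)) \<beta>" for z
    have A0: "plk r n (A 0) = (\<lambda>b. if b = a then x a else 0)" by (simp add: A_def ab)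
    have hol: "(\<lambda>z. plk r n (A z) b) holomorphic_on UNIV" for b
      unfolding A_def by (intro plk_band_mat_holomorphic holomorphic_intros)
    \<comment> \<open>\<open>A z\<close> may fail to have full rank for some \<open>z\<close>, but not near 0\<close>
    define S where "S = {z. plk r n (A z) a \<noteq> 0}"
    have "open ((\<lambda>z. plk r n (A z) a) -` (- {0}))"
      using continuous_open_preimage[OF holomorphic_on_imp_continuous_on[OF hol] open_UNIV, of "- {0}"]
      by (simp add: open_Compl)
    moreover have "(\<lambda>z. plk r n (A z) a) -` (- {0}) = S" by (auto simp: S_def)
    ultimately have "open S" by simp
    have S0: "0 \<in> S" by (simp add: S_def A0 ay(1))
    have mem: "plk r n (A z) \<in> \<C>" if "z \<in> S" for z
      using that band_mat_mem_cone unfolding S_def A_def by blast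
    have holS: "(\<lambda>z. s (plk r n (A z)) - c) holomorphic_on S"
      by (intro holomorphic_on_diff holomorphic_on_const
          global_sections_holomorphic[OF inv_sectionsD(1)[OF s] \<open>open S\<close>] mem
          holomorphic_on_subset[OF hol]) auto
    have "s (plk r n (A 0)) - c = 0"
    proof (rule finite_zero_extends[OF holS \<open>open S\<close> _ _ S0])
      show "finite ((\<lambda>i. - \<alpha> (hi i)) ` {..<r})" by simp
      fix z assume "z \<notin> (\<lambda>i. - \<alpha> (hi i)) ` {..<r}"
      then have "\<alpha> (hi i) + z \<noteq> 0" if "i < r" for i using that by (auto simp: add_eq_0_iff)
      then show "s (plk r n (A z)) - c = 0" unfolding A_def by (subst nice) auto
    qed
    then show ?thesis by (simp add: A0 ay(3))
  qed
  ultimately show ?thesis by simp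
qed

end

section \<open>Invariant sections on band matrices\<close>

context richardson_setup
begin

lemma owner_le_iff: "owner j \<le> i \<longleftrightarrow> j \<le> (i + 1) * q"
proof
  assume "owner j \<le> i"
  then have "(owner j + 1) * q \<le> (i + 1) * q" by (intro mult_le_mono1) simp
  then show "j \<le> (i + 1) * q" using owner_upper[of j] by linarith
next
  assume j: "j \<le> (i + 1) * q"
  show "owner j \<le> i"
  proof (rule ccontr)
    assume "\<not> owner j \<le> i"
    then have "owner j \<noteq> 0" and "i + 1 \<le> owner j" by auto
    then have "(i + 1) * q \<le> owner j * q" by (intro mult_le_mono1)
    with \<open>owner j \<noteq> 0\<close> show False using owner_lower[of j] j by linarith
  qed
qed

text \<open>
  The exponents of the variables on the overlaps that occur in degree \<open>n * k\<close>.
\<close>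

definition exponents :: "nat \<Rightarrow> (nat \<Rightarrow> nat) set" where
  "exponents k = {x. (\<forall>j. j \<notin> overlap \<longrightarrow> x j = 0) \<and> (\<forall>i\<in>{..<r - 1}. (\<Sum>j | j \<in> overlap \<and> owner j = i. x j) = k * (r - 1 - i))}"

text \<open>
  The exponent of \<open>\<alpha> j\<close> makes the total degree in column \<open>j\<close> equal to \<open>r * k\<close>, as invariance under the torus
  requires.
\<close>

definition monomial :: "nat \<Rightarrow> (nat \<Rightarrow> nat) \<Rightarrow> (nat \<Rightarrow> complex) \<Rightarrow> (nat \<Rightarrow> complex) \<Rightarrow> complex" where
  "monomial k x \<alpha> \<beta> = (\<Prod>j<n. \<alpha> j ^ (r * k - x j)) * (\<Prod>j\<in>overlap. \<beta> j ^ x j)"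

lemma exponents_le: "x \<in> exponents k \<Longrightarrow> x j \<le> r * k"
proof (cases "j \<in> overlap")
  case True
  assume x: "x \<in> exponents k"
  have "x j \<le> (\<Sum>j' | j' \<in> overlap \<and> owner j' = owner j. x j')"
    by (rule member_le_sum) (use True finite_overlap in auto)
  also have "\<dots> = k * (r - 1 - owner j)" using x True by (auto simp: exponents_def overlap_iff)
  also have "\<dots> \<le> k * r" by (intro mult_le_mono2) simp
  finally show ?thesis by (simp add: mult.commute)
qed (simp add: exponents_def)

context
  fixes s k
  assumes s: "s \<in> inv_sections r n X (n * k)"
begin

text \<open>
  Sections on the slice of the band matrices in which all owners have the entry 1.
\<close>

definition \<Phi> :: "(nat \<Rightarrow> complex) \<Rightarrow> complex" where
  "\<Phi> b = s (band (\<lambda>_. 1) b)"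

lemma section_column_scale:
  assumes "\<And>i. i < r \<Longrightarrow> \<alpha> (hi i) \<noteq> 0" "\<And>j. j < n \<Longrightarrow> t j \<noteq> 0"
  shows "s (band (\<lambda>j. t j * \<alpha> j) (\<lambda>j. t j * \<beta> j)) = (\<Prod>j<n. t j) ^ (r * k) * s (band \<alpha> \<beta>)"
proof -
  have eq: "band (\<lambda>j. t j * \<alpha> j) (\<lambda>j. t j * \<beta> j) = (\<lambda>a. torus_char r t a * band \<alpha> \<beta> a)"
  proof
    fix a
    have "band (\<lambda>j. t j * \<alpha> j) (\<lambda>j. t j * \<beta> j) = plk r n (\<lambda>i j. t j * band_mat \<alpha> \<beta> i j)"
      by (rule plk_cong) (simp add: band_mat_def)
    then show "band (\<lambda>j. t j * \<alpha> j) (\<lambda>j. t j * \<beta> j) a = torus_char r t a * band \<alpha> \<beta> a"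
      by (cases "a \<in> index_seqs r n") (simp_all add: plk_column_scale plk_outside)
  qed
  have "band \<alpha> \<beta> \<in> \<C>" by (rule band_mem_cone) (rule assms(1))
  from inv_sections_diagonal(2)[OF s this assms(2)] show ?thesis by (simp add: eq)
qed

lemma section_row_scale:
  assumes "\<And>i. i < r \<Longrightarrow> \<alpha> (hi i) \<noteq> 0" "\<And>i. i < r \<Longrightarrow> l i \<noteq> 0"
  shows "s (band (\<lambda>j. l (owner j) * \<alpha> j) (\<lambda>j. l (owner j + 1) * \<beta> j)) = (\<Prod>i<r. l i) ^ (n * k) * s (band \<alpha> \<beta>)"
proof -
  have "band (\<lambda>j. l (owner j) * \<alpha> j) (\<lambda>j. l (owner j + 1) * \<beta> j) = plk r n (\<lambda>i j. l i * band_mat \<alpha> \<beta> i j)"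
    by (rule plk_cong) (auto simp: band_mat_def)
  also have "\<dots> = (\<lambda>a. (\<Prod>i<r. l i) * band \<alpha> \<beta> a)" by (rule plk_row_scale)
  finally have eq: "band (\<lambda>j. l (owner j) * \<alpha> j) (\<lambda>j. l (owner j + 1) * \<beta> j)
    = (\<lambda>a. (\<Prod>i<r. l i) * band \<alpha> \<beta> a)" .
  have "band \<alpha> \<beta> \<in> \<C>" by (rule band_mem_cone) (rule assms(1))
  moreover have "(\<Prod>i<r. l i) \<noteq> 0" using assms(2) by simp
  ultimately show ?thesis unfolding eq by (rule inv_sectionsD(3)[OF s])
qed

text \<open>
  Multiply the rows after \<open>i\<close> by \<open>\<mu>\<close> and divide the columns owned by them by \<open>\<mu>\<close>.  This changes precisely the
  entries on the \<open>i\<close>-th overlap.  There are \<open>e = r - 1 - i\<close> such rows and \<open>e * q\<close> such columns, so the section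
  is multiplied by \<open>\<mu>\<close> to the power \<open>e * n * k - e * q * r * k = e * k\<close>.
\<close>

lemma \<Phi>_homogeneous:
  assumes i: "i < r - 1" and \<mu>: "\<mu> \<noteq> 0"
  shows "\<Phi> (\<lambda>j. if owner j = i then \<mu> * b j else b j) = \<mu> ^ (k * (r - 1 - i)) * \<Phi> b"
proof -
  \<comment> \<open>the factors of the rows; their inverses are the factors of the owned columns\<close>
  define l where "l h = (if h \<le> i then 1 else \<mu>)" for h
  have l: "l h \<noteq> 0" for h using \<mu> by (simp add: l_def)
  define e where "e = r - 1 - i"
  have "(\<Prod>h<r. l h) = (\<Prod>h\<in>{Suc i..<r}. l h)"
    by (rule prod.mono_neutral_right) (auto simp: l_def)
  also have "\<dots> = (\<Prod>h\<in>{Suc i..<r}. \<mu>)" by (rule prod.cong) (auto simp: l_def)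
  finally have l_rows: "(\<Prod>h<r. l h) = \<mu> ^ e" by (simp add: e_def)
  have cc: "n - Suc ((i + 1) * q) = e * q"
    by (simp add: n_eq e_def diff_mult_distrib2 mult.commute)
  have "(\<Prod>j<n. l (owner j)) = (\<Prod>j\<in>{Suc ((i + 1) * q)..<n}. l (owner j))"
    by (rule prod.mono_neutral_right) (auto simp: l_def owner_le_iff)
  also have "\<dots> = (\<Prod>j\<in>{Suc ((i + 1) * q)..<n}. \<mu>)"
    by (rule prod.cong) (auto simp: l_def owner_le_iff)
  finally have l_cols: "(\<Prod>j<n. l (owner j)) = \<mu> ^ (e * q)"
    by (simp only: prod_constant card_atLeastLessThan cc)
  define t where "t j = 1 / l (owner j)" for j
  have t_prod: "(\<Prod>j<n. t j) = 1 / \<mu> ^ (e * q)" by (simp add: t_def prod_dividef l_cols)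
  have "band (\<lambda>_. 1) (\<lambda>j. if owner j = i then \<mu> * b j else b j)
    = band (\<lambda>j. t j * (l (owner j) * 1)) (\<lambda>j. t j * (l (owner j + 1) * b j))"
    using \<mu> by (intro plk_cong) (auto simp: band_mat_def t_def l_def)
  then have "\<Phi> (\<lambda>j. if owner j = i then \<mu> * b j else b j)
    = s (band (\<lambda>j. t j * (l (owner j) * 1)) (\<lambda>j. t j * (l (owner j + 1) * b j)))"
    by (simp add: \<Phi>_def)
  also have "\<dots> = (\<Prod>j<n. t j) ^ (r * k) * s (band (\<lambda>j. l (owner j) * 1) (\<lambda>j. l (owner j + 1) * b j))"
    by (rule section_column_scale) (simp_all add: l t_def)
  also have "s (band (\<lambda>j. l (owner j) * 1) (\<lambda>j. l (owner j + 1) * b j)) = (\<Prod>h<r. l h) ^ (n * k) * \<Phi> b"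
    unfolding \<Phi>_def by (rule section_row_scale) (simp_all add: l)
  also have "(\<Prod>j<n. t j) ^ (r * k) * ((\<Prod>h<r. l h) ^ (n * k) * \<Phi> b)
    = \<mu> ^ (e * (n * k)) / \<mu> ^ (e * q * (r * k)) * \<Phi> b"
    by (simp add: t_prod l_rows power_divide power_mult[symmetric])
  also have "\<mu> ^ (e * (n * k)) = \<mu> ^ (e * q * (r * k)) * \<mu> ^ (k * e)"
    unfolding power_add[symmetric] by (rule arg_cong[where f = "\<lambda>u. \<mu> ^ u"]) (simp add: n_eq algebra_simps)
  finally show ?thesis using \<mu> by (simp add: e_def)
qed

lemma \<Phi>_is_poly_comb: "is_poly_comb overlap (exponents k) \<Phi>"
  unfolding exponents_def
proof (rule multihomogeneous_entire_is_poly_comb)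
  show "owner ` overlap \<subseteq> {..<r - 1}" by (auto simp: overlap_iff)
  show "\<Phi> b = \<Phi> b'" if "\<And>j. j \<in> overlap \<Longrightarrow> b j = b' j" for b b'
  proof -
    have "band (\<lambda>_. 1) b = band (\<lambda>_. 1) b'"
      by (rule plk_cong) (simp add: band_mat_def that)
    then show ?thesis by (simp add: \<Phi>_def)
  qed
  show "(\<lambda>z. \<Phi> (\<lambda>j. b j + z * b' j)) holomorphic_on UNIV" for b b'
    unfolding \<Phi>_def
  proof (rule global_sections_holomorphic[OF inv_sectionsD(1)[OF s] open_UNIV])
    show "band (\<lambda>_. 1) (\<lambda>j. b j + z * b' j) \<in> \<C>" for z
      by (rule band_mem_cone) simp
    show "(\<lambda>z. band (\<lambda>_. 1) (\<lambda>j. b j + z * b' j) a) holomorphic_on UNIV" for a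
      by (intro plk_band_mat_holomorphic holomorphic_intros)
  qed
  show "\<Phi> (\<lambda>j. if owner j = i then \<mu> * b j else b j) = \<mu> ^ (k * (r - 1 - i)) * \<Phi> b"
    if "i \<in> {..<r - 1}" "\<mu> \<noteq> 0" for i \<mu> b using \<Phi>_homogeneous[of i \<mu> b] that by simp
qed (auto simp: finite_overlap)

text \<open>
  Where no owner vanishes, the columns can be scaled to reach the slice.  The remaining case follows by
  continuity, along the line on which all vanishing owners become \<open>z\<close>.
\<close>

lemma section_expansion:
  "\<exists>E c. finite E \<and> E \<subseteq> exponents k \<and> (\<forall>\<alpha> \<beta>. (\<forall>i<r. \<alpha> (hi i) \<noteq> 0) \<longrightarrow>
    s (band \<alpha> \<beta>) = (\<Sum>x\<in>E. c x * monomial k x \<alpha> \<beta>))"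
proof -
  obtain E c where E: "finite E" "E \<subseteq> exponents k" "\<Phi> = (\<lambda>b. \<Sum>x\<in>E. c x * (\<Prod>j\<in>overlap. b j ^ x j))"
    using \<Phi>_is_poly_comb unfolding is_poly_comb_def by (elim exE conjE) (rule that)
  have generic: "s (band \<alpha> \<beta>) = (\<Sum>x\<in>E. c x * monomial k x \<alpha> \<beta>)" if \<alpha>: "\<And>j. j < n \<Longrightarrow> \<alpha> j \<noteq> 0" for \<alpha> \<beta>
  proof -
    have Ov_n: "j < n" if "j \<in> overlap" for j using that by (simp add: overlap_iff)
    have "band \<alpha> \<beta> = band (\<lambda>j. \<alpha> j * 1) (\<lambda>j. \<alpha> j * (\<beta> j / \<alpha> j))"
      by (rule plk_cong) (simp add: band_mat_def \<alpha>)
    then have "s (band \<alpha> \<beta>) = (\<Prod>j<n. \<alpha> j) ^ (r * k) * \<Phi> (\<lambda>j. \<beta> j / \<alpha> j)"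
      unfolding \<Phi>_def by (simp only:) (rule section_column_scale, simp_all add: \<alpha>)
    also have "\<dots> = (\<Sum>x\<in>E. c x * ((\<Prod>j<n. \<alpha> j ^ (r * k)) * (\<Prod>j\<in>overlap. (\<beta> j / \<alpha> j) ^ x j)))"
      by (simp add: E(3) sum_distrib_left mult_ac prod_power_distrib)
    also have "\<dots> = (\<Sum>x\<in>E. c x * monomial k x \<alpha> \<beta>)"
    proof (rule sum.cong[OF refl])
      fix x assume "x \<in> E"
      then have x: "x \<in> exponents k" using E(2) by blast
      have "(\<Prod>j\<in>overlap. \<alpha> j ^ x j) = (\<Prod>j<n. \<alpha> j ^ x j)"
        by (rule prod.mono_neutral_left) (use x in \<open>auto simp: overlap_iff exponents_def\<close>)
      then have eq1: "(\<Prod>j\<in>overlap. (\<beta> j / \<alpha> j) ^ x j) = (\<Prod>j\<in>overlap. \<beta> j ^ x j) / (\<Prod>j<n. \<alpha> j ^ x j)"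
        by (simp add: power_divide prod_dividef)
      have eq2: "(\<Prod>j<n. \<alpha> j ^ (r * k)) / (\<Prod>j<n. \<alpha> j ^ x j) = (\<Prod>j<n. \<alpha> j ^ (r * k - x j))"
        unfolding prod_dividef[symmetric] by (rule prod.cong) (auto simp: power_diff \<alpha> exponents_le[OF x])
      show "c x * ((\<Prod>j<n. \<alpha> j ^ (r * k)) * (\<Prod>j\<in>overlap. (\<beta> j / \<alpha> j) ^ x j)) = c x * monomial k x \<alpha> \<beta>"
        unfolding monomial_def eq1 eq2[symmetric] by simp
    qed
    finally show ?thesis .
  qed
  have "s (band \<alpha> \<beta>) = (\<Sum>x\<in>E. c x * monomial k x \<alpha> \<beta>)" if \<alpha>: "\<forall>i<r. \<alpha> (hi i) \<noteq> 0" for \<alpha> \<beta>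
  proof -
    define \<alpha>' where "\<alpha>' z j = \<alpha> j + z * (if \<alpha> j = 0 then 1 else 0)" for z j
    have hol\<alpha>: "(\<lambda>z. \<alpha>' z j) holomorphic_on UNIV" for j unfolding \<alpha>'_def by (intro holomorphic_intros)
    have hol: "(\<lambda>z. band (\<alpha>' z) \<beta> a) holomorphic_on UNIV" for a
      by (intro plk_band_mat_holomorphic hol\<alpha> holomorphic_intros)
    have "band (\<alpha>' z) \<beta> \<in> \<C>" for z by (rule band_mem_cone) (use \<alpha> in \<open>simp add: \<alpha>'_def\<close>)
    then have "(\<lambda>z. s (band (\<alpha>' z) \<beta>)) holomorphic_on UNIV"
      using hol by (intro global_sections_holomorphic[OF inv_sectionsD(1)[OF s] open_UNIV]) auto
    moreover have "(\<lambda>z. \<Sum>x\<in>E. c x * monomial k x (\<alpha>' z) \<beta>) holomorphic_on UNIV"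
      unfolding monomial_def by (intro holomorphic_intros hol\<alpha>)
    ultimately have h: "(\<lambda>z. s (band (\<alpha>' z) \<beta>) - (\<Sum>x\<in>E. c x * monomial k x (\<alpha>' z) \<beta>)) holomorphic_on UNIV"
      by (rule holomorphic_on_diff)
    have "s (band (\<alpha>' 0) \<beta>) - (\<Sum>x\<in>E. c x * monomial k x (\<alpha>' 0) \<beta>) = 0"
      by (rule finite_zero_extends[OF h open_UNIV, of "{0}"]) (auto simp: generic \<alpha>'_def)
    moreover have "\<alpha>' 0 = \<alpha>" by (simp add: \<alpha>'_def fun_eq_iff)
    ultimately show ?thesis by simp
  qed
  with E(1,2) show ?thesis by (intro exI[of _ E] exI[of _ c]) auto
qed

end

end

section \<open>Unstable points\<close>

lemma plk_contraction:
  "\<exists>\<kappa>. plk r n (\<lambda>i j. rdet r M ((c i)(i := j))) = (\<lambda>a. \<kappa> * plk r n M a)"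
proof -
  have "\<forall>i\<in>{..<r}. \<exists>C. \<forall>j. rdet r M ((c i)(i := j)) = (\<Sum>h<r. C h * M h j)"
    using rdet_contraction by blast
  from bchoice[OF this] obtain C where C: "\<forall>i\<in>{..<r}. \<forall>j. rdet r M ((c i)(i := j)) = (\<Sum>h<r. C i h * M h j)"
    by - (elim exE, rule that)
  have "plk r n (\<lambda>i j. rdet r M ((c i)(i := j))) = plk r n (\<lambda>i j. \<Sum>h<r. C i h * M h j)"
    by (rule plk_cong) (use C in auto)
  then show ?thesis by (auto simp: plk_mult)
qed

context richardson_setup
begin

lemma binary_weight_of_positions:
  assumes a: "a \<in> index_seqs r n" "set a = Suc ` c ` {..<r}" and inj: "inj_on c {..<r}"
  shows "binary_weight a = (\<Sum>p<r. 2 ^ c p)"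
proof -
  have "(\<lambda>i. i - 1) ` set a = c ` {..<r}" unfolding a(2) by (simp add: image_image)
  then show ?thesis using binary_weight_eq[OF a(1)] by (simp add: set_encode_def sum.reindex[OF inj])
qed

lemma rdet_nonzero_inj: "rdet r M c \<noteq> 0 \<Longrightarrow> inj_on c {..<r}"
  using rdet_eq_0_of_repeat[of _ r _ c M] by (auto simp: inj_on_def)

text \<open>
  Among the nonzero Pluecker coordinates of \<open>x\<close>, the one at \<open>\<pi>\<close> of largest binary weight is also the largest in the
  componentwise order: contracting at the other members of \<open>\<pi>\<close> gives a basis in echelon form with pivots at
  \<open>\<pi>\<close>, since an entry beyond a pivot would be a Pluecker coordinate of larger weight.
\<close>

lemma triangular_normal_form:
  assumes x: "x \<in> \<C>"
  shows "\<exists>A \<pi> \<kappa>. \<pi> \<in> index_seqs r n \<and> x \<pi> \<noteq> 0 \<and> plk r n A = (\<lambda>a. \<kappa> * x a) \<and> \<kappa> \<noteq> 0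
    \<and> (\<forall>i<r. \<forall>j<n. \<pi> ! i - 1 < j \<longrightarrow> A i j = 0) \<and> (\<forall>i<r. A i (\<pi> ! i - 1) \<noteq> 0)
    \<and> (\<forall>a. x a \<noteq> 0 \<longrightarrow> (\<forall>i<r. a ! i \<le> \<pi> ! i))"
proof -
  obtain M where M: "x = plk r n M" using mem_coneE[OF x] by metis
  define B where "B = {b. x b \<noteq> 0}"
  have fin: "finite B"
    by (rule finite_subset[OF _ finite_index_seqs[of r n]]) (use cone_support(1)[OF x] in \<open>auto simp: B_def\<close>)
  have "B \<noteq> {}" using cone_nonzero[OF x] by (auto simp: B_def)
  then have "Max (binary_weight ` B) \<in> binary_weight ` B" using fin by (intro Max_in) auto
  then obtain \<pi> where \<pi>B: "\<pi> \<in> B" "binary_weight \<pi> = Max (binary_weight ` B)" by auto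
  have max: "binary_weight b \<le> binary_weight \<pi>" if "x b \<noteq> 0" for b using \<pi>B fin that by (simp add: B_def)
  have x\<pi>: "x \<pi> \<noteq> 0" using \<pi>B by (simp add: B_def)
  have \<pi>: "\<pi> \<in> index_seqs r n" by (rule cone_support(1)[OF x x\<pi>])
  have \<pi>n: "\<pi> ! p - 1 < n" if "p < r" for p using index_seqsD(2,3)[OF \<pi> that] by linarith
  define c where "c p = \<pi> ! p - 1" for p
  define A where "A i j = rdet r M (c(i := j))" for i j
  obtain \<kappa> where \<kappa>: "plk r n A = (\<lambda>a. \<kappa> * x a)"
    unfolding A_def[abs_def] M using plk_contraction[of r n M "\<lambda>_. c"] by blast
  have diag: "A i (c i) = x \<pi>" for i
    unfolding A_def fun_upd_triv M plk_apply[OF \<pi>] by (simp add: c_def[abs_def])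
  have tri: "A i j = 0" if ij: "i < r" "j < n" "\<pi> ! i - 1 < j" for i j
  proof (rule ccontr)
    assume nz: "A i j \<noteq> 0"
    have cn: "(c(i := j)) p < n" if "p < r" for p using \<pi>n[OF that] ij(2) by (simp add: c_def)
    obtain b where b: "b \<in> index_seqs r n" "set b = Suc ` (c(i := j)) ` {..<r}" "plk r n M b \<noteq> 0"
      using ex_plk_nonzero_of_rdet[OF nz[unfolded A_def] cn] by blast
    have "binary_weight b = (\<Sum>p<r. 2 ^ (c(i := j)) p)"
      by (rule binary_weight_of_positions[OF b(1,2) rdet_nonzero_inj[OF nz[unfolded A_def]]])
    also have "\<dots> = 2 ^ j + (\<Sum>p\<in>{..<r} - {i}. 2 ^ (c(i := j)) p)"
      using ij(1) by (subst sum.remove[of _ i]) auto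
    also have "(\<Sum>p\<in>{..<r} - {i}. 2 ^ (c(i := j)) p) = (\<Sum>p\<in>{..<r} - {i}. 2 ^ c p)"
      by (rule sum.cong) auto
    also have "binary_weight \<pi> = 2 ^ c i + (\<Sum>p\<in>{..<r} - {i}. 2 ^ c p)"
      unfolding binary_weight_def c_def using ij(1) by (subst sum.remove[of _ i]) auto
    then have "2 ^ j + (\<Sum>p\<in>{..<r} - {i}. 2 ^ c p) = 2 ^ j + binary_weight \<pi> - 2 ^ c i" by simp
    finally have "binary_weight b = 2 ^ j + binary_weight \<pi> - 2 ^ c i" .
    moreover have "(2::nat) ^ c i < 2 ^ j" using ij(3) by (simp add: c_def)
    moreover have "binary_weight b \<le> binary_weight \<pi>" using max b(3) by (simp add: M)
    ultimately show False by linarith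
  qed
  have dom: "a ! i \<le> \<pi> ! i" if "plk r n A a \<noteq> 0" "i < r" for a i
  proof (rule ccontr)
    assume gt: "\<not> a ! i \<le> \<pi> ! i"
    have aI: "a \<in> index_seqs r n" using that(1) plk_outside by blast
    have "rdet r A (\<lambda>p. a ! p - 1) = 0"
    proof (rule rdet_eq_0_of_zero_block[OF that(2)])
      fix p l assume pl: "i \<le> p" "p < r" "l \<le> i"
      have "\<pi> ! l \<le> \<pi> ! i" "a ! i \<le> a ! p"
        using index_seqs_mono[OF \<pi> pl(3) that(2)] index_seqs_mono[OF aI pl(1,2)] by auto
      then have "\<pi> ! l - 1 < a ! p - 1" "a ! p - 1 < n"
        using gt index_seqsD(2)[OF \<pi>, of l] index_seqsD(2,3)[OF aI pl(2)] pl that(2) by linarith+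
      then show "A l (a ! p - 1) = 0" using tri pl that(2) by simp
    qed
    then show False using that(1) by (simp add: plk_apply[OF aI])
  qed
  have "plk r n A \<pi> = (\<Prod>p<r. A p (\<pi> ! p - 1))"
    unfolding plk_apply[OF \<pi>]
  proof (rule rdet_triangular)
    fix p l assume "l < p" "p < r"
    then show "A l (\<pi> ! p - 1) = 0"
      using tri[of l "\<pi> ! p - 1"] \<pi>n[of p] index_seqsD(2)[OF \<pi>, of l] index_seqsD(4)[OF \<pi>, of l p] by simp
  qed
  also have "\<dots> = x \<pi> ^ r" using diag by (simp add: c_def)
  finally have "plk r n A \<pi> \<noteq> 0" using x\<pi> by simp
  then have "\<kappa> \<noteq> 0" by (auto simp: \<kappa>)
  then show ?thesis
    by (intro exI[of _ A] exI[of _ \<pi>] exI[of _ \<kappa>])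
      (use \<pi> x\<pi> \<kappa> tri dom diag in \<open>auto simp: \<kappa> c_def\<close>)
qed

text \<open>
  Put the point in echelon form with pivots \<open>\<pi>\<close>.  If \<open>\<pi>\<close> is smaller than \<open>w\<close> at the place \<open>i\<close>, then the coordinate
  subspace of the columns before \<open>hi i\<close> meets the point in dimension at least \<open>i + 1\<close>, which is too large.
  Otherwise consider the columns \<open>lo i, \<dots>, hi (i - 1)\<close> common to the rows \<open>i - 1\<close> and \<open>i\<close>.  There are at most \<open>q\<close>
  of them, so that already a line in their coordinate subspace makes the point unstable.  If no such line
  exists, some nonzero Pluecker coordinate avoids these columns for each \<open>i\<close>, and contracting at its first \<open>i\<close>
  members and the last pivots gives a vector of the point that is supported on the interval of row \<open>i\<close>.
\<close>

lemma cone_point_on_band_or_unstable: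
  assumes x: "x \<in> \<C>"
  shows "(\<exists>\<alpha> \<beta> c. (\<forall>i<r. \<alpha> (hi i) \<noteq> 0) \<and> c \<noteq> 0 \<and> x = (\<lambda>a. c * band \<alpha> \<beta> a))
    \<or> (\<exists>S\<subseteq>{..<n}. \<forall>a. x a \<noteq> 0 \<longrightarrow> r * card S < n * meet_count S a)"
proof -
  obtain A \<pi> \<kappa> where \<pi>: "\<pi> \<in> index_seqs r n" "x \<pi> \<noteq> 0" and \<kappa>: "plk r n A = (\<lambda>a. \<kappa> * x a)" "\<kappa> \<noteq> 0"
    and tri: "\<forall>i<r. \<forall>j<n. \<pi> ! i - 1 < j \<longrightarrow> A i j = 0"
    and diag: "\<forall>i<r. A i (\<pi> ! i - 1) \<noteq> 0"
    and dom': "\<forall>a. x a \<noteq> 0 \<longrightarrow> (\<forall>i<r. a ! i \<le> \<pi> ! i)"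
    using triangular_normal_form[OF x] by - (elim exE conjE, rule that)
  have dom: "a ! i \<le> \<pi> ! i" if "x a \<noteq> 0" "i < r" for a i using dom' that by blast
  show ?thesis
  proof (cases "\<exists>i<r. \<pi> ! i \<noteq> hi i + 1")
    case True
    then obtain i where i: "i < r" "\<pi> ! i \<le> hi i"
      using cone_support(3)[OF x \<pi>(2)] by (metis Suc_eq_plus1 le_SucE)
    have "r * card {..<hi i} < n * meet_count {..<hi i} a" if a: "x a \<noteq> 0" for a
    proof -
      have aI: "a \<in> index_seqs r n" by (rule cone_support(1)[OF x a])
      have "{..i} \<subseteq> {p. p < r \<and> a ! p - 1 \<in> {..<hi i}}"
      proof
        fix p assume p: "p \<in> {..i}"
        have "a ! p \<le> a ! i" using index_seqs_mono[OF aI] p i(1) by auto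
        moreover have "a ! p \<ge> 1" using index_seqsD(2)[OF aI] p i(1) by auto
        ultimately show "p \<in> {p. p < r \<and> a ! p - 1 \<in> {..<hi i}}" using dom[OF a i(1)] i p by auto
      qed
      from card_mono[OF _ this] have "i + 1 \<le> meet_count {..<hi i} a" by (simp add: meet_count_def)
      then have "n * (i + 1) \<le> n * meet_count {..<hi i} a" by (rule mult_le_mono2)
      moreover have "r * hi i < n * (i + 1)" by (simp add: hi_def n_eq algebra_simps)
      ultimately show ?thesis by simp
    qed
    moreover have "{..<hi i} \<subseteq> {..<n}" using hi_less_n[OF i(1)] by auto
    ultimately show ?thesis by blast
  next
    case False
    then have \<pi>_nth: "\<pi> ! i = hi i + 1" if "i < r" for i using that by blast
    have tri': "A i j = 0" if "i < r" "j < n" "hi i < j" for i j using tri that \<pi>_nth by simp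
    have diag': "A i (hi i) \<noteq> 0" if "i < r" for i using diag[rule_format, OF that] \<pi>_nth[OF that] by simp
    have hi_mono: "hi i < hi p" if "i < p" for i p using that q1 by (simp add: hi_def)
    show ?thesis
    proof (cases "\<exists>i. 1 \<le> i \<and> i < r \<and> (\<forall>a. x a \<noteq> 0 \<longrightarrow> (\<exists>p<r. a ! p - 1 \<in> {lo i..i * q}))")
      case True
      then obtain i where i: "1 \<le> i" "i < r" and meet: "\<And>a. x a \<noteq> 0 \<Longrightarrow> \<exists>p<r. a ! p - 1 \<in> {lo i..i * q}" by blast
      have "i * q = (i - 1) * q + q" using i(1) by (cases i) auto
      then have card: "card {lo i..i * q} \<le> q" using lo_bounds(1)[OF i] by simp
      have "r * card {lo i..i * q} < n * meet_count {lo i..i * q} a" if "x a \<noteq> 0" for a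
      proof -
        obtain p where "p < r" "a ! p - 1 \<in> {lo i..i * q}" using meet[OF \<open>x a \<noteq> 0\<close>] by blast
        then have "card {p} \<le> meet_count {lo i..i * q} a" unfolding meet_count_def by (intro card_mono) auto
        then have "n * 1 \<le> n * meet_count {lo i..i * q} a" by (intro mult_le_mono2) simp
        moreover have "r * card {lo i..i * q} \<le> r * q" by (rule mult_le_mono2[OF card])
        moreover have "r * q < n" by (simp add: n_eq mult.commute)
        ultimately show ?thesis by linarith
      qed
      moreover have "{lo i..i * q} \<subseteq> {..<n}"
      proof -
        have "i * q < n" using hi_less_n[OF i(2)] by (simp add: hi_def)
        then show ?thesis by auto
      qed
      ultimately show ?thesis by blast
    next
      case False
      have "\<forall>i\<in>{1..<r}. \<exists>a. x a \<noteq> 0 \<and> (\<forall>p<r. a ! p - 1 \<notin> {lo i..i * q})"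
      proof (rule ballI, rule ccontr)
        fix i assume i: "i \<in> {1..<r}" and no: "\<not> (\<exists>a. x a \<noteq> 0 \<and> (\<forall>p<r. a ! p - 1 \<notin> {lo i..i * q}))"
        from no have "\<forall>a. x a \<noteq> 0 \<longrightarrow> (\<exists>p<r. a ! p - 1 \<in> {lo i..i * q})" by blast
        with i have "1 \<le> i \<and> i < r \<and> (\<forall>a. x a \<noteq> 0 \<longrightarrow> (\<exists>p<r. a ! p - 1 \<in> {lo i..i * q}))" by simp
        with False show False by blast
      qed
      from bchoice[OF this] obtain b where
        b: "\<forall>i\<in>{1..<r}. x (b i) \<noteq> 0 \<and> (\<forall>p<r. b i ! p - 1 \<notin> {lo i..i * q})" by - (elim exE, rule that)
      define c where "c i p = (if p < i then b i ! p - 1 else hi p)" for i p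
      have below: "b i ! p - 1 < lo i" if "p < i" "i < r" for i p
      proof -
        have bi: "x (b i) \<noteq> 0" "b i ! p - 1 \<notin> {lo i..i * q}" using b that by auto
        have "b i ! p \<le> hi p + 1" using cone_support(3)[OF x bi(1), of p] that by simp
        moreover have "hi p \<le> i * q" unfolding hi_def using that by (intro mult_le_mono1) simp
        ultimately show ?thesis using bi(2) by auto
      qed
      have above: "i * q < b i ! p - 1" if "i \<le> p" "p < r" "1 \<le> i" for i p
      proof -
        have bi: "x (b i) \<noteq> 0" "b i ! p - 1 \<notin> {lo i..i * q}" using b that by auto
        have "lo i + 1 \<le> b i ! i" using cone_support(2)[OF x bi(1), of i] that by simp
        also have "\<dots> \<le> b i ! p" using index_seqs_mono[OF cone_support(1)[OF x bi(1)] that(1,2)] .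
        finally show ?thesis using bi(2) by auto
      qed
      have cn: "c i p < n" if "p < r" "i < r" for i p
      proof (cases "p < i")
        case True
        then show ?thesis using below[OF True that(2)] lo_less_hi[OF that(2)] hi_less_n[OF that(2)] by (simp add: c_def)
      qed (use hi_less_n that in \<open>simp add: c_def\<close>)
      \<comment> \<open>\<open>c i\<close> consists of the first \<open>i\<close> members of \<open>b i\<close> and the last pivots; the place \<open>i\<close> is free\<close>
      define A' where "A' i j = rdet r A ((c i)(i := j))" for i j
      obtain \<kappa>' where \<kappa>': "plk r n A' = (\<lambda>a. \<kappa>' * plk r n A a)"
        unfolding A'_def[abs_def] using plk_contraction[of r n A c] by blast
      have A'_hi: "A' i j = 0" if ij: "i < r" "j < n" "hi i < j" for i j
        unfolding A'_def
      proof (rule rdet_eq_0_of_zero_block[OF ij(1)])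
        fix p l assume pl: "i \<le> p" "p < r" "l \<le> i"
        have "hi l \<le> hi i" using pl(3) by (simp add: hi_def)
        moreover have "hi i < ((c i)(i := j)) p" using pl ij hi_mono[of i p] by (simp add: c_def)
        moreover have "((c i)(i := j)) p < n" using cn[OF pl(2) ij(1)] ij(2) by simp
        ultimately show "A l (((c i)(i := j)) p) = 0" using tri'[of l] pl ij(1) by simp
      qed
      \<comment> \<open>otherwise a nonzero Pluecker coordinate has \<open>i + 1\<close> members below \<open>lo i\<close>, against the bound by \<open>v\<close>\<close>
      have A'_lo: "A' i j = 0" if ij: "i < r" "j < n" "j < lo i" for i j
      proof (rule ccontr)
        assume nz: "A' i j \<noteq> 0"
        let ?c = "(c i)(i := j)"
        have lt: "?c p < n" if "p < r" for p using cn[OF that ij(1)] ij(2) by simp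
        obtain a where a: "a \<in> index_seqs r n" "set a = Suc ` ?c ` {..<r}" "plk r n A a \<noteq> 0"
          using ex_plk_nonzero_of_rdet[OF nz[unfolded A'_def] lt] by blast
        have xa: "x a \<noteq> 0" using a(3) by (simp add: \<kappa>)
        have inj: "inj_on (\<lambda>p. Suc (?c p)) {..i}"
          using rdet_nonzero_inj[OF nz[unfolded A'_def]] ij(1) by (auto simp only: inj_on_def atMost_iff lessThan_iff)
        have "(\<lambda>p. Suc (?c p)) ` {..i} \<subseteq> (!) a ` {..<i}"
        proof
          fix u assume "u \<in> (\<lambda>p. Suc (?c p)) ` {..i}"
          then obtain p where p: "p \<le> i" "u = Suc (?c p)" by blast
          have ul: "u \<le> lo i"
            using p below[of p i] ij by (cases "p = i") (auto simp: c_def)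
          have "u \<in> set a" unfolding a(2) image_image by (rule image_eqI[where x = p]) (use p ij(1) in simp_all)
          then obtain h where h: "h < r" "u = a ! h" using index_seqsD(1)[OF a(1)] by (auto simp: set_conv_nth)
          have "h < i"
          proof (rule ccontr)
            assume "\<not> h < i"
            then have "a ! i \<le> a ! h" using index_seqs_mono[OF a(1)] h(1) by simp
            then show False using cone_support(2)[OF x xa ij(1)] ul h(2) by simp
          qed
          then show "u \<in> (!) a ` {..<i}" using h(2) by blast
        qed
        then have "card ((\<lambda>p. Suc (?c p)) ` {..i}) \<le> card ((!) a ` {..<i})" by (intro card_mono) auto
        also have "\<dots> \<le> i" using card_image_le[of "{..<i}" "(!) a"] by simp
        finally have "card ((\<lambda>p. Suc (?c p)) ` {..i}) \<le> i" .
        then show False unfolding card_image[OF inj] by simp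
      qed
      have A'_diag: "A' i (hi i) \<noteq> 0" if i: "i < r" for i
      proof -
        have upd: "(c i)(i := hi i) = c i" by (auto simp: c_def)
        have low: "rdet (r - i) (\<lambda>l. A (l + i)) (\<lambda>p. c i (p + i)) \<noteq> 0"
        proof (subst rdet_triangular)
          fix p l assume "l < p" "p < r - i"
          then show "A (l + i) (c i (p + i)) = 0"
            using tri'[of "l + i" "hi (p + i)"] hi_mono[of "l + i" "p + i"] hi_less_n[of "p + i"] by (simp add: c_def)
        next
          show "(\<Prod>p<r - i. A (p + i) (c i (p + i))) \<noteq> 0" using diag' by (simp add: c_def)
        qed
        have "rdet i A (c i) \<noteq> 0"
        proof (cases "i = 0")
          case True
          then show ?thesis by (simp add: rdet_leibniz)
        next
          case False
          have bi: "x (b i) \<noteq> 0" using b i False by auto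
          have bI: "b i \<in> index_seqs r n" by (rule cone_support(1)[OF x bi])
          have "rdet r A (\<lambda>p. b i ! p - 1) = rdet i A (\<lambda>p. b i ! p - 1)
            * rdet (r - i) (\<lambda>l. A (l + i)) (\<lambda>p. b i ! (p + i) - 1)"
          proof (rule rdet_block)
            show "i \<le> r" using i by simp
            fix p l assume pl: "i \<le> p" "p < r" "l < i"
            have "hi l \<le> i * q" unfolding hi_def using pl by (intro mult_le_mono1) simp
            moreover have "i * q < b i ! p - 1" using above pl False by simp
            moreover have "b i ! p - 1 < n" using index_seqsD(2,3)[OF bI pl(2)] by linarith
            ultimately show "A l (b i ! p - 1) = 0" using tri'[of l] pl i by simp
          qed
          moreover have "rdet r A (\<lambda>p. b i ! p - 1) \<noteq> 0"
            using bi \<kappa> plk_apply[OF bI, of A] by auto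
          moreover have "rdet i A (\<lambda>p. b i ! p - 1) = rdet i A (c i)"
            by (rule rdet_cong) (simp add: c_def)
          ultimately show ?thesis by auto
        qed
        moreover have "rdet r A (c i) = rdet i A (c i) * rdet (r - i) (\<lambda>l. A (l + i)) (\<lambda>p. c i (p + i))"
        proof (rule rdet_block)
          show "i \<le> r" using i by simp
          fix p l assume "i \<le> p" "p < r" "l < i"
          then show "A l (c i p) = 0" using tri'[of l "hi p"] hi_mono[of l p] hi_less_n[of p] by (simp add: c_def)
        qed
        ultimately show ?thesis using low by (simp add: A'_def upd)
      qed
      define \<alpha> where "\<alpha> j = A' (owner j) j" for j
      define \<beta> where "\<beta> j = A' (owner j + 1) j" for j
      have \<alpha>: "\<alpha> (hi i) \<noteq> 0" if "i < r" for i using A'_diag[OF that] by (simp add: \<alpha>_def owner_hi)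
      have eq: "plk r n A' = band \<alpha> \<beta>"
        unfolding \<alpha>_def[abs_def] \<beta>_def[abs_def]
        by (rule plk_cong, rule supported_eq_band_mat) (use A'_hi A'_lo in auto)
      have "band \<alpha> \<beta> w \<noteq> 0" using \<alpha> by (simp add: plk_band_mat_w)
      then have "\<kappa>' \<noteq> 0" unfolding eq[symmetric] \<kappa>' by auto
      have "x = (\<lambda>a. (1 / (\<kappa>' * \<kappa>)) * band \<alpha> \<beta> a)"
        unfolding eq[symmetric] \<kappa>' \<kappa>(1) using \<open>\<kappa>' \<noteq> 0\<close> \<kappa>(2) by simp
      moreover have "1 / (\<kappa>' * \<kappa>) \<noteq> 0" using \<open>\<kappa>' \<noteq> 0\<close> \<kappa>(2) by simp
      ultimately show ?thesis using \<alpha> by blast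
    qed
  qed
qed

end

section \<open>Monomials as products of Pluecker coordinates\<close>

text \<open>
  Let \<open>\<sigma>\<close> be a permutation other than the identity whose term does not vanish.  The first place that \<open>\<sigma>\<close> moves is
  moved up, hence is at least \<open>\<tau>\<close>; but it is the image of a later place, which would have to be below \<open>\<tau>\<close>.
\<close>

lemma rdet_unique_matching:
  assumes lower: "\<And>p l. p < r \<Longrightarrow> l < r \<Longrightarrow> M l (c p) \<noteq> 0 \<Longrightarrow> p < \<tau> \<Longrightarrow> l \<le> p"
    and upper: "\<And>p l. p < r \<Longrightarrow> l < r \<Longrightarrow> M l (c p) \<noteq> 0 \<Longrightarrow> \<tau> \<le> p \<Longrightarrow> p \<le> l"
  shows "rdet r M c = (\<Prod>p<r. M p (c p))"
proof -
  have "(\<Prod>p = 0..<r. M (\<sigma> p) (c p)) = 0" if s: "\<sigma> permutes {0..<r}" "\<sigma> \<noteq> id" for \<sigma>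
  proof (rule ccontr)
    assume nz: "(\<Prod>p = 0..<r. M (\<sigma> p) (c p)) \<noteq> 0"
    have bnd: "\<sigma> p < r" if "p < r" for p using permutes_in_image[OF s(1), of p] that by simp
    have nz': "M (\<sigma> p) (c p) \<noteq> 0" if "p < r" for p using nz that by (simp add: prod_zero_iff)
    have "\<exists>p. \<sigma> p \<noteq> p" using s(2) by (auto simp: fun_eq_iff)
    define p0 where "p0 = (LEAST p. \<sigma> p \<noteq> p)"
    have p0: "\<sigma> p0 \<noteq> p0" unfolding p0_def by (rule LeastI_ex) fact
    have least: "\<sigma> p = p" if "p < p0" for p using not_less_Least[of p "\<lambda>p. \<sigma> p \<noteq> p"] that by (simp add: p0_def)
    have p0r: "p0 < r" using p0 s(1) by (metis atLeastLessThan_iff permutes_not_in zero_le)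
    have inj: "inj \<sigma>" using permutes_inj[OF s(1)] .
    have "p0 < \<sigma> p0"
    proof (rule ccontr)
      assume "\<not> p0 < \<sigma> p0"
      then have "\<sigma> p0 < p0" using p0 by linarith
      then have "\<sigma> (\<sigma> p0) = \<sigma> p0" by (rule least)
      then show False using inj p0 by (simp add: inj_eq)
    qed
    then have tp: "\<tau> \<le> p0" using lower[OF p0r bnd[OF p0r] nz'[OF p0r]] by linarith
    obtain p1 where p1: "\<sigma> p1 = p0" using permutes_surj[OF s(1)] by (metis surjD)
    have p1r: "p1 < r" using p1 p0r s(1) by (metis atLeastLessThan_iff permutes_not_in zero_le)
    have "p0 < p1"
    proof (rule ccontr)
      assume "\<not> p0 < p1"
      then consider "p1 = p0" | "p1 < p0" by linarith
      then show False using p1 p0 least by cases auto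
    qed
    then show False using upper[OF p1r bnd[OF p1r] nz'[OF p1r]] p1 tp by linarith
  qed
  then have "rdet r M c = (\<Sum>\<sigma>\<in>{id}. signof \<sigma> * (\<Prod>p = 0..<r. M (\<sigma> p) (c p)))"
    unfolding rdet_leibniz
    by (intro sum.mono_neutral_right) (auto simp: finite_permutations permutes_id)
  then show ?thesis by (simp add: atLeast0LessThan)
qed

lemma prod_list_concat_replicate:
  "distinct js \<Longrightarrow> prod_list (map f (concat (map (\<lambda>j. replicate (e j) j) js))) = (\<Prod>j\<in>set js. (f j :: complex) ^ e j)"
  by (induction js) auto

lemma length_concat_replicate:
  "distinct js \<Longrightarrow> length (concat (map (\<lambda>j. replicate (e j) j) js)) = (\<Sum>j\<in>set js. e j)"
  by (induction js) auto

context richardson_setup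
begin

lemma zero_notin_overlap: "0 \<notin> overlap"
  using m_pos[of 1] by (auto simp: overlap_iff owner_def lo_def)

context
  fixes x :: "nat \<Rightarrow> nat"
  assumes x: "x \<in> exponents 1"
begin

text \<open>
  List the columns of row \<open>i\<close> with their multiplicities in the monomial of \<open>x\<close>: first those in the overlap with
  row \<open>i - 1\<close>, which make up \<open>front i\<close> of length \<open>r - i\<close>, then the ones that the row owns.  For \<open>i = 0\<close> there is no
  overlap, and the column 0, of multiplicity \<open>r\<close>, takes its place.
\<close>

definition front :: "nat \<Rightarrow> nat list" where
  "front i = (if i = 0 then replicate r 0 else concat (map (\<lambda>j. replicate (x j) j) [j\<leftarrow>[0..<n]. j \<in> overlap \<and> owner j + 1 = i]))"

definition rear :: "nat \<Rightarrow> nat list" where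
  "rear i = concat (map (\<lambda>j. replicate (r - x j) j) [j\<leftarrow>[1..<n]. owner j = i])"

text \<open>
  All rows have lists of length \<open>n\<close>; their entries at place \<open>t\<close> form the index sequence \<open>seq_at t\<close>.
\<close>

definition col_at :: "nat \<Rightarrow> nat \<Rightarrow> nat" where
  "col_at t i = (front i @ rear i) ! t"

definition seq_at :: "nat \<Rightarrow> nat list" where
  "seq_at t = map (\<lambda>i. col_at t i + 1) [0..<r]"

lemma x_le: "x j \<le> r" using exponents_le[OF x, of j] by simp

lemma x_outside: "j \<notin> overlap \<Longrightarrow> x j = 0" using x by (simp add: exponents_def)

lemma x_sum: "i < r - 1 \<Longrightarrow> (\<Sum>j | j \<in> overlap \<and> owner j = i. x j) = r - 1 - i"
  using x by (simp add: exponents_def)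

lemma length_front: "i < r \<Longrightarrow> length (front i) = r - i"
proof (cases "i = 0")
  case False
  assume i: "i < r"
  have "length (front i) = (\<Sum>j\<in>{j. j < n \<and> j \<in> overlap \<and> owner j + 1 = i}. x j)"
    using False by (simp add: front_def length_concat_replicate)
  also have "{j. j < n \<and> j \<in> overlap \<and> owner j + 1 = i} = {j. j \<in> overlap \<and> owner j = i - 1}" using False by (auto simp: overlap_iff)
  finally show ?thesis using x_sum[of "i - 1"] i False by simp
qed (simp add: front_def)

lemma length_rear: "i < r \<Longrightarrow> length (rear i) + (r - 1 - i) = r * q"
proof -
  assume i: "i < r"
  let ?B = "{j. 1 \<le> j \<and> j < n \<and> owner j = i}"
  have B: "?B = {i * q + 1..(i + 1) * q}"
    using hi_less_n[OF i] by (auto simp: owner_eq hi_def)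
  have "length (rear i) = (\<Sum>j\<in>?B. r - x j)"
    by (simp add: rear_def length_concat_replicate)
  then have "length (rear i) + (\<Sum>j\<in>?B. x j) = (\<Sum>j\<in>?B. r)"
    using x_le by (simp add: sum.distrib[symmetric])
  moreover have "(\<Sum>j\<in>?B. x j) = (\<Sum>j | j \<in> overlap \<and> owner j = i. x j)"
  proof (rule sum.mono_neutral_right)
    show "finite ?B" unfolding B by simp
    show "{j. j \<in> overlap \<and> owner j = i} \<subseteq> ?B"
    proof
      fix j assume j: "j \<in> {j. j \<in> overlap \<and> owner j = i}"
      then have "j \<noteq> 0" using zero_notin_overlap by (metis mem_Collect_eq)
      then show "j \<in> ?B" using j by (simp add: overlap_iff)
    qed
    show "\<forall>j\<in>?B - {j. j \<in> overlap \<and> owner j = i}. x j = 0" using x_outside by blast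
  qed
  moreover have "(\<Sum>j | j \<in> overlap \<and> owner j = i. x j) = r - 1 - i"
  proof (cases "i < r - 1")
    case False
    then have "{j. j \<in> overlap \<and> owner j = i} = {}" by (auto simp: overlap_iff)
    then have "(\<Sum>j | j \<in> overlap \<and> owner j = i. x j) = 0" by (simp only: sum.empty)
    then show ?thesis using False i by simp
  qed (rule x_sum)
  moreover have "(\<Sum>j\<in>?B. r) = r * q" unfolding B by simp
  ultimately show ?thesis by simp
qed

lemma length_rows: "i < r \<Longrightarrow> length (front i @ rear i) = n"
  using length_front[of i] length_rear[of i] by (simp add: n_eq mult.commute)

lemma col_at_front:
  assumes "i < r" "t < r - i"
  shows "if i = 0 then col_at t i = 0 else col_at t i \<in> overlap \<and> owner (col_at t i) + 1 = i"
proof -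
  have "col_at t i = front i ! t" "t < length (front i)"
    using assms by (simp_all add: col_at_def nth_append length_front)
  then have "col_at t i \<in> set (front i)" by simp
  then show ?thesis by (auto simp: front_def split: if_splits)
qed

lemma col_at_rear:
  assumes "i < r" "r - i \<le> t" "t < n"
  shows "owner (col_at t i) = i" "1 \<le> col_at t i" "col_at t i < n"
proof -
  have "col_at t i = rear i ! (t - length (front i))" "t - length (front i) < length (rear i)"
    using assms length_rows[OF assms(1)] by (auto simp: col_at_def nth_append length_front)
  then have "col_at t i \<in> set (rear i)" by simp
  then show "owner (col_at t i) = i" "1 \<le> col_at t i" "col_at t i < n" by (auto simp: rear_def)
qed

lemma col_at_bounds:
  assumes "i < r" "t < n"
  shows "col_at t i \<le> (if t < r - i then i * q else (i + 1) * q)"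
    and "i \<noteq> 0 \<Longrightarrow> (if t < r - i then (i - 1) * q else i * q) < col_at t i"
    and "col_at t i < n"
proof -
  consider "t < r - i" "i = 0" | "t < r - i" "i \<noteq> 0" | "r - i \<le> t" by linarith
  then show "col_at t i \<le> (if t < r - i then i * q else (i + 1) * q)"
    using col_at_front[OF assms(1)] col_at_rear[OF assms(1) _ assms(2)] owner_upper[of "col_at t i"]
    by cases auto
  show "(if t < r - i then (i - 1) * q else i * q) < col_at t i" if "i \<noteq> 0"
  proof (cases "t < r - i")
    case True
    then have "lo i \<le> col_at t i" using col_at_front[OF assms(1) True] that by (auto simp: overlap_iff)
    then show ?thesis using True lo_bounds(1)[of i] that assms(1) by simp
  next
    case False
    then show ?thesis using col_at_rear[OF assms(1) _ assms(2)] owner_lower[of "col_at t i"] that by simp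
  qed
  have "(i + 1) * q < n" using hi_less_n[OF assms(1)] by (simp add: hi_def)
  then show "col_at t i < n"
    using \<open>col_at t i \<le> (if t < r - i then i * q else (i + 1) * q)\<close> by (auto split: if_splits)
qed

lemma seq_at_mem:
  assumes t: "t < n"
  shows "seq_at t \<in> index_seqs r n"
proof -
  have "col_at t i < col_at t i'" if ii: "i < i'" "i' < r" for i i'
  proof -
    have "i + 1 \<le> i'" using ii by simp
    then have m1: "(i + 1) * q \<le> i' * q" by (rule mult_le_mono1)
    have "i \<le> i' - 1" using ii by simp
    then have m2: "i * q \<le> (i' - 1) * q" by (rule mult_le_mono1)
    have m0: "r - i' \<le> r - i" using ii by simp
    have b1: "col_at t i \<le> (if t < r - i then i * q else (i + 1) * q)"
      by (rule col_at_bounds(1)) (use ii t in auto)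
    have b2: "(if t < r - i' then (i' - 1) * q else i' * q) < col_at t i'"
      by (rule col_at_bounds(2)) (use ii t in auto)
    consider "t < r - i'" "t < r - i" | "\<not> t < r - i'" "t < r - i" | "\<not> t < r - i'" "\<not> t < r - i"
      using m0 by linarith
    then show ?thesis
    proof cases
      case 1
      then have "col_at t i \<le> i * q" "(i' - 1) * q < col_at t i'" using b1 b2 by simp_all
      then show ?thesis using m2 by linarith
    next
      case 2
      then have "col_at t i \<le> i * q" "i' * q < col_at t i'" using b1 b2 by simp_all
      then show ?thesis using m1 by simp
    next
      case 3
      then have "col_at t i \<le> (i + 1) * q" "i' * q < col_at t i'" using b1 b2 by simp_all
      then show ?thesis using m1 by linarith
    qed
  qed
  then have "sorted_wrt (<) (seq_at t)" by (simp add: seq_at_def sorted_wrt_iff_nth_less)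
  then show ?thesis using col_at_bounds(3)[OF _ t] by (auto simp: index_seqs_def seq_at_def Suc_le_eq)
qed

lemma seq_at_nth: "i < r \<Longrightarrow> seq_at t ! i - 1 = col_at t i"
  by (simp add: seq_at_def)

text \<open>
  At the place \<open>t\<close> the rows before \<open>r - t\<close> are still in their fronts and the others are not.  So the submatrix at
  these columns is bidiagonal, with the second diagonal on one side before \<open>r - t\<close> and on the other side
  from there on.
\<close>

lemma plk_band_mat_seq_at:
  assumes t: "t < n"
  shows "band \<alpha> \<beta> (seq_at t) = (\<Prod>i<r. band_mat \<alpha> \<beta> i (col_at t i))"
proof -
  have "rdet r (band_mat \<alpha> \<beta>) (\<lambda>p. seq_at t ! p - 1) = rdet r (band_mat \<alpha> \<beta>) (col_at t)"
    by (rule rdet_cong) (simp only: seq_at_nth)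
  also have "\<dots> = (\<Prod>i<r. band_mat \<alpha> \<beta> i (col_at t i))"
  proof (rule rdet_unique_matching[where \<tau> = "r - t"])
    fix p l assume pl: "p < r" "l < r" "band_mat \<alpha> \<beta> l (col_at t p) \<noteq> 0"
    have owner: "owner (col_at t p) = l \<or> owner (col_at t p) + 1 = l \<and> col_at t p \<in> overlap"
      using pl(3) by (auto simp: band_mat_def split: if_splits)
    show "l \<le> p" if "p < r - t"
    proof -
      have "t < r - p" using that by simp
      from col_at_front[OF pl(1) this] show ?thesis using owner zero_notin_overlap
        by (cases "p = 0") (auto simp: owner_def)
    qed
    show "p \<le> l" if "r - t \<le> p"
      using col_at_rear(1)[OF pl(1) _ t] that owner by auto
  qed
  finally show ?thesis by (simp add: plk_apply[OF seq_at_mem[OF t]])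
qed

text \<open>
  The multiplicities of the listed columns are the exponents of the monomial.  The statement is for arbitrary
  \<open>G\<close> because it serves for the entries of a band matrix as well as for the characters of the torus.
\<close>

lemma prod_col_at:
  fixes G :: "nat \<Rightarrow> nat \<Rightarrow> complex"
  shows "(\<Prod>t<n. \<Prod>i<r. G i (col_at t i)) = (\<Prod>j<n. G (owner j) j ^ (r - x j)) * (\<Prod>j\<in>overlap. G (owner j + 1) j ^ x j)"
proof -
  have "(\<Prod>t<n. \<Prod>i<r. G i (col_at t i)) = (\<Prod>i<r. \<Prod>t<n. G i (col_at t i))" by (rule prod.swap)
  also have "\<dots> = (\<Prod>i<r. (if i = 0 then G 0 0 ^ r else 1) * (\<Prod>j | j \<in> overlap \<and> owner j + 1 = i. G (owner j + 1) j ^ x j)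
      * (\<Prod>j\<in>{j\<in>{1..<n}. owner j = i}. G (owner j) j ^ (r - x j)))"
  proof (rule prod.cong[OF refl])
    fix i assume "i \<in> {..<r}"
    then have i: "i < r" by simp
    define L where "L = front i @ rear i"
    have L: "length L = n" unfolding L_def by (rule length_rows[OF i])
    have "(\<Prod>t<n. G i (col_at t i)) = prod_list (map (G i) L)"
      unfolding prod.list_conv_set_nth length_map L by (simp add: col_at_def L_def[symmetric] L atLeast0LessThan)
    also have "\<dots> = prod_list (map (G i) (front i)) * prod_list (map (G i) (rear i))" by (simp add: L_def)
    also have "prod_list (map (G i) (front i))
      = (if i = 0 then G 0 0 ^ r else 1) * (\<Prod>j | j \<in> overlap \<and> owner j + 1 = i. G (owner j + 1) j ^ x j)"
    proof (cases "i = 0")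
      case True
      then have "{j. j \<in> overlap \<and> owner j + 1 = i} = {}" by auto
      then show ?thesis using True by (simp add: front_def prod_list_replicate)
    next
      case False
      have "set [j\<leftarrow>[0..<n]. j \<in> overlap \<and> owner j + 1 = i] = {j. j \<in> overlap \<and> owner j + 1 = i}" by (auto simp: overlap_iff)
      then have "prod_list (map (G i) (front i)) = (\<Prod>j | j \<in> overlap \<and> owner j + 1 = i. G i j ^ x j)"
        using False by (simp add: front_def prod_list_concat_replicate)
      also have "\<dots> = (\<Prod>j | j \<in> overlap \<and> owner j + 1 = i. G (owner j + 1) j ^ x j)" by (rule prod.cong) auto
      finally show ?thesis using False by simp
    qed
    also have "prod_list (map (G i) (rear i)) = (\<Prod>j\<in>{j\<in>{1..<n}. owner j = i}. G (owner j) j ^ (r - x j))"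
      unfolding rear_def by (subst prod_list_concat_replicate) (auto intro!: prod.cong)
    finally show "(\<Prod>t<n. G i (col_at t i)) = (if i = 0 then G 0 0 ^ r else 1)
      * (\<Prod>j | j \<in> overlap \<and> owner j + 1 = i. G (owner j + 1) j ^ x j)
      * (\<Prod>j\<in>{j\<in>{1..<n}. owner j = i}. G (owner j) j ^ (r - x j))" .
  qed
  also have "\<dots> = (\<Prod>i<r. if i = 0 then G 0 0 ^ r else 1)
      * (\<Prod>i<r. \<Prod>j\<in>{j\<in>overlap. owner j + 1 = i}. G (owner j + 1) j ^ x j)
      * (\<Prod>i<r. \<Prod>j\<in>{j\<in>{1..<n}. owner j = i}. G (owner j) j ^ (r - x j))"
    by (simp only: prod.distrib)
  also have "(\<Prod>i<r. if i = 0 then G 0 0 ^ r else 1) = G 0 0 ^ r" using r1 by (simp add: prod.delta)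
  also have "(\<Prod>i<r. \<Prod>j\<in>{j\<in>overlap. owner j + 1 = i}. G (owner j + 1) j ^ x j) = (\<Prod>j\<in>overlap. G (owner j + 1) j ^ x j)"
    by (rule prod.group) (auto simp: finite_overlap overlap_iff)
  also have "(\<Prod>i<r. \<Prod>j\<in>{j\<in>{1..<n}. owner j = i}. G (owner j) j ^ (r - x j)) = (\<Prod>j\<in>{1..<n}. G (owner j) j ^ (r - x j))"
    by (rule prod.group) (auto simp: owner_less)
  also have "G 0 0 ^ r * (\<Prod>j\<in>overlap. G (owner j + 1) j ^ x j) * (\<Prod>j\<in>{1..<n}. G (owner j) j ^ (r - x j))
    = (G (owner 0) 0 ^ (r - x 0) * (\<Prod>j\<in>{1..<n}. G (owner j) j ^ (r - x j))) * (\<Prod>j\<in>overlap. G (owner j + 1) j ^ x j)"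
    using x_outside[OF zero_notin_overlap] by (simp add: owner_def)
  also have "G (owner 0) 0 ^ (r - x 0) * (\<Prod>j\<in>{1..<n}. G (owner j) j ^ (r - x j)) = (\<Prod>j<n. G (owner j) j ^ (r - x j))"
    by (simp add: n_eq lessThan_atLeast0 prod.atLeast_Suc_lessThan del: prod.atLeastLessThan_Suc prod.op_ivl_Suc)
  finally show ?thesis .
qed

definition monomial_section :: "wedge \<Rightarrow> complex" where
  "monomial_section y = (if y \<in> \<C> then \<Prod>t<n. y (seq_at t) else 0)"

lemma monomial_section_on_band:
  assumes "\<And>i. i < r \<Longrightarrow> \<alpha> (hi i) \<noteq> 0"
  shows "monomial_section (band \<alpha> \<beta>) = monomial 1 x \<alpha> \<beta>"
proof -
  have "band \<alpha> \<beta> \<in> \<C>" by (rule band_mem_cone) (rule assms)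
  then have "monomial_section (band \<alpha> \<beta>) = (\<Prod>t<n. \<Prod>i<r. band_mat \<alpha> \<beta> i (col_at t i))"
    by (simp add: monomial_section_def plk_band_mat_seq_at)
  also have "\<dots> = monomial 1 x \<alpha> \<beta>"
    unfolding prod_col_at monomial_def by (simp add: band_mat_def)
  finally show ?thesis .
qed

lemma monomial_section_inv: "monomial_section \<in> inv_sections r n X n"
proof -
  have "(\<lambda>y. \<Prod>t<n. y (seq_at t)) \<in> forms (index_seqs r n) (\<Sum>t<n. 1)"
    by (rule forms_prod) (simp, rule forms_coord[OF finite_index_seqs seq_at_mem], simp)
  then have "monomial_section \<in> global_sections (index_seqs r n) \<C> n"
    unfolding monomial_section_def[abs_def] by (intro form_global_section) simp
  moreover have "monomial_section (wedge_act r n t y) = monomial_section y" if t: "t \<in> torus n" and y: "y \<in> \<C>" for t y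
  proof -
    define \<tau> where "\<tau> j = t $$ (j, j)" for j
    have tc: "t \<in> carrier_mat n n" "diagonal_mat t" "det t = 1" using t by (auto simp: torus_def SL_def)
    have td: "diag_of n \<tau> = t"
      using tc(1,2) by (intro eq_matI) (auto simp: diag_of_def \<tau>_def diagonal_mat_def)
    have p1: "(\<Prod>j<n. \<tau> j) = 1" using det_diag_of[of n \<tau>] td tc(3) by simp
    note act = cone_torus[OF y p1, unfolded td]
    have "(\<Prod>t<n. torus_char r \<tau> (seq_at t)) = (\<Prod>t<n. \<Prod>i<r. \<tau> (col_at t i))"
      unfolding torus_char_def by (intro prod.cong refl) (simp only: seq_at_nth lessThan_iff)
    also have "\<dots> = (\<Prod>j<n. \<tau> j ^ (r - x j)) * (\<Prod>j\<in>overlap. \<tau> j ^ x j)"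
      by (rule prod_col_at[of "\<lambda>_. \<tau>"])
    also have "(\<Prod>j\<in>overlap. \<tau> j ^ x j) = (\<Prod>j<n. \<tau> j ^ x j)"
      by (rule prod.mono_neutral_left) (auto simp: overlap_iff x_outside)
    also have "(\<Prod>j<n. \<tau> j ^ (r - x j)) * (\<Prod>j<n. \<tau> j ^ x j) = (\<Prod>j<n. \<tau> j) ^ r"
      by (simp add: prod.distrib[symmetric] power_add[symmetric] x_le prod_power_distrib)
    finally have "(\<Prod>t<n. torus_char r \<tau> (seq_at t)) = 1" by (simp add: p1)
    then show ?thesis using act y by (simp add: monomial_section_def prod.distrib)
  qed
  ultimately show ?thesis by (simp add: inv_sections_def)
qed

end

end

section \<open>Generation in degree 1\<close>

context richardson_setup
begin

text \<open>
  At the points that do not come from band matrices both sections vanish.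
\<close>

lemma inv_section_eqI:
  assumes s: "s \<in> inv_sections r n X d" and t: "t \<in> inv_sections r n X d" and d: "d > 0"
    and nice: "\<And>\<alpha> \<beta>. (\<And>i. i < r \<Longrightarrow> \<alpha> (hi i) \<noteq> 0) \<Longrightarrow> s (band \<alpha> \<beta>) = t (band \<alpha> \<beta>)"
  shows "s = t"
proof
  fix x show "s x = t x"
  proof (cases "x \<in> \<C>")
    case False
    then show ?thesis
      using global_sections_outside[OF inv_sectionsD(1)[OF s]] global_sections_outside[OF inv_sectionsD(1)[OF t]] by simp
  next
    case True
    from cone_point_on_band_or_unstable[OF True] show ?thesis
    proof (elim disjE exE conjE)
      fix \<alpha> \<beta> c assume \<alpha>: "\<forall>i<r. \<alpha> (hi i) \<noteq> 0" and c: "c \<noteq> 0" and x: "x = (\<lambda>a. c * band \<alpha> \<beta> a)"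
      have "band \<alpha> \<beta> \<in> \<C>" by (rule band_mem_cone) (use \<alpha> in auto)
      then show ?thesis unfolding x
        using inv_sectionsD(3)[OF s _ c] inv_sectionsD(3)[OF t _ c] nice[of \<alpha> \<beta>] \<alpha> by simp
    next
      fix S assume S: "S \<subseteq> {..<n}" "\<forall>a. x a \<noteq> 0 \<longrightarrow> r * card S < n * meet_count S a"
      then show ?thesis
        using inv_section_vanishes_if_unstable[OF s True S(1) d] inv_section_vanishes_if_unstable[OF t True S(1) d] by simp
    qed
  qed
qed

lemma cone_wedge_act: "t \<in> torus n \<Longrightarrow> x \<in> \<C> \<Longrightarrow> wedge_act r n t x \<in> \<C>"
proof -
  assume t: "t \<in> torus n" and x: "x \<in> \<C>"
  have tc: "t \<in> carrier_mat n n" "diagonal_mat t" "det t = 1" using t by (auto simp: torus_def SL_def)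
  have td: "diag_of n (\<lambda>j. t $$ (j, j)) = t"
    using tc(1,2) by (intro eq_matI) (auto simp: diag_of_def diagonal_mat_def)
  have "(\<Prod>j<n. t $$ (j, j)) = 1" using det_diag_of[of n "\<lambda>j. t $$ (j, j)"] td tc(3) by simp
  from cone_torus[OF x this, unfolded td] show ?thesis by simp
qed

lemma inv_sections_add:
  assumes "s \<in> inv_sections r n X d" "t \<in> inv_sections r n X d"
  shows "(\<lambda>x. s x + t x) \<in> inv_sections r n X d"
  using assms global_sections_add unfolding inv_sections_def by auto

lemma inv_sections_mult:
  assumes "s \<in> inv_sections r n X d" "t \<in> inv_sections r n X d'"
  shows "(\<lambda>x. s x * t x) \<in> inv_sections r n X (d + d')"
  using assms global_sections_mult unfolding inv_sections_def by auto

lemma inv_sections_const: "(\<lambda>x. if x \<in> \<C> then c else 0) \<in> inv_sections r n X 0"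
  using form_global_section[OF forms_const[of c "index_seqs r n"], of \<C>] cone_wedge_act
  unfolding inv_sections_def by auto

lemma inv_sections_outside: "s \<in> inv_sections r n X d \<Longrightarrow> x \<notin> \<C> \<Longrightarrow> s x = 0"
  using inv_sectionsD(1) global_sections_outside by blast

lemma inv_sections_scale:
  assumes s: "s \<in> inv_sections r n X d"
  shows "(\<lambda>x. c * s x) \<in> inv_sections r n X d"
proof -
  have "(\<lambda>x. (if x \<in> \<C> then c else 0) * s x) \<in> inv_sections r n X (0 + d)"
    by (rule inv_sections_mult[OF inv_sections_const s])
  also have "(\<lambda>x. (if x \<in> \<C> then c else 0) * s x) = (\<lambda>x. c * s x)"
    using inv_sections_outside[OF s] by (auto simp: fun_eq_iff)
  finally show ?thesis by simp
qed

lemma inv_sections_zero: "(\<lambda>x. 0) \<in> inv_sections r n X d"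
proof -
  have "(\<lambda>x. \<Sum>p\<in>{}. (0 * (\<Prod>j\<in>index_seqs r n. x j ^ 0))) \<in> forms (index_seqs r n) d"
    by (rule formsI) auto
  then have "(\<lambda>x. 0) \<in> forms (index_seqs r n) d" by simp
  from form_global_section[OF this, of \<C>] show ?thesis unfolding inv_sections_def by simp
qed

lemma inv_sections_sum:
  "finite E \<Longrightarrow> (\<And>e. e \<in> E \<Longrightarrow> f e \<in> inv_sections r n X d) \<Longrightarrow> (\<lambda>x. \<Sum>e\<in>E. f e x) \<in> inv_sections r n X d"
  by (induction E rule: finite_induct) (auto intro: inv_sections_zero inv_sections_add)

lemma ex_subsum:
  "finite B \<Longrightarrow> d \<le> (\<Sum>j\<in>B. x j) \<Longrightarrow> \<exists>y. (\<forall>j. y j \<le> x j) \<and> (\<Sum>j\<in>B. y j) = (d::nat)"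
proof (induction B arbitrary: d rule: finite_induct)
  case empty
  then show ?case by (intro exI[of _ "\<lambda>_. 0"]) auto
next
  case (insert b B)
  have "d - min d (x b) \<le> (\<Sum>j\<in>B. x j)" using insert.prems insert.hyps by simp
  from insert.IH[OF this] obtain y where y: "\<forall>j. y j \<le> x j" "(\<Sum>j\<in>B. y j) = d - min d (x b)" by blast
  have "(\<Sum>j\<in>B. (y(b := min d (x b))) j) = (\<Sum>j\<in>B. y j)"
    using insert.hyps by (intro sum.cong) auto
  then show ?case using y insert.hyps by (intro exI[of _ "y(b := min d (x b))"]) auto
qed

text \<open>
  Split the exponents separately on each overlap, where their sum is \<open>k + 1\<close> times \<open>r - 1 - i\<close>.
\<close>

lemma exponents_split:
  assumes x: "x \<in> exponents (Suc k)"
  shows "\<exists>y z. y \<in> exponents 1 \<and> z \<in> exponents k \<and> x = (\<lambda>j. y j + z j)"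
proof -
  have "\<forall>i\<in>{..<r - 1}. \<exists>y. (\<forall>j. y j \<le> x j) \<and> (\<Sum>j | j \<in> overlap \<and> owner j = i. y j) = r - 1 - i"
  proof
    fix i assume i: "i \<in> {..<r - 1}"
    show "\<exists>y. (\<forall>j. y j \<le> x j) \<and> (\<Sum>j | j \<in> overlap \<and> owner j = i. y j) = r - 1 - i"
    proof (rule ex_subsum)
      show "finite {j. j \<in> overlap \<and> owner j = i}" using finite_overlap by simp
      show "r - 1 - i \<le> (\<Sum>j | j \<in> overlap \<and> owner j = i. x j)" using x i by (simp add: exponents_def)
    qed
  qed
  from bchoice[OF this] obtain Y where
    Y: "\<forall>i\<in>{..<r - 1}. (\<forall>j. Y i j \<le> x j) \<and> (\<Sum>j | j \<in> overlap \<and> owner j = i. Y i j) = r - 1 - i" by - (elim exE, rule that)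
  define y where "y j = (if j \<in> overlap then Y (owner j) j else 0)" for j
  have le: "y j \<le> x j" for j using Y by (auto simp: y_def overlap_iff)
  have ysum: "(\<Sum>j | j \<in> overlap \<and> owner j = i. y j) = r - 1 - i" if "i < r - 1" for i
  proof -
    have "(\<Sum>j | j \<in> overlap \<and> owner j = i. y j) = (\<Sum>j | j \<in> overlap \<and> owner j = i. Y i j)"
      by (rule sum.cong) (auto simp: y_def)
    then show ?thesis using Y that by simp
  qed
  have "(\<Sum>j | j \<in> overlap \<and> owner j = i. x j - y j) = k * (r - 1 - i)" if i: "i < r - 1" for i
  proof -
    have "(\<Sum>j | j \<in> overlap \<and> owner j = i. x j - y j) = (\<Sum>j | j \<in> overlap \<and> owner j = i. x j) - (\<Sum>j | j \<in> overlap \<and> owner j = i. y j)"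
      by (rule sum_subtractf_nat) (use le in auto)
    also have "(\<Sum>j | j \<in> overlap \<and> owner j = i. x j) = Suc k * (r - 1 - i)" using x i by (simp add: exponents_def)
    finally show ?thesis by (simp add: ysum[OF i])
  qed
  then have "(\<lambda>j. x j - y j) \<in> exponents k" using x by (simp add: exponents_def)
  moreover have "y \<in> exponents 1" using ysum by (simp add: exponents_def y_def)
  moreover have "x = (\<lambda>j. y j + (x j - y j))" using le by (simp add: fun_eq_iff)
  ultimately show ?thesis by blast
qed

lemma monomial_add:
  assumes y: "y \<in> exponents 1" and z: "z \<in> exponents k"
  shows "monomial (Suc k) (\<lambda>j. y j + z j) \<alpha> \<beta> = monomial 1 y \<alpha> \<beta> * monomial k z \<alpha> \<beta>"
proof -
  have "r * Suc k - (y j + z j) = (r * 1 - y j) + (r * k - z j)" for j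
    using exponents_le[OF y, of j] exponents_le[OF z, of j] by simp
  then show ?thesis unfolding monomial_def by (simp add: power_add prod.distrib mult_ac)
qed

abbreviation "\<R> \<equiv> inv_ring r n X"
abbreviation "\<G> \<equiv> generated_algebra r n X (graded_piece r n X 1)"

definition homog :: "nat \<Rightarrow> (wedge \<Rightarrow> complex) \<Rightarrow> nat \<Rightarrow> wedge \<Rightarrow> complex" where
  "homog k f = (\<lambda>k'. if k' = k then f else (\<lambda>_. 0))"

lemma carrierI: "(\<And>k. s k \<in> inv_sections r n X (n * k)) \<Longrightarrow> finite {k. s k \<noteq> (\<lambda>_. 0)} \<Longrightarrow> s \<in> carrier \<R>"
  by (simp add: inv_ring_def)

lemma carrierD: "s \<in> carrier \<R> \<Longrightarrow> s k \<in> inv_sections r n X (n * k)" "s \<in> carrier \<R> \<Longrightarrow> finite {k. s k \<noteq> (\<lambda>_. 0)}"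
  by (simp_all add: inv_ring_def)

lemma homog_carrier: "f \<in> inv_sections r n X (n * k) \<Longrightarrow> homog k f \<in> carrier \<R>"
proof (rule carrierI)
  assume f: "f \<in> inv_sections r n X (n * k)"
  show "homog k f k' \<in> inv_sections r n X (n * k')" for k'
    using f inv_sections_zero by (simp add: homog_def)
  show "finite {k'. homog k f k' \<noteq> (\<lambda>_. 0)}"
    by (rule finite_subset[of _ "{k}"]) (auto simp: homog_def)
qed

lemma add_carrier: "s \<in> carrier \<R> \<Longrightarrow> t \<in> carrier \<R> \<Longrightarrow> s \<oplus>\<^bsub>\<R>\<^esub> t \<in> carrier \<R>"
proof (rule carrierI)
  assume st: "s \<in> carrier \<R>" "t \<in> carrier \<R>"
  show "(s \<oplus>\<^bsub>\<R>\<^esub> t) k \<in> inv_sections r n X (n * k)" for k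
    using inv_sections_add[OF carrierD(1)[OF st(1)] carrierD(1)[OF st(2)]] by (simp add: inv_ring_def)
  show "finite {k. (s \<oplus>\<^bsub>\<R>\<^esub> t) k \<noteq> (\<lambda>_. 0)}"
    by (rule finite_subset[OF _ finite_UnI[OF carrierD(2)[OF st(1)] carrierD(2)[OF st(2)]]])
      (auto simp: inv_ring_def)
qed

lemma mult_carrier: "s \<in> carrier \<R> \<Longrightarrow> t \<in> carrier \<R> \<Longrightarrow> s \<otimes>\<^bsub>\<R>\<^esub> t \<in> carrier \<R>"
proof (rule carrierI)
  assume st: "s \<in> carrier \<R>" "t \<in> carrier \<R>"
  show "(s \<otimes>\<^bsub>\<R>\<^esub> t) k \<in> inv_sections r n X (n * k)" for k
  proof -
    have "(\<lambda>x. s i x * t (k - i) x) \<in> inv_sections r n X (n * k)" if "i \<le> k" for i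
    proof -
      have "n * i + n * (k - i) = n * k" using that by (simp add: distrib_left[symmetric])
      then show ?thesis
        using inv_sections_mult[OF carrierD(1)[OF st(1), of i] carrierD(1)[OF st(2), of "k - i"]] by simp
    qed
    then have "(\<lambda>x. \<Sum>i\<le>k. s i x * t (k - i) x) \<in> inv_sections r n X (n * k)"
      by (intro inv_sections_sum) auto
    then show ?thesis by (simp add: inv_ring_def)
  qed
  let ?S = "{k. s k \<noteq> (\<lambda>_. 0)}" and ?T = "{k. t k \<noteq> (\<lambda>_. 0)}"
  have "{k. (s \<otimes>\<^bsub>\<R>\<^esub> t) k \<noteq> (\<lambda>_. 0)} \<subseteq> (\<lambda>(i, j). i + j) ` (?S \<times> ?T)"
  proof
    fix k assume "k \<in> {k. (s \<otimes>\<^bsub>\<R>\<^esub> t) k \<noteq> (\<lambda>_. 0)}"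
    then obtain x where "(\<Sum>i\<le>k. s i x * t (k - i) x) \<noteq> 0" by (auto simp: inv_ring_def)
    then obtain i where i: "i \<le> k" "s i x * t (k - i) x \<noteq> 0"
      by (auto elim!: sum.not_neutral_contains_not_neutral)
    then have "i \<in> ?S" "k - i \<in> ?T" by auto
    then show "k \<in> (\<lambda>(i, j). i + j) ` (?S \<times> ?T)"
      using i(1) by (intro image_eqI[where x = "(i, k - i)"]) simp_all
  qed
  then show "finite {k. (s \<otimes>\<^bsub>\<R>\<^esub> t) k \<noteq> (\<lambda>_. 0)}"
    by (rule finite_subset) (intro finite_imageI finite_cartesian_product carrierD(2) st)
qed

text \<open>
  The additive inverse of the ring record is defined by a description; uniqueness identifies it with the
  negative of all components.
\<close>

lemma a_inv_carrier: "s \<in> carrier \<R> \<Longrightarrow> \<ominus>\<^bsub>\<R>\<^esub> s \<in> carrier \<R>"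
proof -
  assume s: "s \<in> carrier \<R>"
  let ?t = "\<lambda>k x. - s k x"
  have t: "?t \<in> carrier \<R>"
  proof (rule carrierI)
    show "(\<lambda>x. - s k x) \<in> inv_sections r n X (n * k)" for k
      using inv_sections_scale[OF carrierD(1)[OF s], of "-1" k] by simp
    show "finite {k. (\<lambda>x. - s k x) \<noteq> (\<lambda>_. 0)}"
      by (rule finite_subset[OF _ carrierD(2)[OF s]]) (auto simp: fun_eq_iff)
  qed
  have "\<ominus>\<^bsub>\<R>\<^esub> s = (THE y. y \<in> carrier \<R> \<and> s \<oplus>\<^bsub>\<R>\<^esub> y = \<zero>\<^bsub>\<R>\<^esub> \<and> y \<oplus>\<^bsub>\<R>\<^esub> s = \<zero>\<^bsub>\<R>\<^esub>)"
    by (simp add: a_inv_def m_inv_def)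
  also have "\<dots> = ?t"
  proof (rule the_equality)
    show "?t \<in> carrier \<R> \<and> s \<oplus>\<^bsub>\<R>\<^esub> ?t = \<zero>\<^bsub>\<R>\<^esub> \<and> ?t \<oplus>\<^bsub>\<R>\<^esub> s = \<zero>\<^bsub>\<R>\<^esub>"
      using t by (auto simp: inv_ring_def)
    fix y assume "y \<in> carrier \<R> \<and> s \<oplus>\<^bsub>\<R>\<^esub> y = \<zero>\<^bsub>\<R>\<^esub> \<and> y \<oplus>\<^bsub>\<R>\<^esub> s = \<zero>\<^bsub>\<R>\<^esub>"
    then have "y k x + s k x = 0" for k x by (simp add: inv_ring_def fun_eq_iff)
    then show "y = ?t" by (simp add: fun_eq_iff add_eq_0_iff2)
  qed
  finally show ?thesis using t by simp
qed

lemma scalar_homog: "(\<lambda>k x. if k = 0 \<and> x \<in> \<C> then c else 0) = homog 0 (\<lambda>x. if x \<in> \<C> then c else 0)"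
  by (auto simp: homog_def fun_eq_iff)

lemma generated_subset: "\<G> \<subseteq> carrier \<R>"
proof
  fix s assume "s \<in> \<G>"
  then show "s \<in> carrier \<R>"
    unfolding generated_algebra_def
  proof (induction rule: generate_ring.induct)
    case one
    have "\<one>\<^bsub>\<R>\<^esub> = homog 0 (\<lambda>x. if x \<in> \<C> then 1 else 0)" by (simp add: inv_ring_def scalar_homog)
    then show ?case using homog_carrier[of "\<lambda>x. if x \<in> \<C> then 1 else 0" 0] inv_sections_const by simp
  next
    case (incl h)
    then show ?case
    proof
      assume "h \<in> scalars r n X"
      then obtain c where "h = homog 0 (\<lambda>x. if x \<in> \<C> then c else 0)" by (auto simp: scalars_def scalar_homog)
      then show ?case using homog_carrier[of "\<lambda>x. if x \<in> \<C> then c else 0" 0] inv_sections_const by simp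
    qed (simp add: graded_piece_def)
  qed (simp_all add: a_inv_carrier add_carrier mult_carrier)
qed

lemma G_add: "s \<in> \<G> \<Longrightarrow> t \<in> \<G> \<Longrightarrow> s \<oplus>\<^bsub>\<R>\<^esub> t \<in> \<G>"
  unfolding generated_algebra_def by (rule generate_ring.eng_add)

lemma G_mult: "s \<in> \<G> \<Longrightarrow> t \<in> \<G> \<Longrightarrow> s \<otimes>\<^bsub>\<R>\<^esub> t \<in> \<G>"
  unfolding generated_algebra_def by (rule generate_ring.eng_mult)

lemma G_const: "homog 0 (\<lambda>x. if x \<in> \<C> then c else 0) \<in> \<G>"
  unfolding generated_algebra_def
  by (rule generate_ring.incl) (auto simp: scalars_def scalar_homog[symmetric])

lemma G_degree_1: "f \<in> inv_sections r n X n \<Longrightarrow> homog 1 f \<in> \<G>"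
  unfolding generated_algebra_def
  by (rule generate_ring.incl) (use homog_carrier[of f 1] in \<open>auto simp: graded_piece_def homog_def\<close>)

lemma homog_mult: "homog i f \<otimes>\<^bsub>\<R>\<^esub> homog j g = homog (i + j) (\<lambda>x. f x * g x)"
proof (intro ext)
  fix k x
  have expand: "(homog i f \<otimes>\<^bsub>\<R>\<^esub> homog j g) k x = (\<Sum>l\<le>k. homog i f l x * homog j g (k - l) x)"
    by (simp add: inv_ring_def)
  have "(homog i f \<otimes>\<^bsub>\<R>\<^esub> homog j g) k x = (\<Sum>l\<le>k. if l = i then (if k - i = j then f x * g x else 0) else 0)"
    unfolding expand by (rule sum.cong) (auto simp: homog_def)
  also have "\<dots> = (if i \<le> k then if k - i = j then f x * g x else 0 else 0)" by (simp add: sum.delta)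
  also have "\<dots> = homog (i + j) (\<lambda>x. f x * g x) k x" by (auto simp: homog_def)
  finally show "(homog i f \<otimes>\<^bsub>\<R>\<^esub> homog j g) k x = homog (i + j) (\<lambda>x. f x * g x) k x" .
qed

lemma homog_add: "homog k f \<oplus>\<^bsub>\<R>\<^esub> homog k g = homog k (\<lambda>x. f x + g x)"
  by (auto simp: inv_ring_def homog_def)

lemma G_zero: "(\<lambda>k x. 0) \<in> \<G>"
proof -
  have "homog 0 (\<lambda>x. if x \<in> \<C> then 0 else 0) = (\<lambda>k x. 0)" by (auto simp: homog_def fun_eq_iff)
  then show ?thesis using G_const[of 0] by simp
qed

lemma G_scale:
  assumes "homog k f \<in> \<G>" "\<And>x. x \<notin> \<C> \<Longrightarrow> f x = 0"
  shows "homog k (\<lambda>x. c * f x) \<in> \<G>"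
proof -
  have "homog 0 (\<lambda>x. if x \<in> \<C> then c else 0) \<otimes>\<^bsub>\<R>\<^esub> homog k f = homog k (\<lambda>x. c * f x)"
    using assms(2) by (auto simp: homog_mult intro!: arg_cong[where f = "homog k"])
  then show ?thesis using G_mult[OF G_const assms(1), of c] by simp
qed

lemma G_sum:
  assumes "finite E" "\<And>e. e \<in> E \<Longrightarrow> homog k (f e) \<in> \<G>"
  shows "homog k (\<lambda>x. \<Sum>e\<in>E. f e x) \<in> \<G>"
  using assms
proof (induction E rule: finite_induct)
  case empty
  have "homog k (\<lambda>x. 0) = (\<lambda>k x. 0)" by (auto simp: homog_def fun_eq_iff)
  then show ?case using G_zero by simp
next
  case (insert e E)
  then have "homog k (f e) \<oplus>\<^bsub>\<R>\<^esub> homog k (\<lambda>x. \<Sum>e\<in>E. f e x) \<in> \<G>" by (intro G_add) auto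
  then show ?case using insert.hyps by (simp add: homog_add)
qed

lemma ex_monomial_section:
  assumes "x \<in> exponents (Suc k)"
  shows "\<exists>f. f \<in> inv_sections r n X (n * Suc k) \<and> homog (Suc k) f \<in> \<G>
    \<and> (\<forall>\<alpha> \<beta>. (\<forall>i<r. \<alpha> (hi i) \<noteq> 0) \<longrightarrow> f (band \<alpha> \<beta>) = monomial (Suc k) x \<alpha> \<beta>)"
  using assms
proof (induction k arbitrary: x)
  case 0
  then have x: "x \<in> exponents 1" by simp
  show ?case
    using monomial_section_inv[OF x] G_degree_1[OF monomial_section_inv[OF x]] monomial_section_on_band[OF x]
    by (intro exI[of _ "monomial_section x"]) simp
next
  case (Suc k)
  obtain y z where yz: "y \<in> exponents 1" "z \<in> exponents (Suc k)" "x = (\<lambda>j. y j + z j)"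
    using exponents_split[OF Suc.prems] by blast
  obtain g where g: "g \<in> inv_sections r n X (n * Suc k)" "homog (Suc k) g \<in> \<G>"
    "\<forall>\<alpha> \<beta>. (\<forall>i<r. \<alpha> (hi i) \<noteq> 0) \<longrightarrow> g (band \<alpha> \<beta>) = monomial (Suc k) z \<alpha> \<beta>"
    using Suc.IH[OF yz(2)] by blast
  let ?f = "\<lambda>u. monomial_section y u * g u"
  have "?f \<in> inv_sections r n X (n * Suc (Suc k))"
    using inv_sections_mult[OF monomial_section_inv[OF yz(1)] g(1)] by simp
  moreover have "homog (Suc (Suc k)) ?f \<in> \<G>"
    using G_mult[OF G_degree_1[OF monomial_section_inv[OF yz(1)]] g(2)] by (simp add: homog_mult)
  moreover have "?f (band \<alpha> \<beta>) = monomial (Suc (Suc k)) x \<alpha> \<beta>" if "\<forall>i<r. \<alpha> (hi i) \<noteq> 0" for \<alpha> \<beta>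
    using monomial_section_on_band[OF yz(1), of \<alpha> \<beta>] g(3) that by (simp add: yz(3) monomial_add[OF yz(1,2)])
  ultimately show ?case by blast
qed

text \<open>
  In positive degree the section equals the combination of products of monomial sections that has the same
  expansion on band matrices.  In degree 0 the only monomial is 1, so the section is a scalar.
\<close>

lemma inv_sections_generated:
  assumes s: "s \<in> inv_sections r n X (n * k)"
  shows "homog k s \<in> \<G>"
proof -
  obtain E c where E: "finite E" "E \<subseteq> exponents k"
    and exp: "\<forall>\<alpha> \<beta>. (\<forall>i<r. \<alpha> (hi i) \<noteq> 0) \<longrightarrow> s (band \<alpha> \<beta>) = (\<Sum>x\<in>E. c x * monomial k x \<alpha> \<beta>)"
    using section_expansion[OF s] by - (elim exE conjE, rule that)
  show ?thesis
  proof (cases k)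
    case 0
    have "monomial 0 x \<alpha> \<beta> = 1" if "x \<in> exponents 0" for x \<alpha> \<beta>
      using exponents_le[OF that] by (simp add: monomial_def)
    then have "s (band \<alpha> \<beta>) = (\<Sum>x\<in>E. c x)" if "\<And>i. i < r \<Longrightarrow> \<alpha> (hi i) \<noteq> 0" for \<alpha> \<beta>
      using exp that E(2) 0 by (simp add: subset_iff)
    then have "s x = (\<Sum>x\<in>E. c x)" if "x \<in> \<C>" for x
      using inv_section_degree_0[of s x] s that 0 by simp
    then have "s = (\<lambda>x. if x \<in> \<C> then \<Sum>x\<in>E. c x else 0)"
      using inv_sections_outside[OF s] by (auto simp: fun_eq_iff)
    then show ?thesis using G_const 0 by metis
  next
    case (Suc k')
    have "\<forall>x\<in>E. \<exists>f. f \<in> inv_sections r n X (n * k) \<and> homog k f \<in> \<G>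
      \<and> (\<forall>\<alpha> \<beta>. (\<forall>i<r. \<alpha> (hi i) \<noteq> 0) \<longrightarrow> f (band \<alpha> \<beta>) = monomial k x \<alpha> \<beta>)"
      using ex_monomial_section[of _ k'] E(2) unfolding Suc by blast
    from bchoice[OF this] obtain f where f: "\<forall>x\<in>E. f x \<in> inv_sections r n X (n * k) \<and> homog k (f x) \<in> \<G>
      \<and> (\<forall>\<alpha> \<beta>. (\<forall>i<r. \<alpha> (hi i) \<noteq> 0) \<longrightarrow> f x (band \<alpha> \<beta>) = monomial k x \<alpha> \<beta>)" by - (elim exE, rule that)
    have "s = (\<lambda>u. \<Sum>x\<in>E. c x * f x u)"
    proof (rule inv_section_eqI[OF s])
      show "(\<lambda>u. \<Sum>x\<in>E. c x * f x u) \<in> inv_sections r n X (n * k)"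
        by (rule inv_sections_sum[OF E(1)], rule inv_sections_scale) (use f in blast)
      show "0 < n * k" by (simp add: n_eq Suc)
      show "s (band \<alpha> \<beta>) = (\<Sum>x\<in>E. c x * f x (band \<alpha> \<beta>))"
        if "\<And>i. i < r \<Longrightarrow> \<alpha> (hi i) \<noteq> 0" for \<alpha> \<beta>
        using exp f that by (simp add: exp)
    qed
    moreover have "homog k (\<lambda>u. \<Sum>x\<in>E. c x * f x u) \<in> \<G>"
    proof (rule G_sum[OF E(1)])
      fix x assume "x \<in> E"
      then show "homog k (\<lambda>u. c x * f x u) \<in> \<G>"
        using f inv_sections_outside by (intro G_scale) blast+
    qed
    ultimately show ?thesis by simp
  qed
qed

lemma carrier_subset_generated: "carrier \<R> \<subseteq> \<G>"
proof
  fix s assume s: "s \<in> carrier \<R>"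
  have "(\<lambda>k. if k \<in> F then s k else (\<lambda>_. 0)) \<in> \<G>" if "finite F" for F
    using that
  proof (induction F rule: finite_induct)
    case empty
    then show ?case using G_zero by simp
  next
    case (insert k F)
    have "homog k (s k) \<oplus>\<^bsub>\<R>\<^esub> (\<lambda>k. if k \<in> F then s k else (\<lambda>_. 0)) \<in> \<G>"
      by (rule G_add[OF inv_sections_generated[OF carrierD(1)[OF s]] insert.IH])
    also have "homog k (s k) \<oplus>\<^bsub>\<R>\<^esub> (\<lambda>k. if k \<in> F then s k else (\<lambda>_. 0)) = (\<lambda>k'. if k' \<in> insert k F then s k' else (\<lambda>_. 0))"
      using insert.hyps by (auto simp: inv_ring_def homog_def fun_eq_iff)
    finally show ?case .
  qed
  from this[OF carrierD(2)[OF s]] have "(\<lambda>k. if s k \<noteq> (\<lambda>_. 0) then s k else (\<lambda>_. 0)) \<in> \<G>" by simp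
  moreover have "(\<lambda>k. if s k \<noteq> (\<lambda>_. 0) then s k else (\<lambda>_. 0)) = s" by auto
  ultimately show "s \<in> \<G>" by simp
qed

end

theorem theorem3p8:
  fixes r q n :: nat and m :: "nat \<Rightarrow> nat" and X :: "complex vec set set"
  assumes "r \<ge> 1" and "q \<ge> 1" and "n = q * r + 1"
    and "\<forall>i\<in>{1..r - 1}. 1 \<le> m i \<and> m i \<le> q"
    and "X = richardson r n (v_seq r q m) (w_seq r q)"
  shows "generated_algebra r n X (graded_piece r n X 1) = carrier (inv_ring r n X)"
proof -
  interpret richardson_setup r q n m
    using assms(1-4) by unfold_locales
  show ?thesis
    unfolding assms(5) using generated_subset carrier_subset_generated by (rule subset_antisym)
qed

end
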